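(* Let $\mathcal{N}_{A\to B}$ be a nonzero completely positive linear map (not necessarily trace preserving) and let $\varepsilon\in(0,1)$. Then the one-shot retrocausal classical capacity of $\mathcal{N}$ within error $\varepsilon$ satisfies $$C_{\mathrm{retro}}^{\varepsilon}(\mathcal{N})=\log_2\left\lfloor\frac{\varepsilon}{1-\varepsilon}\,2^{I_{\max}(\mathcal{N})+I_{\mathrm{doe}}(\mathcal{N})}+1\right\rfloor .$$
   Context: All quantum systems are finite-dimensional Hilbert spaces; $d_A\geq 1$ denotes the dimension of system $A$. A state is a positive semidefinite unit-trace operator; $\mathcal{D}_B$ is the set of states of $B$ and $\mathrm{aff}(\mathcal{D}_B)$ is the set of unit-trace Hermitian operators on $B$. A channel is a completely positive trace-preserving linear map. Maps act as the identity on systems not listed in their subscript. Primed systems are isomorphic copies ($A'\cong A$). $\Phi_{AA'}=\frac{1}{d_A}\sum_{i,j}|i\rangle\langle j|_A\otimes|i\rangle\langle j|_{A'}$ is the standard maximally entangled state, and $\pi_A=\mathbb{1}_A/d_A$. For a linear map $\mathcal{N}_{A\to B}$ its Choi operator is $\Phi^{\mathcal{N}}_{A'B}=\mathcal{N}_{A\to B}[\Phi_{A'A}]$. Max-information and Doeblin information of a completely positive map (operator inequalities in the Loewner order, $\inf\emptyset=+\infty$): $$I_{\max}(\mathcal{N})=\inf_{\lambda\in\mathbb{R},\,\sigma_B\in\mathcal{D}_B}\{\log_2\lambda:\Phi^{\mathcal{N}}_{A'B}\leq\lambda\,\pi_{A'}\otimes\sigma_B\},\qquad I_{\mathrm{doe}}(\mathcal{N})=\inf_{\lambda\in\mathbb{R},\,\tau_B\in\mathrm{aff}(\mathcal{D}_B)}\{\log_2\lambda:\pi_{A'}\otimes\tau_B\leq\lambda\,\Phi^{\mathcal{N}}_{A'B}\}.$$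 $I_{\mathrm{doe}}$ may equal $+\infty$; conventions: $2^{\infty}=\lfloor\infty\rfloor=\log_2\infty=\infty$. Loop supermap: for a linear map $\mathcal{T}_{EA\to FA}$ and an operator $\rho_{RE}$ ($R$ any reference system, possibly trivial), $\Gamma_A\{\mathcal{T}_{EA\to FA}\}[\rho_{RE}]=\mathrm{Tr}_{AA'}\big[\Phi_{AA'}\,\mathcal{T}_{EA\to FA}[\rho_{RE}\otimes\Phi_{AA'}]\big]$. Retrocausal communication: a strategy is a pair of channels $(\mathcal{E}_{ML\to A},\mathcal{D}_{B\to\widehat{M}L})$ with $\widehat{M}\cong M$ and $L$ an arbitrary system. Write $\mathcal{G}_{M\to\widehat{M}}=\Gamma_A\{\mathcal{E}_{ML\to A}\circ\mathcal{D}_{B\to\widehat{M}L}\circ\mathcal{N}_{A\to B}\}$, where the composition is viewed as a map from $MA$ to $\widehat{M}A$. With $\{|m\rangle\}_{m=0}^{d_M-1}$ a fixed orthonormal basis of $M$ (and correspondingly of $\widehat{M}$), the worst-case classical error probability is $$p_{\mathrm{error}}((\mathcal{E},\mathcal{D}),\mathcal{N})=1-\min_{0\leq m\leq d_M-1}\frac{\mathrm{Tr}\big[|m\rangle\langle m|_{\widehat{M}}\,\mathcal{G}[|m\rangle\langle m|_M]\big]}{\mathrm{Tr}\big[\mathcal{G}[|m\rangle\langle m|_M]\big]}.$$ Only strategies for which all these denominators are nonzero are considered. The one-shot retrocausal classical capacity is $$C_{\mathrm{retro}}^{\varepsilon}(\mathcal{N})=\sup\{\log_2 d_M: p_{\mathrm{error}}((\mathcal{E}_{ML\to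 A},\mathcal{D}_{B\to\widehat{M}L}),\mathcal{N}_{A\to B})\leq\varepsilon\},$$ the supremum being over all positive integers $d_M,d_L$ and all strategies. *)

theory Defs
  imports
    "Jordan_Normal_Form.Schur_Decomposition"
    "HOL-Library.Extended_Real"
begin

text \<open>
  A system of dimension \<open>d\<close> is represented by its fixed orthonormal basis \<open>0, \<dots>, d - 1\<close>;
  operators on it are elements of \<^term>\<open>carrier_mat d d\<close>.  A composite system \<open>XY\<close> has dimension
  \<open>dX * dY\<close>, and the basis vector \<open>|x\<rangle> \<otimes> |y\<rangle>\<close> has index \<open>x * dY + y\<close>.
\<close>


subsection \<open>Operators\<close>

definition trace_mat :: "complex mat \<Rightarrow> complex" where
  "trace_mat X = (\<Sum>i<dim_row X. X $$ (i, i))"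

definition kron :: "complex mat \<Rightarrow> complex mat \<Rightarrow> complex mat" where
  "kron X Y = mat (dim_row X * dim_row Y) (dim_col X * dim_col Y)
     (\<lambda>(i, j). X $$ (i div dim_row Y, j div dim_col Y) * Y $$ (i mod dim_row Y, j mod dim_col Y))"

text \<open>Trace over the second factor of a \<open>d * e\<close>-dimensional system.\<close>

definition ptrace_snd :: "nat \<Rightarrow> nat \<Rightarrow> complex mat \<Rightarrow> complex mat" where
  "ptrace_snd d e X = mat d d (\<lambda>(i, j). \<Sum>k<e. X $$ (i * e + k, j * e + k))"

text \<open>In the order on \<^typ>\<open>complex\<close>, \<open>0 \<le> z\<close> means that \<open>z\<close> is real and nonnegative, so
  Hermiticity is implied.\<close>

definition psd :: "nat \<Rightarrow> complex mat \<Rightarrow> bool" where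
  "psd d X \<longleftrightarrow> X \<in> carrier_mat d d \<and> (\<forall>v \<in> carrier_vec d. 0 \<le> (X *\<^sub>v v) \<bullet>c v)"

text \<open>The Loewner order; the type class order on \<^typ>\<open>complex mat\<close> is entrywise.\<close>

definition loewner_le :: "nat \<Rightarrow> complex mat \<Rightarrow> complex mat \<Rightarrow> bool" where
  "loewner_le d X Y \<longleftrightarrow> X \<in> carrier_mat d d \<and> Y \<in> carrier_mat d d \<and> psd d (Y - X)"

definition states :: "nat \<Rightarrow> complex mat set" where
  "states d = {\<sigma>. psd d \<sigma> \<and> trace_mat \<sigma> = 1}"

definition aff_states :: "nat \<Rightarrow> complex mat set" where
  "aff_states d = {\<tau> \<in> carrier_mat d d. mat_adjoint \<tau> = \<tau> \<and> trace_mat \<tau> = 1}"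

definition basis_proj :: "nat \<Rightarrow> nat \<Rightarrow> complex mat" where
  "basis_proj d m = mat d d (\<lambda>(i, j). if i = m \<and> j = m then 1 else 0)"

definition max_mixed :: "nat \<Rightarrow> complex mat" where
  "max_mixed d = (1 / of_nat d) \<cdot>\<^sub>m 1\<^sub>m d"

text \<open>\<open>(1/d) \<Sum>i j. |i\<rangle>\<langle>j| \<otimes> |i\<rangle>\<langle>j|\<close>: the entry at row \<open>|i i'\<rangle>\<close> and column
  \<open>|j j'\<rangle>\<close> is \<open>1/d\<close> if \<open>i = i'\<close> and \<open>j = j'\<close>, and \<open>0\<close> otherwise.\<close>

definition max_entangled :: "nat \<Rightarrow> complex mat" where
  "max_entangled d = mat (d * d) (d * d)
     (\<lambda>(r, c). if r div d = r mod d \<and> c div d = c mod d then 1 / of_nat d else 0)"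


subsection \<open>Linear maps on operators\<close>

text \<open>A map from operators on \<open>A\<close> to operators on \<open>B\<close> is a function on \<^typ>\<open>complex mat\<close> of which
  only the values on \<^term>\<open>carrier_mat dA dA\<close> matter.\<close>

type_synonym superop = "complex mat \<Rightarrow> complex mat"

definition linear_superop :: "nat \<Rightarrow> nat \<Rightarrow> superop \<Rightarrow> bool" where
  "linear_superop dA dB N \<longleftrightarrow>
     (\<forall>X \<in> carrier_mat dA dA. N X \<in> carrier_mat dB dB) \<and>
     (\<forall>X \<in> carrier_mat dA dA. \<forall>Y \<in> carrier_mat dA dA. N (X + Y) = N X + N Y) \<and>
     (\<forall>c. \<forall>X \<in> carrier_mat dA dA. N (c \<cdot>\<^sub>m X) = c \<cdot>\<^sub>m N X)"

text \<open>\<open>id\<^sub>R \<otimes> N\<close>, for \<open>N\<close> from operators on \<open>A\<close> to operators on \<open>B\<close>: an operator on \<open>RA\<close> is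
  \<open>\<Sum>r s. |r\<rangle>\<langle>s| \<otimes> X\<^sub>r\<^sub>s\<close>, and \<open>N\<close> is applied to each block \<open>X\<^sub>r\<^sub>s\<close>.\<close>

definition id_tensor :: "nat \<Rightarrow> nat \<Rightarrow> nat \<Rightarrow> superop \<Rightarrow> superop" where
  "id_tensor dR dA dB N X = mat (dR * dB) (dR * dB)
     (\<lambda>(i, j). N (mat dA dA (\<lambda>(a, a'). X $$ ((i div dB) * dA + a, (j div dB) * dA + a')))
        $$ (i mod dB, j mod dB))"

text \<open>\<open>N \<otimes> id\<^sub>R\<close>, from operators on \<open>AR\<close> to operators on \<open>BR\<close>.\<close>

definition tensor_id :: "nat \<Rightarrow> nat \<Rightarrow> nat \<Rightarrow> superop \<Rightarrow> superop" where
  "tensor_id dR dA dB N X = mat (dB * dR) (dB * dR)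
     (\<lambda>(i, j). N (mat dA dA (\<lambda>(a, a'). X $$ (a * dR + i mod dR, a' * dR + j mod dR)))
        $$ (i div dR, j div dR))"

text \<open>The relabelling \<open>XYZ \<rightarrow> YXZ\<close>: \<open>|y x z\<rangle>\<close>, of index \<open>(y * dX + x) * dZ + z\<close>, is sent back to
  \<open>|x y z\<rangle>\<close>.\<close>

definition swap_index :: "nat \<Rightarrow> nat \<Rightarrow> nat \<Rightarrow> nat \<Rightarrow> nat" where
  "swap_index dX dY dZ i =
     (((i div dZ) mod dX) * dY + (i div dZ) div dX) * dZ + i mod dZ"

definition swap_sys :: "nat \<Rightarrow> nat \<Rightarrow> nat \<Rightarrow> superop" where
  "swap_sys dX dY dZ X = mat (dY * dX * dZ) (dY * dX * dZ)
     (\<lambda>(i, j). X $$ (swap_index dX dY dZ i, swap_index dX dY dZ j))"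

definition cp_map :: "nat \<Rightarrow> nat \<Rightarrow> superop \<Rightarrow> bool" where
  "cp_map dA dB N \<longleftrightarrow> linear_superop dA dB N \<and>
     (\<forall>k X. psd (k * dA) X \<longrightarrow> psd (k * dB) (id_tensor k dA dB N X))"

definition channel :: "nat \<Rightarrow> nat \<Rightarrow> superop \<Rightarrow> bool" where
  "channel dA dB N \<longleftrightarrow> cp_map dA dB N \<and>
     (\<forall>X \<in> carrier_mat dA dA. trace_mat (N X) = trace_mat X)"

definition choi :: "nat \<Rightarrow> nat \<Rightarrow> superop \<Rightarrow> complex mat" where
  "choi dA dB N = id_tensor dA dA dB N (max_entangled dA)"


subsection \<open>Extended real arithmetic\<close>

text \<open>Base-2 logarithm, exponential and floor with \<open>log\<^sub>2 \<infinity> = 2\<^sup>\<infinity> = \<lfloor>\<infinity>\<rfloor> = \<infinity>\<close>.  The value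
  \<open>-\<infinity>\<close> of the logarithm at nonpositive arguments is relevant at \<open>0\<close> only.\<close>

definition elog2 :: "ereal \<Rightarrow> ereal" where
  "elog2 x = (case x of ereal r \<Rightarrow> (if r \<le> 0 then -\<infinity> else ereal (log 2 r)) | PInfty \<Rightarrow> \<infinity> | MInfty \<Rightarrow> -\<infinity>)"

definition eexp2 :: "ereal \<Rightarrow> ereal" where
  "eexp2 x = (case x of ereal r \<Rightarrow> ereal (2 powr r) | PInfty \<Rightarrow> \<infinity> | MInfty \<Rightarrow> 0)"

definition efloor :: "ereal \<Rightarrow> ereal" where
  "efloor x = (case x of ereal r \<Rightarrow> ereal (of_int \<lfloor>r\<rfloor>) | PInfty \<Rightarrow> \<infinity> | MInfty \<Rightarrow> -\<infinity>)"


subsection \<open>Max-information and Doeblin information\<close>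

definition I_max :: "nat \<Rightarrow> nat \<Rightarrow> superop \<Rightarrow> ereal" where
  "I_max dA dB N = Inf {elog2 (ereal l) | l \<sigma>. \<sigma> \<in> states dB \<and>
     loewner_le (dA * dB) (choi dA dB N) (complex_of_real l \<cdot>\<^sub>m kron (max_mixed dA) \<sigma>)}"

definition I_doe :: "nat \<Rightarrow> nat \<Rightarrow> superop \<Rightarrow> ereal" where
  "I_doe dA dB N = Inf {elog2 (ereal l) | l \<tau>. \<tau> \<in> aff_states dB \<and>
     loewner_le (dA * dB) (kron (max_mixed dA) \<tau>) (complex_of_real l \<cdot>\<^sub>m choi dA dB N)}"


subsection \<open>Retrocausal communication\<close>

text \<open>For \<open>T\<close> from operators on \<open>EA\<close> to operators on \<open>FA\<close>, the map
  \<open>\<rho> \<mapsto> Tr\<^sub>A\<^sub>A\<^sub>' [\<Phi>\<^sub>A\<^sub>A\<^sub>' T[\<rho> \<otimes> \<Phi>\<^sub>A\<^sub>A\<^sub>']]\<close> from operators on \<open>E\<close> to operators on \<open>F\<close>, where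
  \<open>\<Phi>\<^sub>A\<^sub>A\<^sub>'\<close> and \<open>T\<close> act as the identity on \<open>F\<close> and \<open>A'\<close> respectively.  Its action on an
  operator on \<open>RE\<close> is given by \<^const>\<open>id_tensor\<close>.\<close>

definition loop :: "nat \<Rightarrow> nat \<Rightarrow> nat \<Rightarrow> superop \<Rightarrow> superop" where
  "loop dE dF dA T \<rho> = ptrace_snd dF (dA * dA)
     (kron (1\<^sub>m dF) (max_entangled dA) *
      tensor_id dA (dE * dA) (dF * dA) T (kron \<rho> (max_entangled dA)))"

text \<open>The composition of \<open>N : A \<rightarrow> B\<close>, \<open>D : B \<rightarrow> M'L\<close> and \<open>E : ML \<rightarrow> A\<close> as a map \<open>MA \<rightarrow> M'A\<close>, where
  \<open>M'\<close> is the decoded copy of \<open>M\<close>.  The decoder yields \<open>M M' L\<close>, which is reordered to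
  \<open>M' M L\<close> so that the encoder acts on the last two factors.\<close>

definition retro_comp ::
    "nat \<Rightarrow> nat \<Rightarrow> nat \<Rightarrow> nat \<Rightarrow> superop \<Rightarrow> superop \<Rightarrow> superop \<Rightarrow> superop" where
  "retro_comp dA dB dM dL E D N X =
     id_tensor dM (dM * dL) dA E
       (swap_sys dM dM dL
         (id_tensor dM dB (dM * dL) D
           (id_tensor dM dA dB N X)))"

definition retro_map ::
    "nat \<Rightarrow> nat \<Rightarrow> nat \<Rightarrow> nat \<Rightarrow> superop \<Rightarrow> superop \<Rightarrow> superop \<Rightarrow> superop" where
  "retro_map dA dB dM dL E D N = loop dM dM dA (retro_comp dA dB dM dL E D N)"

definition retro_strategy ::
    "nat \<Rightarrow> nat \<Rightarrow> nat \<Rightarrow> nat \<Rightarrow> superop \<Rightarrow> superop \<Rightarrow> superop \<Rightarrow> bool" where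
  "retro_strategy dA dB dM dL E D N \<longleftrightarrow>
     channel (dM * dL) dA E \<and> channel dB (dM * dL) D \<and>
     (\<forall>m<dM. trace_mat (retro_map dA dB dM dL E D N (basis_proj dM m)) \<noteq> 0)"

definition p_error ::
    "nat \<Rightarrow> nat \<Rightarrow> nat \<Rightarrow> nat \<Rightarrow> superop \<Rightarrow> superop \<Rightarrow> superop \<Rightarrow> real" where
  "p_error dA dB dM dL E D N =
     1 - Min ((\<lambda>m. let Y = retro_map dA dB dM dL E D N (basis_proj dM m)
                    in Re (trace_mat (basis_proj dM m * Y)) / Re (trace_mat Y)) ` {..<dM})"

definition C_retro :: "nat \<Rightarrow> nat \<Rightarrow> real \<Rightarrow> superop \<Rightarrow> ereal" where
  "C_retro dA dB \<epsilon> N = Sup {elog2 (ereal (real dM)) | dM dL E D.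
     1 \<le> dM \<and> 1 \<le> dL \<and> retro_strategy dA dB dM dL E D N \<and> p_error dA dB dM dL E D N \<le> \<epsilon>}"

end

theory Submission
  imports
    "HOL-Analysis.Function_Topology"
    "HOL-Analysis.Topology_Euclidean_Space"
    "HOL-Analysis.Convex"
    Defs
begin

text \<open>
  On classical inputs the loop turns a strategy into numbers \<open>f m m' \<ge> 0\<close>: up to the factor
  \<open>1/dA\<^sup>2\<close>, \<open>f m m'\<close> is the pairing \<open>Tr[J C]\<close> of the unnormalised Choi operator \<open>J\<close> of \<open>N\<close> with
  the completely positive map from \<open>B\<close> to \<open>A\<close> that decodes \<open>m'\<close> and encodes \<open>m\<close>.  Semidefinite
  duality identifies the largest value \<open>U\<close> of \<open>Tr[J C]\<close> over all channels from \<open>B\<close> to \<open>A\<close> with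
  \<open>2 powr I_max\<close>, and the least value \<open>L\<close> with \<open>2 powr - I_doe\<close>; both are attained.

  For the converse, \<open>\<Sum>m. f (g m) m\<close> is such a value for every relabelling \<open>g\<close>.  The identity bounds
  the diagonal of \<open>f\<close> by \<open>U\<close>, and the nontrivial cyclic shifts bound its off-diagonal part from below by
  \<open>(dM - 1) * L\<close>, so error at most \<open>\<epsilon>\<close> forces \<open>(dM - 1) * (1 - \<epsilon>) * L \<le> \<epsilon> * U\<close>.  Conversely, guess
  \<open>m'\<close> uniformly at random and feed \<open>B\<close> back through the maximising channel if \<open>m' = m\<close> and
  through the minimising one otherwise: then \<open>f m m'\<close> is proportional to \<open>U\<close> or to \<open>L\<close>, and the same
  inequality suffices.
\<close>

subsection \<open>Positive semidefinite kernels\<close>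

text \<open>Operators are treated as functions of two indices from a finite set, so that composite
  systems are Cartesian products and arithmetic with matrix indices stays confined to the
  translation. Strong duality needs no separation theorem. Once an optimal channel is known to
  exist, its first-order condition is dual feasibility of an operator computed from it, and equality
  of the two values is an identity. This operator is a priori only Hermitian, which is what
  \<open>aff_states\<close> asks for in the Doeblin information; for the max-information its
  positivity follows from \<open>1 \<otimes> S \<ge> J \<ge> 0\<close>. The trace of the loop output
  depends on the message, so the success probability is a ratio with varying denominators. Clearing
  them gives conditions linear in \<open>f\<close> that can be added over the messages. Solved for
  \<open>dM\<close>, the resulting inequality is
  \<open>dM \<le> \<epsilon> / (1 - \<epsilon>) * (U / L) + 1\<close>; the 1 reflects that the
  trivial shift belongs to the diagonal. If \<open>L = 0\<close>, every number of messages is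
  reached, in agreement with \<open>I_doe = \<infinity>\<close>.\<close>

lemma sum_swap4:
  "(\<Sum>a\<in>A. \<Sum>b\<in>B. \<Sum>c\<in>C. \<Sum>d\<in>D. F a b c d) = (\<Sum>c\<in>C. \<Sum>d\<in>D. \<Sum>a\<in>A. \<Sum>b\<in>B. F a b c d)"
proof -
  have "(\<Sum>p\<in>A \<times> B. \<Sum>r\<in>C \<times> D. F (fst p) (snd p) (fst r) (snd r)) =
      (\<Sum>r\<in>C \<times> D. \<Sum>p\<in>A \<times> B. F (fst p) (snd p) (fst r) (snd r))"
    by (rule sum.swap)
  then show ?thesis
    by (simp only: sum.cartesian_product'[of _ A B] sum.cartesian_product'[of _ C D] fst_conv snd_conv)
qed

text \<open>The conjugate sits on the second vector, so that pairing a kernel with the rank-one kernel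
  \<open>x p * cnj (x q)\<close> evaluates its form at \<open>x\<close>; no transposition is needed below.\<close>

definition sesq :: "'i set \<Rightarrow> ('i \<Rightarrow> 'i \<Rightarrow> complex) \<Rightarrow> ('i \<Rightarrow> complex) \<Rightarrow> ('i \<Rightarrow> complex) \<Rightarrow> complex" where
  "sesq I K v w = (\<Sum>p\<in>I. \<Sum>q\<in>I. v p * cnj (w q) * K p q)"

definition psd_kernel :: "'i set \<Rightarrow> ('i \<Rightarrow> 'i \<Rightarrow> complex) \<Rightarrow> bool" where
  "psd_kernel I K \<longleftrightarrow> (\<forall>v. 0 \<le> sesq I K v v)"

definition pairing :: "'i set \<Rightarrow> ('i \<Rightarrow> 'i \<Rightarrow> complex) \<Rightarrow> ('i \<Rightarrow> 'i \<Rightarrow> complex) \<Rightarrow> complex" where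
  "pairing I K L = (\<Sum>p\<in>I. \<Sum>q\<in>I. K p q * L p q)"

definition hermitian_kernel :: "'i set \<Rightarrow> ('i \<Rightarrow> 'i \<Rightarrow> complex) \<Rightarrow> bool" where
  "hermitian_kernel I K \<longleftrightarrow> (\<forall>p\<in>I. \<forall>q\<in>I. K q p = cnj (K p q))"

lemma hermitian_kernelD: "hermitian_kernel I K \<Longrightarrow> p \<in> I \<Longrightarrow> q \<in> I \<Longrightarrow> K q p = cnj (K p q)"
  unfolding hermitian_kernel_def by (drule (1) bspec)+

lemma hermitian_kernel_uminus:
  assumes "hermitian_kernel I K"
  shows "hermitian_kernel I (\<lambda>p q. - K p q)"
  unfolding hermitian_kernel_def
proof (intro ballI)
  fix p q assume "p \<in> I" "q \<in> I"
  from hermitian_kernelD[OF assms this] show "- K q p = cnj (- K p q)" by simp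
qed

lemma sesq_cong:
  assumes "\<And>p q. p \<in> I \<Longrightarrow> q \<in> I \<Longrightarrow> K p q = L p q" "\<And>p. p \<in> I \<Longrightarrow> v p = v' p" "\<And>p. p \<in> I \<Longrightarrow> w p = w' p"
  shows "sesq I K v w = sesq I L v' w'"
  unfolding sesq_def using assms by (intro sum.cong) auto

lemma psd_kernel_cong:
  assumes "\<And>p q. p \<in> I \<Longrightarrow> q \<in> I \<Longrightarrow> K p q = L p q"
  shows "psd_kernel I K \<longleftrightarrow> psd_kernel I L"
proof -
  have "sesq I K v v = sesq I L v v" for v by (rule sesq_cong) (simp_all add: assms)
  then show ?thesis by (simp add: psd_kernel_def)
qed

lemma pairing_cong:
  assumes "\<And>p q. p \<in> I \<Longrightarrow> q \<in> I \<Longrightarrow> K p q = K' p q" "\<And>p q. p \<in> I \<Longrightarrow> q \<in> I \<Longrightarrow> L p q = L' p q"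
  shows "pairing I K L = pairing I K' L'"
  unfolding pairing_def using assms by (intro sum.cong) auto

lemma psd_kernel_add: "psd_kernel I K \<Longrightarrow> psd_kernel I L \<Longrightarrow> psd_kernel I (\<lambda>p q. K p q + L p q)"
proof -
  assume a: "psd_kernel I K" "psd_kernel I L"
  have "sesq I (\<lambda>p q. K p q + L p q) v v = sesq I K v v + sesq I L v v" for v
    by (simp add: sesq_def algebra_simps sum.distrib)
  with a show ?thesis by (simp add: psd_kernel_def)
qed

lemma psd_kernel_zero: "psd_kernel I (\<lambda>p q. 0)"
  by (simp add: psd_kernel_def sesq_def)

lemma psd_kernel_sum: "(\<And>t. t \<in> T \<Longrightarrow> psd_kernel I (K t)) \<Longrightarrow> psd_kernel I (\<lambda>p q. \<Sum>t\<in>T. K t p q)"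
  by (induction T rule: infinite_finite_induct) (auto intro: psd_kernel_add psd_kernel_zero)

lemma psd_kernel_scale: "psd_kernel I K \<Longrightarrow> 0 \<le> r \<Longrightarrow> psd_kernel I (\<lambda>p q. r * K p q)"
proof -
  assume a: "psd_kernel I K" "0 \<le> r"
  have "sesq I (\<lambda>p q. r * K p q) v v = r * sesq I K v v" for v
    by (simp add: sesq_def sum_distrib_left mult_ac)
  with a show ?thesis by (auto simp: psd_kernel_def less_eq_complex_def)
qed

lemma mult_cnj_nonneg: "0 \<le> z * cnj z"
  by (simp add: less_eq_complex_def)

lemma psd_kernel_rank_one: "psd_kernel I (\<lambda>p q. x p * cnj (x q))"
proof -
  have "sesq I (\<lambda>p q. x p * cnj (x q)) v v = (\<Sum>p\<in>I. v p * x p) * cnj (\<Sum>p\<in>I. v p * x p)" for v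
    by (simp add: sesq_def sum_product mult_ac)
  then show ?thesis by (simp only: psd_kernel_def mult_cnj_nonneg simp_thms)
qed

lemma psd_kernel_subset:
  assumes "finite I" "psd_kernel I K" "I' \<subseteq> I"
  shows "psd_kernel I' K"
  unfolding psd_kernel_def
proof
  fix v :: "'a \<Rightarrow> complex"
  define w where "w p = (if p \<in> I' then v p else 0)" for p
  have "sesq I K w w = (\<Sum>p\<in>I'. \<Sum>q\<in>I. w p * cnj (w q) * K p q)"
    unfolding sesq_def by (rule sum.mono_neutral_right[OF assms(1,3)]) (simp add: w_def)
  also have "\<dots> = sesq I' K w w"
    unfolding sesq_def
  proof (rule sum.cong[OF refl])
    fix p
    show "(\<Sum>q\<in>I. w p * cnj (w q) * K p q) = (\<Sum>q\<in>I'. w p * cnj (w q) * K p q)"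
      by (rule sum.mono_neutral_right[OF assms(1,3)]) (simp add: w_def)
  qed
  also have "\<dots> = sesq I' K v v" by (rule sesq_cong) (simp_all add: w_def)
  moreover have "0 \<le> sesq I K w w" using assms(2) by (simp add: psd_kernel_def)
  ultimately show "0 \<le> sesq I' K v v" by simp
qed

lemma psd_kernel_two_point:
  assumes "finite I" "psd_kernel I K" "p \<in> I" "q \<in> I" "p \<noteq> q"
  shows "0 \<le> z * cnj z * K p p + z * cnj w * K p q + w * cnj z * K q p + w * cnj w * K q q"
proof -
  have "psd_kernel {p, q} K" by (rule psd_kernel_subset[OF assms(1,2)]) (use assms in auto)
  then have "0 \<le> sesq {p, q} K (\<lambda>r. if r = p then z else w) (\<lambda>r. if r = p then z else w)"
    by (simp add: psd_kernel_def)
  then show ?thesis using assms(5) by (auto simp: sesq_def algebra_simps)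
qed

lemma psd_kernel_diag:
  assumes "finite I" "psd_kernel I K" "p \<in> I"
  shows "0 \<le> K p p"
proof -
  have "psd_kernel {p} K" by (rule psd_kernel_subset[OF assms(1,2)]) (use assms in auto)
  then have "0 \<le> sesq {p} K (\<lambda>r. 1) (\<lambda>r. 1)" by (simp add: psd_kernel_def)
  then show ?thesis by (simp add: sesq_def)
qed

text \<open>Symmetry is not built into \<open>psd_kernel\<close>. The order on complex numbers
  forces the form to be real, and polarisation with the vectors (1, 1) and (1, i) on two points
  turns this into symmetry of the entries.\<close>

lemma psd_kernel_hermitian:
  assumes "finite I" "psd_kernel I K" "p \<in> I" "q \<in> I"
  shows "K q p = cnj (K p q)"
proof (cases "p = q")
  case True
  then show ?thesis
    using psd_kernel_diag[OF assms(1-3)] by (simp add: less_eq_complex_def complex_eq_iff)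
next
  case False
  note two = psd_kernel_two_point[OF assms False]
  have "Im (K p p) = 0" "Im (K q q) = 0"
    using psd_kernel_diag[OF assms(1,2,3)] psd_kernel_diag[OF assms(1,2,4)] by (simp_all add: less_eq_complex_def)
  moreover have "Im (K p q) + Im (K q p) = 0" 
    using two[of 1 1] calculation by (simp add: less_eq_complex_def)
  moreover have "Re (K q p) - Re (K p q) = 0" 
    using two[of 1 \<i>] calculation by (simp add: less_eq_complex_def)
  ultimately show ?thesis by (simp add: complex_eq_iff)
qed

lemma psd_kernel_imp_hermitian_kernel: "finite I \<Longrightarrow> psd_kernel I K \<Longrightarrow> hermitian_kernel I K"
  unfolding hermitian_kernel_def by (intro ballI) (rule psd_kernel_hermitian)

lemma psd_kernel_zero_diag:
  assumes "finite I" "psd_kernel I K" "p \<in> I" "q \<in> I" "K p p = 0"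
  shows "K p q = 0"
proof (rule ccontr)
  assume nz: "K p q \<noteq> 0"
  then have "p \<noteq> q" using assms(5) by auto
  note two = psd_kernel_two_point[OF assms(1-4) this]
  have h: "K q p = cnj (K p q)" by (rule psd_kernel_hermitian[OF assms(1-4)])
  define m where "m = (cmod (K p q))\<^sup>2"
  have m: "K p q * cnj (K p q) = of_real m" "m > 0"
    using nz by (simp_all add: m_def flip: complex_norm_square)
  \<comment> \<open>As \<open>K p p = 0\<close>, the form at \<open>z = - t * cnj (K p q)\<close>,
    \<open>w = 1\<close> is affine in \<open>t\<close>, namely \<open>K q q - 2 * t * m\<close>;
    this \<open>t\<close> brings it to \<open>- K q q - 2 < 0\<close>.\<close>
  define t where "t = (Re (K q q) + 1) / m"
  have "0 \<le> - (of_real t * cnj (K p q)) * K p q + - (of_real t * K p q) * cnj (K p q) + K q q"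
    using two[of "- of_real t * cnj (K p q)" 1] by (simp add: assms(5) h)
  also have "\<dots> = of_real (- 2 * t * m) + K q q"
    using m(1) by (simp add: algebra_simps)
  finally have "0 \<le> - 2 * t * m + Re (K q q)" by (simp add: less_eq_complex_def)
  moreover have "t * m = Re (K q q) + 1" using m(2) by (simp add: t_def)
  moreover have "0 \<le> Re (K q q)" using psd_kernel_diag[OF assms(1,2,4)] by (simp add: less_eq_complex_def)
  ultimately show False by simp
qed

lemma psd_kernel_schur_complement:
  assumes "finite I" "x \<notin> I" "psd_kernel (insert x I) K" "K x x \<noteq> 0"
  shows "psd_kernel I (\<lambda>p q. K p q - K p x * K x q / K x x)"
  unfolding psd_kernel_def
proof
  fix v :: "'a \<Rightarrow> complex"
  define s where "s = (\<Sum>p\<in>I. v p * K p x)"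
  have h: "K x q = cnj (K q x)" if "q \<in> I" for q
    using psd_kernel_hermitian[OF _ assms(3), of q x] assms(1) that by simp
  have k: "cnj (K x x) = K x x" using psd_kernel_hermitian[OF _ assms(3), of x x] assms(1) by simp
  have cs: "(\<Sum>q\<in>I. cnj (v q) * K x q) = cnj s"
    by (simp add: s_def h)
  \<comment> \<open>Among all extensions of \<open>v\<close> to \<open>x\<close> this one minimises
    the form of \<open>K\<close>; completing the square leaves the form of the Schur complement at
    \<open>v\<close>.\<close>
  define w where "w p = (if p = x then - s / K x x else v p)" for p
  have w: "w p = v p" if "p \<in> I" for p using assms(2) that by (auto simp: w_def)
  have wx: "w x = - s / K x x" by (simp add: w_def)
  have "sesq (insert x I) K w w = w x * cnj (w x) * K x x + w x * (\<Sum>q\<in>I. cnj (v q) * K x q)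
     + cnj (w x) * (\<Sum>p\<in>I. v p * K p x) + sesq I K v v"
    using assms(1,2) w by (simp add: sesq_def sum.distrib sum_distrib_left mult_ac cong: sum.cong)
  also have "\<dots> = sesq I K v v - s * cnj s / K x x"
    using assms(4) by (simp add: cs s_def[symmetric] wx k field_simps)
  also have "s * cnj s / K x x = (\<Sum>p\<in>I. \<Sum>q\<in>I. v p * cnj (v q) * (K p x * K x q / K x x))"
    unfolding cs[symmetric] unfolding s_def
    by (simp add: sum_product sum_divide_distrib mult_ac)
  also have "sesq I K v v - \<dots> = sesq I (\<lambda>p q. K p q - K p x * K x q / K x x) v v"
    by (simp add: sesq_def sum_subtractf algebra_simps)
  finally show "0 \<le> sesq I (\<lambda>p q. K p q - K p x * K x q / K x x) v v"
    using assms(3) by (metis psd_kernel_def)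
qed

text \<open>A Cholesky decomposition: one index is eliminated at a time by passing to the Schur complement.\<close>

lemma psd_kernel_gram:
  assumes "finite I" "psd_kernel I K"
  obtains c :: "'i \<Rightarrow> 'i \<Rightarrow> complex"
  where "\<And>p q. p \<in> I \<Longrightarrow> q \<in> I \<Longrightarrow> K p q = (\<Sum>t\<in>I. c t p * cnj (c t q))"
proof -
  have "\<exists>c :: 'i \<Rightarrow> 'i \<Rightarrow> complex. \<forall>p\<in>I. \<forall>q\<in>I. K p q = (\<Sum>t\<in>I. c t p * cnj (c t q))"
    using assms
  proof (induction I arbitrary: K rule: finite_induct)
    case (insert x I)
    let ?I = "insert x I"
    have fin: "finite ?I" using insert by simp
    have herm: "K q p = cnj (K p q)" if "p \<in> ?I" "q \<in> ?I" for p q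
      by (rule psd_kernel_hermitian[OF fin insert.prems that])
    show ?case
    proof (cases "K x x = 0")
      case True
      have z: "K x q = 0" "K q x = 0" if "q \<in> ?I" for q
        using psd_kernel_zero_diag[OF fin insert.prems _ that True] herm[of x q] that by auto
      have "psd_kernel I K" by (rule psd_kernel_subset[OF fin insert.prems]) auto
      then obtain c where c: "\<And>p q. p \<in> I \<Longrightarrow> q \<in> I \<Longrightarrow> K p q = (\<Sum>t\<in>I. c t p * cnj (c t q))"
        using insert.IH[of K] by auto
      show ?thesis
        using insert.hyps by (intro exI[of _ "\<lambda>t p. if t = x \<or> p = x then 0 else c t p"])
          (auto simp: z c sum.insert intro!: sum.cong)
    next
      case False
      define \<kappa> where "\<kappa> = Re (K x x)"
      have K: "K x x = of_real \<kappa>" "0 < \<kappa>"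
        using psd_kernel_diag[OF fin insert.prems, of x] False
        by (auto simp: \<kappa>_def less_eq_complex_def complex_eq_iff)
      have "psd_kernel I (\<lambda>p q. K p q - K p x * K x q / K x x)"
        by (rule psd_kernel_schur_complement[OF insert.hyps insert.prems False])
      from insert.IH[OF this] obtain c where
        c: "\<And>p q. p \<in> I \<Longrightarrow> q \<in> I \<Longrightarrow> K p q - K p x * K x q / K x x = (\<Sum>t\<in>I. c t p * cnj (c t q))"
        by blast
      have c': "K p q = K p x * K x q / K x x + (\<Sum>t\<in>I. c t p * cnj (c t q))" if "p \<in> I" "q \<in> I" for p q
        using c[OF that] by (simp add: algebra_simps)
      have sq: "complex_of_real (sqrt \<kappa>) * complex_of_real (sqrt \<kappa>) = of_real \<kappa>"
        using K(2) by (simp flip: of_real_mult)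
      \<comment> \<open>The vector with index \<open>x\<close> is the pivot column over the root of
        the pivot; the vectors of the Schur complement are extended by zero at
        \<open>x\<close>.\<close>
      let ?c = "\<lambda>t p. if t = x then K p x / of_real (sqrt \<kappa>) else if p = x then 0 else c t p"
      have "K p q = (\<Sum>t\<in>?I. ?c t p * cnj (?c t q))" if pq: "p \<in> ?I" "q \<in> ?I" for p q
      proof -
        have "(\<Sum>t\<in>?I. ?c t p * cnj (?c t q)) = K p x * K x q / K x x + (\<Sum>t\<in>I. ?c t p * cnj (?c t q))"
          using insert.hyps herm[OF pq(2), of x] by (simp add: sq K(1))
        also have "(\<Sum>t\<in>I. ?c t p * cnj (?c t q)) = 
           (if p = x \<or> q = x then 0 else (\<Sum>t\<in>I. c t p * cnj (c t q)))"
          using insert.hyps by (auto intro!: sum.cong sum.neutral)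
        finally have *: "(\<Sum>t\<in>?I. ?c t p * cnj (?c t q)) = K p x * K x q / K x x +
           (if p = x \<or> q = x then 0 else (\<Sum>t\<in>I. c t p * cnj (c t q)))" .
        show ?thesis
        proof (cases "p = x \<or> q = x")
          case True
          then show ?thesis unfolding * using False by auto
        next
          case F: False
          then have "p \<in> I" "q \<in> I" using pq by auto
          from c'[OF this] show ?thesis unfolding * using F by simp
        qed
      qed
      then show ?thesis by (intro exI[of _ ?c] ballI)
    qed
  qed simp
  then obtain c :: "'i \<Rightarrow> 'i \<Rightarrow> complex"
    where "\<forall>p\<in>I. \<forall>q\<in>I. K p q = (\<Sum>t\<in>I. c t p * cnj (c t q))" ..
  then show ?thesis by (intro that[of c]) simp
qed

text \<open>Congruence by a weighted reindexing, seen on Gram vectors. As \<open>h\<close> may be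
  non-injective and has to land in \<open>I\<close> only where the weight is nonzero, the same rule
  yields restrictions, blocks, corners and direct summands.\<close>

lemma psd_kernel_pullback:
  assumes "finite I" "psd_kernel I K" and h: "\<And>p. p \<in> I' \<Longrightarrow> g p \<noteq> 0 \<Longrightarrow> h p \<in> I"
  shows "psd_kernel I' (\<lambda>p q. g p * cnj (g q) * K (h p) (h q))"
proof -
  obtain c where c: "\<And>p q. p \<in> I \<Longrightarrow> q \<in> I \<Longrightarrow> K p q = (\<Sum>t\<in>I. c t p * cnj (c t q))"
    using psd_kernel_gram[OF assms(1,2)] by blast
  have "psd_kernel I' (\<lambda>p q. \<Sum>t\<in>I. (g p * c t (h p)) * cnj (g q * c t (h q)))"
    by (intro psd_kernel_sum psd_kernel_rank_one)
  also have "?this \<longleftrightarrow> ?thesis"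
  proof (rule psd_kernel_cong)
    fix p q assume pq: "p \<in> I'" "q \<in> I'"
    show "(\<Sum>t\<in>I. (g p * c t (h p)) * cnj (g q * c t (h q))) = g p * cnj (g q) * K (h p) (h q)"
    proof (cases "g p = 0 \<or> g q = 0")
      case False
      then show ?thesis using c[OF h[OF pq(1)] h[OF pq(2)]] by (simp add: sum_distrib_left mult_ac)
    qed auto
  qed
  finally show ?thesis .
qed

section \<open>The bilinear pairing of kernels\<close>

lemma pairing_rank_one: "pairing I K (\<lambda>p q. x p * cnj (x q)) = sesq I K x x"
  by (simp add: pairing_def sesq_def mult_ac)

lemma pairing_sum_right: "pairing I K (\<lambda>p q. \<Sum>t\<in>T. L t p q) = (\<Sum>t\<in>T. pairing I K (L t))"
proof -
  have "(\<Sum>p\<in>I. \<Sum>q\<in>I. \<Sum>t\<in>T. K p q * L t p q) = (\<Sum>p\<in>I. \<Sum>t\<in>T. \<Sum>q\<in>I. K p q * L t p q)"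
    by (intro sum.cong refl sum.swap)
  also have "\<dots> = (\<Sum>t\<in>T. \<Sum>p\<in>I. \<Sum>q\<in>I. K p q * L t p q)" by (rule sum.swap)
  finally show ?thesis by (simp add: pairing_def sum_distrib_left)
qed

lemma pairing_add_right: "pairing I K (\<lambda>p q. L p q + L' p q) = pairing I K L + pairing I K L'"
  by (simp add: pairing_def sum.distrib algebra_simps)

lemma pairing_scale_right: "pairing I K (\<lambda>p q. z * L p q) = z * pairing I K L"
  by (simp add: pairing_def sum_distrib_left algebra_simps)

lemma pairing_diff_left: "pairing I (\<lambda>p q. K p q - K' p q) L = pairing I K L - pairing I K' L"
  by (simp add: pairing_def sum_subtractf algebra_simps)

lemma pairing_gram: "pairing I K (\<lambda>p q. \<Sum>t\<in>T. c t p * cnj (c t q)) = (\<Sum>t\<in>T. sesq I K (c t) (c t))"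
  by (simp add: pairing_sum_right pairing_rank_one)

text \<open>A Gram decomposition of one kernel makes the pairing a sum of values of the form of the
  other. All weak-duality bounds rest on this.\<close>

lemma pairing_nonneg:
  assumes "finite I" "psd_kernel I K" "psd_kernel I L"
  shows "0 \<le> pairing I K L"
proof -
  obtain c where c: "\<And>p q. p \<in> I \<Longrightarrow> q \<in> I \<Longrightarrow> L p q = (\<Sum>t\<in>I. c t p * cnj (c t q))"
    using psd_kernel_gram[OF assms(1,3)] by blast
  have "pairing I K L = (\<Sum>t\<in>I. sesq I K (c t) (c t))"
    unfolding pairing_gram[symmetric] by (rule pairing_cong) (simp_all add: c)
  then show ?thesis using assms(2) by (simp add: psd_kernel_def sum_nonneg)
qed

subsection \<open>Semidefinite duality for channels\<close>

text \<open>The entry at \<open>(a, b)\<close>, \<open>(a', b')\<close> stands for \<open>\<langle>a| P(|b\<rangle>\<langle>b'|) |a'\<rangle>\<close> with a channel \<open>P\<close> from \<open>B\<close>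
  to \<open>A\<close>: the output index comes first.\<close>

definition channel_kernel :: "'a set \<Rightarrow> 'b set \<Rightarrow> ('a \<times> 'b \<Rightarrow> 'a \<times> 'b \<Rightarrow> complex) \<Rightarrow> bool" where
  "channel_kernel A B C \<longleftrightarrow> psd_kernel (A \<times> B) C \<and>
     (\<forall>b\<in>B. \<forall>b'\<in>B. (\<Sum>a\<in>A. C (a, b) (a, b')) = (if b = b' then 1 else 0))"

text \<open>The operator \<open>1 \<otimes> S\<close>, where \<open>S\<close> acts as the multiplier
  of trace preservation: its pairing with a channel kernel is the trace of \<open>S\<close>,
  whatever the channel.\<close>

definition one_tensor :: "('b \<Rightarrow> 'b \<Rightarrow> complex) \<Rightarrow> 'a \<times> 'b \<Rightarrow> 'a \<times> 'b \<Rightarrow> complex" where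
  "one_tensor S p q = (if fst p = fst q then S (snd p) (snd q) else 0)"

definition gram_kernel :: "'t set \<Rightarrow> ('t \<Rightarrow> 'i \<Rightarrow> complex) \<Rightarrow> 'i \<Rightarrow> 'i \<Rightarrow> complex" where
  "gram_kernel T c p q = (\<Sum>t\<in>T. c t p * cnj (c t q))"

lemma psd_kernel_gram_kernel: "psd_kernel I (gram_kernel T c)"
  unfolding gram_kernel_def by (intro psd_kernel_sum psd_kernel_rank_one)

lemma pairing_gram_kernel: "pairing I K (gram_kernel T c) = (\<Sum>t\<in>T. sesq I K (c t) (c t))"
  unfolding gram_kernel_def by (rule pairing_gram)

lemma sum_delta_mult:
  assumes "finite A" "a \<in> A"
  shows "(\<Sum>a'\<in>A. if a = a' then f a' else 0) = (f a :: complex)"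
  using assms by simp

lemma sesq_one_tensor:
  assumes "finite A"
  shows "sesq (A \<times> B) (one_tensor S) v w = (\<Sum>a\<in>A. \<Sum>b\<in>B. \<Sum>b'\<in>B. v (a, b) * cnj (w (a, b')) * S b b')"
proof -
  have "(\<Sum>a'\<in>A. \<Sum>b'\<in>B. v (a, b) * cnj (w (a', b')) * one_tensor S (a, b) (a', b')) =
      (\<Sum>b'\<in>B. v (a, b) * cnj (w (a, b')) * S b b')" if "a \<in> A" for a b
  proof -
    have "(\<Sum>a'\<in>A. \<Sum>b'\<in>B. v (a, b) * cnj (w (a', b')) * one_tensor S (a, b) (a', b')) =
      (\<Sum>a'\<in>A. if a = a' then \<Sum>b'\<in>B. v (a, b) * cnj (w (a', b')) * S b b' else 0)"
      by (intro sum.cong refl) (simp add: one_tensor_def)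
    also have "\<dots> = (\<Sum>b'\<in>B. v (a, b) * cnj (w (a, b')) * S b b')"
      by (rule sum_delta_mult[OF assms that])
    finally show ?thesis .
  qed
  then show ?thesis
    unfolding sesq_def sum.cartesian_product' by (simp cong: sum.cong)
qed

lemma pairing_one_tensor:
  assumes "finite A" "finite B" "channel_kernel A B C"
  shows "pairing (A \<times> B) (one_tensor S) C = (\<Sum>b\<in>B. S b b)"
proof -
  have 1: "(\<Sum>a'\<in>A. \<Sum>b'\<in>B. one_tensor S (a, b) (a', b') * C (a, b) (a', b')) =
      (\<Sum>b'\<in>B. S b b' * C (a, b) (a, b'))" if "a \<in> A" for a b
  proof -
    have "(\<Sum>a'\<in>A. \<Sum>b'\<in>B. one_tensor S (a, b) (a', b') * C (a, b) (a', b')) =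
      (\<Sum>a'\<in>A. if a = a' then \<Sum>b'\<in>B. S b b' * C (a, b) (a', b') else 0)"
      by (intro sum.cong refl) (simp add: one_tensor_def)
    also have "\<dots> = (\<Sum>b'\<in>B. S b b' * C (a, b) (a, b'))"
      by (rule sum_delta_mult[OF assms(1) that])
    finally show ?thesis .
  qed
  have "pairing (A \<times> B) (one_tensor S) C = (\<Sum>a\<in>A. \<Sum>b\<in>B. \<Sum>b'\<in>B. S b b' * C (a, b) (a, b'))"
    unfolding pairing_def sum.cartesian_product' by (simp add: 1 cong: sum.cong)
  also have "\<dots> = (\<Sum>b\<in>B. \<Sum>a\<in>A. \<Sum>b'\<in>B. S b b' * C (a, b) (a, b'))" by (rule sum.swap)
  also have "\<dots> = (\<Sum>b\<in>B. \<Sum>b'\<in>B. S b b' * (\<Sum>a\<in>A. C (a, b) (a, b')))"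
    unfolding sum_distrib_left by (intro sum.cong refl sum.swap)
  also have "\<dots> = (\<Sum>b\<in>B. \<Sum>b'\<in>B. if b = b' then S b b' else 0)"
    using assms(3) unfolding channel_kernel_def by (intro sum.cong refl) simp
  also have "\<dots> = (\<Sum>b\<in>B. S b b)" using assms(2) by simp
  finally show ?thesis .
qed

section \<open>Existence of an optimal channel\<close>

lemma compact_cball_functions: "compact {e :: 'i \<Rightarrow> complex. \<forall>x. norm (e x) \<le> 1}"
proof -
  \<comment> \<open>Tychonoff's theorem allows an arbitrary index type, so families of Gram factors
    need no finite-dimensional model.\<close>
  have "compactin (product_topology (\<lambda>_. euclidean) UNIV) (PiE (UNIV :: 'i set) (\<lambda>_. cball (0::complex) 1))"
    by (subst compactin_PiE) simp
  then have "compact (PiE (UNIV :: 'i set) (\<lambda>_. cball (0::complex) 1))"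
    by (simp add: euclidean_product_topology)
  moreover have "PiE (UNIV :: 'i set) (\<lambda>_. cball (0::complex) 1) = {e. \<forall>x. norm (e x) \<le> 1}"
    by (auto simp: PiE_def Pi_def)
  ultimately show ?thesis by simp
qed

text \<open>Compactness is used for the Gram factors of a kernel rather than the kernel itself: for them
  positivity is automatic and only closed trace conditions remain.\<close>

lemma channel_kernel_optimal:
  fixes H :: "'a \<times> 'b \<Rightarrow> 'a \<times> 'b \<Rightarrow> complex"
  assumes "finite A" "finite B" "A \<noteq> {}"
  obtains c :: "'a \<times> 'b \<Rightarrow> 'a \<times> 'b \<Rightarrow> complex"
  where "channel_kernel A B (gram_kernel (A \<times> B) c)"
    and "\<And>C. channel_kernel A B C \<Longrightarrow> Re (pairing (A \<times> B) H C) \<le> Re (pairing (A \<times> B) H (gram_kernel (A \<times> B) c))"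
proof -
  let ?I = "A \<times> B"
  define tr :: "(('a \<times> 'b) \<times> ('a \<times> 'b) \<Rightarrow> complex) \<Rightarrow> 'b \<Rightarrow> 'b \<Rightarrow> complex"
    where "tr e b b' = (\<Sum>a\<in>A. gram_kernel ?I (\<lambda>t p. e (t, p)) (a, b) (a, b'))" for e b b'
  define F where "F = {e. \<forall>x. norm (e x) \<le> 1} \<inter>
     (\<Inter>b\<in>B. \<Inter>b'\<in>B. {e. tr e b b' = (if b = b' then 1 else 0)})"
  have cont: "continuous_on UNIV (\<lambda>e :: ('a \<times> 'b) \<times> ('a \<times> 'b) \<Rightarrow> complex. e x)" for x
    by (rule continuous_on_product_coordinates)
  have "closed {e. tr e b b' = (if b = b' then 1 else 0)}" for b b'
    unfolding tr_def gram_kernel_def by (intro closed_Collect_eq continuous_intros cont)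
  then have comp: "compact F" unfolding F_def
    by (intro compact_Int_closed compact_cball_functions closed_INT ballI)
  obtain a0 where a0: "a0 \<in> A" using assms(3) by auto
  \<comment> \<open>A feasible point: the channel that discards its input and prepares
    \<open>|a0><a0|\<close>.\<close>
  define e0 where "e0 = (\<lambda>(t :: 'a \<times> 'b, p :: 'a \<times> 'b). if t = p \<and> fst p = a0 then 1 else 0 :: complex)"
  have "tr e0 b b' = (if b = b' then 1 else 0)" if "b \<in> B" "b' \<in> B" for b b'
  proof -
    have "tr e0 b b' = (\<Sum>a\<in>A. \<Sum>t\<in>?I. if (a, b) = t then (if a = a0 \<and> b = b' then 1 else 0) else 0)"
      unfolding tr_def gram_kernel_def e0_def by (intro sum.cong refl) auto
    also have "\<dots> = (\<Sum>a\<in>A. if a = a0 \<and> b = b' then 1 else 0)"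
      using assms that by (intro sum.cong refl) (simp add: sum_delta_mult)
    also have "\<dots> = (if b = b' then 1 else 0)" using assms a0 by simp
    finally show ?thesis .
  qed
  then have "e0 \<in> F" by (auto simp: F_def e0_def)
  then have ne: "F \<noteq> {}" by auto
  let ?v = "\<lambda>e. Re (pairing ?I H (gram_kernel ?I (\<lambda>t p. e (t, p))))"
  have "continuous_on F ?v"
    unfolding pairing_def gram_kernel_def
    by (intro continuous_intros continuous_on_subset[OF cont]) auto
  from continuous_attains_sup[OF comp ne this] obtain e
    where e: "e \<in> F" "\<And>e'. e' \<in> F \<Longrightarrow> ?v e' \<le> ?v e" by blast
  show ?thesis
  proof (rule that[of "\<lambda>t p. e (t, p)"])
    show "channel_kernel A B (gram_kernel ?I (\<lambda>t p. e (t, p)))"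
      unfolding channel_kernel_def using e(1) by (auto simp: psd_kernel_gram_kernel F_def tr_def)
    fix C assume C: "channel_kernel A B C"
    obtain c where c: "\<And>p q. p \<in> ?I \<Longrightarrow> q \<in> ?I \<Longrightarrow> C p q = (\<Sum>t\<in>?I. c t p * cnj (c t q))"
      using psd_kernel_gram[of ?I C] C assms by (auto simp: channel_kernel_def)
    \<comment> \<open>Membership in \<open>F\<close> bounds the factors at all indices, also at
      those outside \<open>A \<times> B\<close>, where nothing is known about
      \<open>c\<close>.\<close>
    define e' where "e' = (\<lambda>(t, p). if t \<in> ?I \<and> p \<in> ?I then c t p else 0)"
    have Ce: "gram_kernel ?I (\<lambda>t p. e' (t, p)) p q = C p q" if "p \<in> ?I" "q \<in> ?I" for p q
      using that c[OF that] by (simp add: gram_kernel_def e'_def cong: sum.cong)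
    have tr: "tr e' b b' = (if b = b' then 1 else 0)" if "b \<in> B" "b' \<in> B" for b b'
      using C that unfolding tr_def channel_kernel_def by (simp add: Ce cong: sum.cong)
    have bd: "norm (e' (t, p)) \<le> 1" for t p
    proof (cases "t \<in> ?I \<and> p \<in> ?I")
      case True
      obtain a b where p: "p = (a, b)" "a \<in> A" "b \<in> B" using True by auto
      \<comment> \<open>By the diagonal trace condition the squared moduli of the factors at a fixed
        \<open>b\<close> add up to 1, so the unit ball excludes no channel.\<close>
      have "1 = Re (tr e' b b)" using tr p by simp
      also have "\<dots> = (\<Sum>a\<in>A. \<Sum>t\<in>?I. (norm (e' (t, (a, b))))\<^sup>2)"
        by (simp add: tr_def gram_kernel_def complex_norm_square[symmetric] del: of_real_power)
      finally have le1: "(\<Sum>a\<in>A. \<Sum>t\<in>?I. (norm (e' (t, (a, b))))\<^sup>2) = 1" by simp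
      have "(\<Sum>t\<in>?I. (norm (e' (t, (a, b))))\<^sup>2) \<le> 1" unfolding le1[symmetric]
        using assms(1) p(2) by (intro member_le_sum[of a A "\<lambda>a. \<Sum>t\<in>?I. (norm (e' (t, (a, b))))\<^sup>2"]) (auto intro: sum_nonneg)
      moreover have "(norm (e' (t, (a, b))))\<^sup>2 \<le> (\<Sum>t\<in>?I. (norm (e' (t, (a, b))))\<^sup>2)"
        using assms True by (intro member_le_sum[of t ?I "\<lambda>t. (norm (e' (t, (a, b))))\<^sup>2"]) auto
      ultimately have "(norm (e' (t, p)))\<^sup>2 \<le> 1" by (simp add: p(1))
      then show ?thesis by (simp add: abs_square_le_1)
    qed (auto simp: e'_def)
    have "e' \<in> F" using tr bd by (auto simp: F_def)
    from e(2)[OF this]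
    show "Re (pairing ?I H C) \<le> Re (pairing ?I H (gram_kernel ?I (\<lambda>t p. e (t, p))))"
      using pairing_cong[of ?I H H "gram_kernel ?I (\<lambda>t p. e' (t, p))" C] Ce by simp
  qed
qed

section \<open>First-order optimality and the dual operator\<close>

lemma sesq_diff_left: "sesq I K (\<lambda>p. v p - z * v' p) w = sesq I K v w - z * sesq I K v' w"
  unfolding sesq_def sum_distrib_left sum_subtractf[symmetric]
  by (rule sum.cong[OF refl], rule sum.cong[OF refl]) (simp add: left_diff_distrib mult.assoc)

lemma sesq_diff_right: "sesq I K v (\<lambda>p. w p - z * w' p) = sesq I K v w - cnj z * sesq I K v w'"
  unfolding sesq_def sum_distrib_left sum_subtractf[symmetric]
  by (rule sum.cong[OF refl], rule sum.cong[OF refl]) (simp add: left_diff_distrib right_diff_distrib mult_ac)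

lemma sesq_cnj:
  assumes "hermitian_kernel I K"
  shows "sesq I K w v = cnj (sesq I K v w)"
proof -
  have "sesq I K w v = (\<Sum>p\<in>I. \<Sum>q\<in>I. cnj (v q * cnj (w p) * K q p))"
    unfolding sesq_def
  proof (intro sum.cong refl)
    fix p q assume "p \<in> I" "q \<in> I"
    from hermitian_kernelD[OF assms this] show "w p * cnj (v q) * K p q = cnj (v q * cnj (w p) * K q p)" by simp
  qed
  also have "\<dots> = (\<Sum>q\<in>I. \<Sum>p\<in>I. cnj (v q * cnj (w p) * K q p))" by (rule sum.swap)
  finally show ?thesis by (simp add: sesq_def)
qed

lemma first_order_nonpos:
  fixes a b :: real
  assumes "\<And>e. 0 < e \<Longrightarrow> e * a + e\<^sup>2 * b \<le> 0"
  shows "a \<le> 0"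
proof (rule ccontr)
  assume "\<not> a \<le> 0"
  then have a: "a > 0" by simp
  define e where "e = a / (2 * (\<bar>b\<bar> + 1))"
  have e: "e > 0" using a by (simp add: e_def)
  have "e * (a + e * b) \<le> 0" using assms[OF e] by (simp add: power2_eq_square algebra_simps)
  then have "a + e * b \<le> 0" using e by (simp add: mult_le_0_iff)
  moreover have "- (e * b) \<le> e * (\<bar>b\<bar> + 1)"
  proof -
    have "- b \<le> \<bar>b\<bar> + 1" by linarith
    then have "e * (- b) \<le> e * (\<bar>b\<bar> + 1)" using e by (intro mult_left_mono) auto
    then show ?thesis by simp
  qed
  moreover have "e * (\<bar>b\<bar> + 1) = a / 2" unfolding e_def by (simp add: field_simps)
  ultimately show False using a by linarith
qed

lemma norm_sum_mult_le:
  fixes v w :: "'i \<Rightarrow> complex"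
  shows "(norm (\<Sum>i\<in>I. v i * w i))\<^sup>2 \<le> (\<Sum>i\<in>I. (norm (v i))\<^sup>2) * (\<Sum>i\<in>I. (norm (w i))\<^sup>2)"
proof -
  have "norm (\<Sum>i\<in>I. v i * w i) \<le> (\<Sum>i\<in>I. norm (v i) * norm (w i))"
    using norm_sum[of "\<lambda>i. v i * w i" I] by (simp add: norm_mult)
  then have "(norm (\<Sum>i\<in>I. v i * w i))\<^sup>2 \<le> (\<Sum>i\<in>I. norm (v i) * norm (w i))\<^sup>2"
    by (intro power_mono) auto
  also have "\<dots> \<le> (\<Sum>i\<in>I. (norm (v i))\<^sup>2) * (\<Sum>i\<in>I. (norm (w i))\<^sup>2)"
    by (rule Cauchy_Schwarz_ineq_sum)
  finally show ?thesis .
qed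

text \<open>By Cauchy-Schwarz the squared Frobenius norm of \<open>X\<close> dominates the form of
  its square. The 1/4 comes from the half in the perturbation of the Kraus vectors for which
  \<open>\<kappa>\<close> is designed.\<close>

lemma psd_kernel_bounded_minus_square:
  fixes X :: "'b \<Rightarrow> 'b \<Rightarrow> complex"
  assumes "finite B"
  defines "\<kappa> \<equiv> (\<Sum>\<beta>\<in>B. \<Sum>b\<in>B. (norm (X b \<beta>))\<^sup>2) / 4"
  shows "psd_kernel B (\<lambda>b b'. (if b = b' then of_real \<kappa> else 0) - (\<Sum>\<beta>\<in>B. X b \<beta> * cnj (X b' \<beta>)) / 4)"
  unfolding psd_kernel_def
proof
  fix v :: "'b \<Rightarrow> complex"
  let ?G = "\<lambda>b b'. (if b = b' then of_real \<kappa> else 0) - (\<Sum>\<beta>\<in>B. X b \<beta> * cnj (X b' \<beta>)) / 4"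
  have 1: "(\<Sum>b\<in>B. \<Sum>b'\<in>B. v b * cnj (v b') * (if b = b' then of_real \<kappa> else 0))
      = of_real \<kappa> * of_real (\<Sum>b\<in>B. (norm (v b))\<^sup>2)"
  proof -
    have "(\<Sum>b\<in>B. \<Sum>b'\<in>B. v b * cnj (v b') * (if b = b' then of_real \<kappa> else 0)) =
       (\<Sum>b\<in>B. \<Sum>b'\<in>B. if b = b' then v b * cnj (v b) * of_real \<kappa> else 0)"
      by (intro sum.cong refl) auto
    also have "\<dots> = (\<Sum>b\<in>B. v b * cnj (v b) * of_real \<kappa>)" using assms(1) by simp
    finally show ?thesis by (simp add: sum_distrib_left mult_ac flip: complex_norm_square)
  qed
  have "(\<Sum>b\<in>B. \<Sum>b'\<in>B. v b * cnj (v b') * (\<Sum>\<beta>\<in>B. X b \<beta> * cnj (X b' \<beta>))) =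
     (\<Sum>b\<in>B. \<Sum>b'\<in>B. \<Sum>\<beta>\<in>B. (v b * X b \<beta>) * cnj (v b' * X b' \<beta>))"
    by (simp add: sum_distrib_left mult_ac)
  also have "\<dots> = (\<Sum>b\<in>B. \<Sum>\<beta>\<in>B. \<Sum>b'\<in>B. (v b * X b \<beta>) * cnj (v b' * X b' \<beta>))"
    by (rule sum.cong[OF refl], rule sum.swap)
  also have "\<dots> = (\<Sum>\<beta>\<in>B. \<Sum>b\<in>B. \<Sum>b'\<in>B. (v b * X b \<beta>) * cnj (v b' * X b' \<beta>))"
    by (rule sum.swap)
  also have "\<dots> = (\<Sum>\<beta>\<in>B. (\<Sum>b\<in>B. v b * X b \<beta>) * cnj (\<Sum>b\<in>B. v b * X b \<beta>))"
    by (simp add: sum_product)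
  also have "\<dots> = of_real (\<Sum>\<beta>\<in>B. (norm (\<Sum>b\<in>B. v b * X b \<beta>))\<^sup>2)"
    by (simp only: of_real_sum complex_norm_square)
  finally have 2: "(\<Sum>b\<in>B. \<Sum>b'\<in>B. v b * cnj (v b') * (\<Sum>\<beta>\<in>B. X b \<beta> * cnj (X b' \<beta>))) =
     of_real (\<Sum>\<beta>\<in>B. (norm (\<Sum>b\<in>B. v b * X b \<beta>))\<^sup>2)" .
  have lin: "sesq B (\<lambda>b b'. f b b' - g b b' / 4) v v =
     (\<Sum>b\<in>B. \<Sum>b'\<in>B. v b * cnj (v b') * f b b') - (\<Sum>b\<in>B. \<Sum>b'\<in>B. v b * cnj (v b') * g b b') / 4" for f g
    by (simp add: sesq_def right_diff_distrib sum_subtractf sum_divide_distrib)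
  have *: "sesq B ?G v v =
      of_real (\<kappa> * (\<Sum>b\<in>B. (norm (v b))\<^sup>2) - (\<Sum>\<beta>\<in>B. (norm (\<Sum>b\<in>B. v b * X b \<beta>))\<^sup>2) / 4)"
    unfolding lin 1 2 by simp
  have "(\<Sum>\<beta>\<in>B. (norm (\<Sum>b\<in>B. v b * X b \<beta>))\<^sup>2) \<le>
     (\<Sum>\<beta>\<in>B. (\<Sum>b\<in>B. (norm (v b))\<^sup>2) * (\<Sum>b\<in>B. (norm (X b \<beta>))\<^sup>2))"
    by (intro sum_mono norm_sum_mult_le)
  also have "\<dots> = 4 * (\<kappa> * (\<Sum>b\<in>B. (norm (v b))\<^sup>2))"
    by (simp add: \<kappa>_def sum_distrib_left mult_ac)
  finally have "0 \<le> \<kappa> * (\<Sum>b\<in>B. (norm (v b))\<^sup>2) - (\<Sum>\<beta>\<in>B. (norm (\<Sum>b\<in>B. v b * X b \<beta>))\<^sup>2) / 4"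
    by simp
  then show "0 \<le> sesq B ?G v v" unfolding * by (simp add: less_eq_complex_def)
qed

lemma psd_kernel_corner:
  assumes "finite B" "psd_kernel B G"
  shows "psd_kernel (A \<times> B) (\<lambda>p q. if fst p = a0 \<and> fst q = a0 then G (snd p) (snd q) else 0)"
proof -
  let ?g = "\<lambda>p. if fst p = a0 then 1 else 0 :: complex"
  have "psd_kernel (A \<times> B) (\<lambda>p q. ?g p * cnj (?g q) * G (snd p) (snd q))"
    by (rule psd_kernel_pullback[OF assms]) auto
  also have "?this \<longleftrightarrow> ?thesis"
    by (rule psd_kernel_cong) simp
  finally show ?thesis .
qed

text \<open>The Kraus vectors \<open>c t\<close> of an optimal channel are perturbed to \<open>c t - (e/2) X c t\<close>, where
  \<open>X = Tr\<^sub>A |x\<rangle>\<langle>x|\<close>, and \<open>e |x\<rangle>\<langle>x|\<close> is added.  The partial trace becomes \<open>1 + e\<^sup>2 X\<^sup>2/4\<close>; adding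
  \<open>e\<^sup>2 |a0\<rangle>\<langle>a0| \<otimes> (\<kappa> - X\<^sup>2/4)\<close> and dividing by \<open>1 + e\<^sup>2 \<kappa>\<close> makes it exactly \<open>1\<close>.  The claim is
  the first-order condition at \<open>e = 0\<close>.\<close>

lemma channel_kernel_stationary:
  fixes H :: "'a \<times> 'b \<Rightarrow> 'a \<times> 'b \<Rightarrow> complex" and c :: "'t \<Rightarrow> 'a \<times> 'b \<Rightarrow> complex" and x :: "'a \<times> 'b \<Rightarrow> complex"
  assumes fin: "finite A" "finite B" and ne: "A \<noteq> {}"
    and herm: "hermitian_kernel (A \<times> B) H"
    and feas: "channel_kernel A B (gram_kernel T c)"
    and opt: "\<And>C. channel_kernel A B C \<Longrightarrow> Re (pairing (A \<times> B) H C) \<le> Re (pairing (A \<times> B) H (gram_kernel T c))"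
  defines "X \<equiv> \<lambda>b \<beta>. \<Sum>a\<in>A. x (a, b) * cnj (x (a, \<beta>))"
  defines "y \<equiv> \<lambda>t p. \<Sum>\<beta>\<in>B. X (snd p) \<beta> * c t (fst p, \<beta>)"
  shows "Re (sesq (A \<times> B) H x x) \<le> Re (\<Sum>t\<in>T. sesq (A \<times> B) H (y t) (c t))"
proof -
  let ?I = "A \<times> B"
  obtain a0 where a0: "a0 \<in> A" using ne by auto
  have hX: "cnj (X b \<beta>) = X \<beta> b" for b \<beta> by (simp add: X_def mult_ac)
  have cc: "(\<Sum>a\<in>A. \<Sum>t\<in>T. c t (a, b) * cnj (c t (a, b'))) = (if b = b' then 1 else 0)"
    if "b \<in> B" "b' \<in> B" for b b'
    using feas that by (simp add: channel_kernel_def gram_kernel_def)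
  have left: "(\<Sum>a\<in>A. \<Sum>t\<in>T. y t (a, b) * cnj (w t (a, b'))) =
     (\<Sum>\<beta>\<in>B. X b \<beta> * (\<Sum>a\<in>A. \<Sum>t\<in>T. c t (a, \<beta>) * cnj (w t (a, b'))))" for w :: "'t \<Rightarrow> 'a \<times> 'b \<Rightarrow> complex" and b b'
  proof -
    have "(\<Sum>a\<in>A. \<Sum>t\<in>T. y t (a, b) * cnj (w t (a, b'))) =
       (\<Sum>a\<in>A. \<Sum>t\<in>T. \<Sum>\<beta>\<in>B. X b \<beta> * (c t (a, \<beta>) * cnj (w t (a, b'))))"
      by (simp add: y_def sum_distrib_right sum_distrib_left mult_ac)
    also have "\<dots> = (\<Sum>a\<in>A. \<Sum>\<beta>\<in>B. \<Sum>t\<in>T. X b \<beta> * (c t (a, \<beta>) * cnj (w t (a, b'))))"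
      by (intro sum.cong refl sum.swap)
    also have "\<dots> = (\<Sum>\<beta>\<in>B. \<Sum>a\<in>A. \<Sum>t\<in>T. X b \<beta> * (c t (a, \<beta>) * cnj (w t (a, b'))))"
      by (rule sum.swap)
    finally show ?thesis by (simp add: sum_distrib_left)
  qed
  \<comment> \<open>Since the \<open>c t\<close> have partial trace 1, each of the two cross terms
    has partial trace \<open>X\<close>. With weight \<open>- e / 2\<close> each, they cancel the
    contribution \<open>e * X\<close> of the added rank-one kernel.\<close>
  have yc: "(\<Sum>a\<in>A. \<Sum>t\<in>T. y t (a, b) * cnj (c t (a, b'))) = X b b'" if "b \<in> B" "b' \<in> B" for b b'
  proof -
    have "(\<Sum>a\<in>A. \<Sum>t\<in>T. y t (a, b) * cnj (c t (a, b'))) = (\<Sum>\<beta>\<in>B. if b' = \<beta> then X b \<beta> else 0)"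
      unfolding left using that by (intro sum.cong refl) (simp add: cc)
    also have "\<dots> = X b b'" using fin that by (simp add: sum_delta_mult)
    finally show ?thesis .
  qed
  have cy: "(\<Sum>a\<in>A. \<Sum>t\<in>T. c t (a, b) * cnj (y t (a, b'))) = X b b'" if "b \<in> B" "b' \<in> B" for b b'
  proof -
    have "(\<Sum>a\<in>A. \<Sum>t\<in>T. c t (a, b) * cnj (y t (a, b'))) = cnj (\<Sum>a\<in>A. \<Sum>t\<in>T. y t (a, b') * cnj (c t (a, b)))"
      by (simp add: mult_ac)
    then show ?thesis using that by (simp only: yc hX)
  qed
  define Z where "Z b b' = (\<Sum>\<beta>\<in>B. X b \<beta> * cnj (X b' \<beta>))" for b b'
  have yy: "(\<Sum>a\<in>A. \<Sum>t\<in>T. y t (a, b) * cnj (y t (a, b'))) = Z b b'" if "b \<in> B" "b' \<in> B" for b b'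
    unfolding left Z_def using that by (intro sum.cong refl) (simp add: cy hX)
  define \<kappa> where "\<kappa> = (\<Sum>\<beta>\<in>B. \<Sum>b\<in>B. (norm (X b \<beta>))\<^sup>2) / 4"
  have \<kappa>: "0 \<le> \<kappa>" by (simp add: \<kappa>_def sum_nonneg)
  define G where "G b b' = (if b = b' then of_real \<kappa> else 0) - Z b b' / 4" for b b'
  have psdG: "psd_kernel B G"
    using psd_kernel_bounded_minus_square[OF fin(2), of X] unfolding G_def[abs_def] Z_def \<kappa>_def .
  define g where "g p q = (if fst p = a0 \<and> fst q = a0 then G (snd p) (snd q) else 0)" for p q :: "'a \<times> 'b"
  have psdg: "psd_kernel ?I g"
    unfolding g_def[abs_def] by (rule psd_kernel_corner[OF fin(2) psdG])
  have trg: "(\<Sum>a\<in>A. g (a, b) (a, b')) = G b b'" for b b'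
    using fin a0 by (simp add: g_def)
  define V where "V = Re (pairing ?I H (gram_kernel T c))"
  have V: "V = Re (\<Sum>t\<in>T. sesq ?I H (c t) (c t))" by (simp add: V_def pairing_gram_kernel)
  \<comment> \<open>The left-hand side is the value of the perturbed channel minus \<open>V\<close>,
    multiplied by \<open>1 + e\<^sup>2 * \<kappa>\<close>. Normalisation enters at second order
    only, so the coefficient of \<open>e\<close> is the claimed difference.\<close>
  have key: "e * (Re (sesq ?I H x x) - Re (\<Sum>t\<in>T. sesq ?I H (y t) (c t)))
     + e\<^sup>2 * (Re (\<Sum>t\<in>T. sesq ?I H (y t) (y t)) / 4 + Re (pairing ?I H g) - \<kappa> * V) \<le> 0" if e: "e > 0" for e :: real
  proof -
    define ce where "ce t p = c t p - of_real (e / 2) * y t p" for t p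
    define r where "r = 1 / (1 + e\<^sup>2 * \<kappa>)"
    have r: "0 \<le> r" "r * (1 + e\<^sup>2 * \<kappa>) = 1" "r > 0" using \<kappa> by (simp_all add: r_def add_nonneg_eq_0_iff add_pos_nonneg)
    define Ce where "Ce p q = of_real r * ((gram_kernel T ce p q + of_real e * (x p * cnj (x q))) + of_real (e\<^sup>2) * g p q)" for p q
    have "channel_kernel A B Ce"
      unfolding channel_kernel_def
    proof (intro conjI ballI)
      show "psd_kernel ?I Ce"
        unfolding Ce_def[abs_def] using r(1) e
        by (intro psd_kernel_scale psd_kernel_add psd_kernel_gram_kernel psdg psd_kernel_rank_one) (auto simp: less_eq_complex_def)
      fix b b' assume b: "b \<in> B" "b' \<in> B"
      have "(\<Sum>a\<in>A. gram_kernel T ce (a, b) (a, b')) = (\<Sum>a\<in>A. \<Sum>t\<in>T. c t (a, b) * cnj (c t (a, b')))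
         - of_real (e / 2) * (\<Sum>a\<in>A. \<Sum>t\<in>T. y t (a, b) * cnj (c t (a, b')))
         - of_real (e / 2) * (\<Sum>a\<in>A. \<Sum>t\<in>T. c t (a, b) * cnj (y t (a, b')))
         + of_real (e / 2) * of_real (e / 2) * (\<Sum>a\<in>A. \<Sum>t\<in>T. y t (a, b) * cnj (y t (a, b')))"
        unfolding gram_kernel_def ce_def sum_distrib_left sum_subtractf[symmetric] sum.distrib[symmetric]
        by (intro sum.cong refl) (simp add: algebra_simps)
      also have "\<dots> = (if b = b' then 1 else 0) - of_real e * X b b' + of_real (e\<^sup>2 / 4) * Z b b'"
        using b by (simp add: cc yc cy yy power2_eq_square)
      finally have 1: "(\<Sum>a\<in>A. gram_kernel T ce (a, b) (a, b')) = \<dots>" .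
      have "(\<Sum>a\<in>A. Ce (a, b) (a, b')) = of_real r * ((\<Sum>a\<in>A. gram_kernel T ce (a, b) (a, b'))
          + of_real e * X b b' + of_real (e\<^sup>2) * G b b')"
        unfolding Ce_def X_def trg[symmetric] by (simp add: sum.distrib sum_distrib_left algebra_simps)
      also have "\<dots> = (if b = b' then of_real (r * (1 + e\<^sup>2 * \<kappa>)) else 0)"
        unfolding 1 G_def by (simp add: algebra_simps)
      finally show "(\<Sum>a\<in>A. Ce (a, b) (a, b')) = (if b = b' then 1 else 0)" by (simp add: r(2))
    qed
    from opt[OF this] have le: "Re (pairing ?I H Ce) \<le> V" by (simp add: V_def)
    have "pairing ?I H Ce = of_real r * ((\<Sum>t\<in>T. sesq ?I H (ce t) (ce t)) + of_real e * sesq ?I H x x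
        + of_real (e\<^sup>2) * pairing ?I H g)"
      unfolding Ce_def[abs_def] pairing_scale_right pairing_add_right pairing_gram_kernel pairing_rank_one by (rule refl)
    moreover have "Re (sesq ?I H (ce t) (ce t)) = Re (sesq ?I H (c t) (c t)) - e * Re (sesq ?I H (y t) (c t))
        + e\<^sup>2 / 4 * Re (sesq ?I H (y t) (y t))" for t
    proof -
      have s1: "sesq ?I H (ce t) (ce t) = sesq ?I H (c t) (c t) - of_real (e / 2) * sesq ?I H (y t) (c t)
         - of_real (e / 2) * (sesq ?I H (c t) (y t) - of_real (e / 2) * sesq ?I H (y t) (y t))"
        unfolding ce_def[abs_def] sesq_diff_left sesq_diff_right by (simp add: algebra_simps)
      \<comment> \<open>The cross terms are conjugate because \<open>H\<close> is Hermitian; the two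
        halves therefore add up to the full first-order term.\<close>
      have s2: "Re (sesq ?I H (c t) (y t)) = Re (sesq ?I H (y t) (c t))"
        by (subst sesq_cnj[OF herm]) simp_all
      show ?thesis unfolding s1 using s2 by (simp add: field_simps power2_eq_square)
    qed
    ultimately have "Re (pairing ?I H Ce) = r * (V - e * Re (\<Sum>t\<in>T. sesq ?I H (y t) (c t))
       + e\<^sup>2 / 4 * Re (\<Sum>t\<in>T. sesq ?I H (y t) (y t)) + e * Re (sesq ?I H x x) + e\<^sup>2 * Re (pairing ?I H g))"
      by (simp add: V sum.distrib sum_subtractf sum_distrib_left)
    with le have "r * (V - e * Re (\<Sum>t\<in>T. sesq ?I H (y t) (c t))
       + e\<^sup>2 / 4 * Re (\<Sum>t\<in>T. sesq ?I H (y t) (y t)) + e * Re (sesq ?I H x x) + e\<^sup>2 * Re (pairing ?I H g))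
       \<le> r * ((1 + e\<^sup>2 * \<kappa>) * V)" 
      using r(2) by (simp add: mult.assoc[symmetric])
    then show ?thesis unfolding mult_le_cancel_left_pos[OF r(3)] by (simp add: algebra_simps)
  qed
  from first_order_nonpos[OF key] show ?thesis by simp
qed


text \<open>Strong duality with both optima attained: the multiplier is computed from an optimal
  channel, the stationarity inequality for all \<open>x\<close> is its feasibility, and its trace is
  the optimal value. As \<open>H\<close> may have any sign, applying this to \<open>- H\<close>
  gives the minimum.\<close>

lemma channel_kernel_duality:
  fixes H :: "'a \<times> 'b \<Rightarrow> 'a \<times> 'b \<Rightarrow> complex"
  assumes fin: "finite A" "finite B" and ne: "A \<noteq> {}"
    and herm: "hermitian_kernel (A \<times> B) H"
  obtains C S where "channel_kernel A B C" and "hermitian_kernel B S"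
    and "psd_kernel (A \<times> B) (\<lambda>p q. one_tensor S p q - H p q)"
    and "(\<Sum>b\<in>B. S b b) = pairing (A \<times> B) H C"
proof -
  let ?I = "A \<times> B"
  obtain c :: "'a \<times> 'b \<Rightarrow> 'a \<times> 'b \<Rightarrow> complex"
    where feas: "channel_kernel A B (gram_kernel ?I c)"
      and opt: "\<And>C. channel_kernel A B C \<Longrightarrow> Re (pairing ?I H C) \<le> Re (pairing ?I H (gram_kernel ?I c))"
    using channel_kernel_optimal[OF fin ne, of H] by metis
  \<comment> \<open>For the optimal kernel \<open>C\<close> this is the sum of
    \<open>C (a, \<beta>) q * H (a, b) q\<close> over \<open>a\<close> and \<open>q\<close>, a
    partial trace over \<open>A\<close> of a product of \<open>H\<close> and \<open>C\<close>. It is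
    what remains of the right-hand side of the stationarity condition once \<open>X\<close> is
    factored out.\<close>
  define Y where "Y b \<beta> = (\<Sum>t\<in>?I. \<Sum>a\<in>A. \<Sum>q\<in>?I. c t (a, \<beta>) * cnj (c t q) * H (a, b) q)" for b \<beta>
  \<comment> \<open>Passing to the Hermitian part preserves the real part of the form, which
    stationarity controls, and that of the trace, which is the real optimal value.\<close>
  define S where "S b b' = (Y b b' + cnj (Y b' b)) / 2" for b b'
  have real: "Im (sesq ?I H v v) = 0" for v
  proof -
    have "sesq ?I H v v = cnj (sesq ?I H v v)" by (rule sesq_cnj[OF herm])
    then show ?thesis by (metis Im_complex_of_real Reals_cnj_iff complex_is_Real_iff)
  qed
  have hS: "hermitian_kernel B S" by (simp add: hermitian_kernel_def S_def add.commute)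
  have rS: "sesq ?I (one_tensor S) x x = of_real (Re (sesq ?I (one_tensor Y) x x))" for x
  proof -
    have "sesq ?I (one_tensor (\<lambda>b b'. cnj (Y b' b))) x x = cnj (sesq ?I (one_tensor Y) x x)"
    proof -
      have "cnj (sesq ?I (one_tensor Y) x x) = (\<Sum>a\<in>A. \<Sum>b\<in>B. \<Sum>b'\<in>B. cnj (x (a, b) * cnj (x (a, b')) * Y b b'))"
        unfolding sesq_one_tensor[OF fin(1)] by simp
      also have "\<dots> = (\<Sum>a\<in>A. \<Sum>b'\<in>B. \<Sum>b\<in>B. cnj (x (a, b) * cnj (x (a, b')) * Y b b'))"
        by (rule sum.cong[OF refl], rule sum.swap)
      finally show ?thesis unfolding sesq_one_tensor[OF fin(1)] by (simp add: mult_ac)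
    qed
    moreover have "sesq ?I (one_tensor S) x x =
       (sesq ?I (one_tensor Y) x x + sesq ?I (one_tensor (\<lambda>b b'. cnj (Y b' b))) x x) / 2"
      unfolding sesq_one_tensor[OF fin(1)] S_def sum.distrib[symmetric] sum_divide_distrib
      by (intro sum.cong refl) (simp add: algebra_simps)
    ultimately show ?thesis by (simp add: complex_eq_iff)
  qed
  have leY: "Re (sesq ?I H x x) \<le> Re (sesq ?I (one_tensor Y) x x)" for x
  proof -
    define X where "X b \<beta> = (\<Sum>a\<in>A. x (a, b) * cnj (x (a, \<beta>)))" for b \<beta>
    define y where "y t p = (\<Sum>\<beta>\<in>B. X (snd p) \<beta> * c t (fst p, \<beta>))" for t p
    have "Re (sesq ?I H x x) \<le> Re (\<Sum>t\<in>?I. sesq ?I H (y t) (c t))"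
      using channel_kernel_stationary[OF fin ne herm feas opt, of x] by (simp only: X_def y_def[abs_def])
    also have "(\<Sum>t\<in>?I. sesq ?I H (y t) (c t)) =
       (\<Sum>t\<in>?I. \<Sum>a\<in>A. \<Sum>b\<in>B. \<Sum>\<beta>\<in>B. X b \<beta> * (\<Sum>q\<in>?I. c t (a, \<beta>) * cnj (c t q) * H (a, b) q))"
    proof -
      have "sesq ?I H (y t) (c t) = 
        (\<Sum>a\<in>A. \<Sum>b\<in>B. \<Sum>\<beta>\<in>B. X b \<beta> * (\<Sum>q\<in>?I. c t (a, \<beta>) * cnj (c t q) * H (a, b) q))" for t
      proof -
        have "(\<Sum>q\<in>?I. y t (a, b) * cnj (c t q) * H (a, b) q) = 
          (\<Sum>\<beta>\<in>B. X b \<beta> * (\<Sum>q\<in>?I. c t (a, \<beta>) * cnj (c t q) * H (a, b) q))" for a b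
        proof -
          have "(\<Sum>q\<in>?I. y t (a, b) * cnj (c t q) * H (a, b) q) =
            (\<Sum>q\<in>?I. \<Sum>\<beta>\<in>B. X b \<beta> * (c t (a, \<beta>) * cnj (c t q) * H (a, b) q))"
            by (simp add: y_def sum_distrib_right mult.assoc)
          also have "\<dots> = (\<Sum>\<beta>\<in>B. \<Sum>q\<in>?I. X b \<beta> * (c t (a, \<beta>) * cnj (c t q) * H (a, b) q))"
            by (rule sum.swap)
          finally show ?thesis by (simp only: sum_distrib_left)
        qed
        then show ?thesis
          unfolding sesq_def by (subst sum.cartesian_product') (simp only:)
      qed
      then show ?thesis by (simp only:)
    qed
    also have "\<dots> = (\<Sum>b\<in>B. \<Sum>\<beta>\<in>B. X b \<beta> * Y b \<beta>)"
    proof -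
      have sw: "(\<Sum>t\<in>?I. \<Sum>a\<in>A. \<Sum>b\<in>B. \<Sum>\<beta>\<in>B. F t a b \<beta>) = (\<Sum>b\<in>B. \<Sum>\<beta>\<in>B. \<Sum>t\<in>?I. \<Sum>a\<in>A. F t a b \<beta>)"
        for F :: "'a \<times> 'b \<Rightarrow> 'a \<Rightarrow> 'b \<Rightarrow> 'b \<Rightarrow> complex"
        by (rule sum_swap4)
      show ?thesis unfolding sw Y_def by (simp only: sum_distrib_left)
    qed
    also have "\<dots> = sesq ?I (one_tensor Y) x x"
    proof -
      have "(\<Sum>b\<in>B. \<Sum>\<beta>\<in>B. X b \<beta> * Y b \<beta>) = (\<Sum>b\<in>B. \<Sum>\<beta>\<in>B. \<Sum>a\<in>A. x (a, b) * cnj (x (a, \<beta>)) * Y b \<beta>)"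
        by (simp only: X_def sum_distrib_right)
      also have "\<dots> = (\<Sum>b\<in>B. \<Sum>a\<in>A. \<Sum>\<beta>\<in>B. x (a, b) * cnj (x (a, \<beta>)) * Y b \<beta>)"
        by (rule sum.cong[OF refl], rule sum.swap)
      also have "\<dots> = (\<Sum>a\<in>A. \<Sum>b\<in>B. \<Sum>\<beta>\<in>B. x (a, b) * cnj (x (a, \<beta>)) * Y b \<beta>)"
        by (rule sum.swap)
      finally show ?thesis by (simp only: sesq_one_tensor[OF fin(1)])
    qed
    finally show ?thesis .
  qed
  have psd: "psd_kernel ?I (\<lambda>p q. one_tensor S p q - H p q)"
  proof -
    have "sesq ?I (\<lambda>p q. one_tensor S p q - H p q) v v = of_real (Re (sesq ?I (one_tensor Y) v v) - Re (sesq ?I H v v))" for v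
    proof -
      have "sesq ?I (\<lambda>p q. one_tensor S p q - H p q) v v = sesq ?I (one_tensor S) v v - sesq ?I H v v"
        by (simp add: sesq_def sum_subtractf right_diff_distrib)
      also have "sesq ?I H v v = of_real (Re (sesq ?I H v v))" using real[of v] by (simp add: complex_eq_iff)
      finally show ?thesis unfolding rS by simp
    qed
    then show ?thesis using leY by (simp add: psd_kernel_def less_eq_complex_def)
  qed
  have trY: "(\<Sum>b\<in>B. Y b b) = pairing ?I H (gram_kernel ?I c)"
  proof -
    have "(\<Sum>b\<in>B. Y b b) = (\<Sum>t\<in>?I. \<Sum>b\<in>B. \<Sum>a\<in>A. \<Sum>q\<in>?I. c t (a, b) * cnj (c t q) * H (a, b) q)"
      unfolding Y_def by (rule sum.swap)
    also have "\<dots> = (\<Sum>t\<in>?I. \<Sum>a\<in>A. \<Sum>b\<in>B. \<Sum>q\<in>?I. c t (a, b) * cnj (c t q) * H (a, b) q)"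
      by (rule sum.cong[OF refl], rule sum.swap)
    also have "\<dots> = (\<Sum>t\<in>?I. sesq ?I H (c t) (c t))"
      unfolding sesq_def by (rule sum.cong[OF refl]) (subst sum.cartesian_product'[of _ A B], simp only:)
    finally show ?thesis by (simp only: pairing_gram_kernel)
  qed
  have "(\<Sum>b\<in>B. S b b) = pairing ?I H (gram_kernel ?I c)"
  proof -
    have "Im (pairing ?I H (gram_kernel ?I c)) = 0" by (simp add: pairing_gram_kernel real)
    then have "cnj (pairing ?I H (gram_kernel ?I c)) = pairing ?I H (gram_kernel ?I c)" by (simp add: complex_eq_iff)
    moreover have "(\<Sum>b\<in>B. S b b) = ((\<Sum>b\<in>B. Y b b) + cnj (\<Sum>b\<in>B. Y b b)) / 2"
      by (simp add: S_def sum.distrib sum_divide_distrib[symmetric])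
    ultimately show ?thesis unfolding trY by simp
  qed
  from that[OF feas hS psd this] show ?thesis .
qed

subsection \<open>Matrices as kernels\<close>

lemma pair_index_less: "a < d \<Longrightarrow> b < e \<Longrightarrow> a * e + b < d * (e :: nat)"
proof -
  assume "a < d" "b < e"
  then have "a * e + b < Suc a * e" by simp
  also have "\<dots> \<le> d * e" using \<open>a < d\<close> by (intro mult_right_mono) auto
  finally show ?thesis .
qed

lemma pair_index_bij: "bij_betw (\<lambda>(a, b). a * e + b) ({..<d} \<times> {..<e}) {..<d * e :: nat}"
proof (rule bij_betwI[where g = "\<lambda>i. (i div e, i mod e)"])
  show "(\<lambda>i. (i div e, i mod e)) \<in> {..<d * e} \<rightarrow> {..<d} \<times> {..<e}"
    by (auto simp: less_mult_imp_div_less intro!: mod_less_divisor intro: Nat.gr0I)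
qed (auto simp: pair_index_less)

lemma sum_pair_index: "(\<Sum>i<d * e. f i) = (\<Sum>a<d. \<Sum>b<e. f (a * e + b :: nat))"
  using sum.reindex_bij_betw[OF pair_index_bij, of f e d]
  by (simp add: sum.cartesian_product' case_prod_unfold)

definition matrix_unit :: "nat \<Rightarrow> nat \<Rightarrow> nat \<Rightarrow> complex mat" where
  "matrix_unit d a a' = mat d d (\<lambda>(i, j). if i = a \<and> j = a' then 1 else 0)"

lemma matrix_unit_carrier [simp]: "matrix_unit d a a' \<in> carrier_mat d d"
  by (simp add: matrix_unit_def)

lemma matrix_unit_index [simp]:
  "i < d \<Longrightarrow> j < d \<Longrightarrow> matrix_unit d a a' $$ (i, j) = (if i = a \<and> j = a' then 1 else 0)"
  by (simp add: matrix_unit_def)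

lemma basis_proj_matrix_unit: "basis_proj d m = matrix_unit d m m"
  by (simp add: basis_proj_def matrix_unit_def)

lemma linear_superop_carrier: "linear_superop dA dB N \<Longrightarrow> X \<in> carrier_mat dA dA \<Longrightarrow> N X \<in> carrier_mat dB dB"
  by (simp add: linear_superop_def)

lemma linear_superop_expand:
  assumes lin: "linear_superop dA dB N" and X: "X \<in> carrier_mat dA dA" and b: "b < dB" "b' < dB"
  shows "N X $$ (b, b') = (\<Sum>a<dA. \<Sum>a'<dA. X $$ (a, a') * N (matrix_unit dA a a') $$ (b, b'))"
proof -
  \<comment> \<open>\<open>X\<close> truncated to the entries in \<open>S\<close>. Induction on
    \<open>S\<close> adds one matrix unit at a time; for the empty set, homogeneity with the scalar
    0 gives the value 0.\<close>
  define M where "M S = mat dA dA (\<lambda>p. if p \<in> S then X $$ p else 0)" for S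
  have M: "M S \<in> carrier_mat dA dA" for S by (simp add: M_def)
  have expand: "N (M S) $$ (b, b') = (\<Sum>p\<in>S. X $$ p * N (matrix_unit dA (fst p) (snd p)) $$ (b, b'))"
    if "finite S" "S \<subseteq> {..<dA} \<times> {..<dA}" for S
    using that
  proof (induction S rule: finite_induct)
    case empty
    have "M {} = 0 \<cdot>\<^sub>m M {}" by (rule eq_matI) (auto simp: M_def)
    then have "N (M {}) = 0 \<cdot>\<^sub>m N (M {})" using lin M unfolding linear_superop_def by metis
    moreover have "N (M {}) \<in> carrier_mat dB dB" using lin M unfolding linear_superop_def by metis
    ultimately have "N (M {}) $$ (b, b') = 0" using b
      by (metis carrier_matD index_smult_mat(1) mult_zero_left)
    then show ?case by simp
  next
    case (insert p S)
    obtain a a' where p: "p = (a, a')" "a < dA" "a' < dA" using insert.prems by auto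
    have 1: "M (insert p S) = M S + X $$ p \<cdot>\<^sub>m matrix_unit dA a a'"
      using insert.hyps p by (intro eq_matI) (auto simp: M_def matrix_unit_def)
    have c: "N (M S) \<in> carrier_mat dB dB" "N (matrix_unit dA a a') \<in> carrier_mat dB dB"
      using linear_superop_carrier[OF lin] M by auto
    have "N (M (insert p S)) = N (M S) + X $$ p \<cdot>\<^sub>m N (matrix_unit dA a a')"
      unfolding 1 using lin M unfolding linear_superop_def by simp
    then have "N (M (insert p S)) $$ (b, b') = N (M S) $$ (b, b') + X $$ p * N (matrix_unit dA a a') $$ (b, b')"
      using c b by simp
    then show ?case using insert p by simp
  qed
  have "M ({..<dA} \<times> {..<dA}) = X" using X by (intro eq_matI) (auto simp: M_def)
  with expand[of "{..<dA} \<times> {..<dA}"] show ?thesis by (simp add: sum.cartesian_product')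
qed

text \<open>The matrix form conjugates the vector at the row index, \<open>sesq\<close> at the
  column index; replacing \<open>v\<close> by its conjugate passes from one to the other.\<close>

lemma psd_kernel_cnj: "psd_kernel I K \<longleftrightarrow> (\<forall>v. 0 \<le> (\<Sum>p\<in>I. \<Sum>q\<in>I. K p q * v q * cnj (v p)))"
proof -
  have 1: "sesq I K (\<lambda>p. cnj (v p)) (\<lambda>p. cnj (v p)) = (\<Sum>p\<in>I. \<Sum>q\<in>I. K p q * v q * cnj (v p))" for v
    by (simp add: sesq_def mult_ac)
  have 2: "sesq I K v v = (\<Sum>p\<in>I. \<Sum>q\<in>I. K p q * cnj (v q) * cnj (cnj (v p)))" for v
    by (simp add: sesq_def mult_ac)
  show ?thesis
  proof
    assume "psd_kernel I K"
    then show "\<forall>v. 0 \<le> (\<Sum>p\<in>I. \<Sum>q\<in>I. K p q * v q * cnj (v p))"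
      unfolding psd_kernel_def 1[symmetric] by blast
  next
    assume *: "\<forall>v. 0 \<le> (\<Sum>p\<in>I. \<Sum>q\<in>I. K p q * v q * cnj (v p))"
    show "psd_kernel I K" unfolding psd_kernel_def 2
    proof
      fix v show "0 \<le> (\<Sum>p\<in>I. \<Sum>q\<in>I. K p q * cnj (v q) * cnj (cnj (v p)))"
        by (rule spec[OF *, of "\<lambda>p. cnj (v p)"])
    qed
  qed
qed

lemma psd_iff_psd_kernel: "psd n X \<longleftrightarrow> X \<in> carrier_mat n n \<and> psd_kernel {..<n} (\<lambda>i j. X $$ (i, j))"
proof (cases "X \<in> carrier_mat n n")
  case True
  have eq: "(X *\<^sub>v v) \<bullet>c v = (\<Sum>p<n. \<Sum>q<n. X $$ (p, q) * v $ q * cnj (v $ p))" if "v \<in> carrier_vec n" for v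
    using True that by (auto simp: scalar_prod_def sum_distrib_right lessThan_atLeast0 conjugate_complex_def intro!: sum.cong)
  have "psd_kernel {..<n} (\<lambda>i j. X $$ (i, j)) \<longleftrightarrow> (\<forall>v\<in>carrier_vec n. 0 \<le> (X *\<^sub>v v) \<bullet>c v)"
  proof
    assume "psd_kernel {..<n} (\<lambda>i j. X $$ (i, j))"
    then show "\<forall>v\<in>carrier_vec n. 0 \<le> (X *\<^sub>v v) \<bullet>c v"
      unfolding psd_kernel_cnj by (simp add: eq)
  next
    assume *: "\<forall>v\<in>carrier_vec n. 0 \<le> (X *\<^sub>v v) \<bullet>c v"
    show "psd_kernel {..<n} (\<lambda>i j. X $$ (i, j))"
      unfolding psd_kernel_cnj
    proof
      fix v :: "nat \<Rightarrow> complex"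
      have "0 \<le> (X *\<^sub>v vec n v) \<bullet>c vec n v" using * by simp
      then show "0 \<le> (\<Sum>p<n. \<Sum>q<n. X $$ (p, q) * v q * cnj (v p))" by (simp add: eq)
    qed
  qed
  then show ?thesis using True by (simp add: psd_def)
qed (simp add: psd_def)

lemma psd_kernel_reindex:
  assumes "bij_betw h I I'"
  shows "psd_kernel I' K \<longleftrightarrow> psd_kernel I (\<lambda>p q. K (h p) (h q))"
proof -
  have "(\<Sum>p\<in>I'. \<Sum>q\<in>I'. v p * cnj (v q) * K p q) = sesq I (\<lambda>p q. K (h p) (h q)) (v \<circ> h) (v \<circ> h)" for v
    by (simp add: sesq_def sum.reindex_bij_betw[OF assms, symmetric])
  then have "psd_kernel I (\<lambda>p q. K (h p) (h q)) \<Longrightarrow> psd_kernel I' K" by (simp add: psd_kernel_def sesq_def)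
  moreover have "psd_kernel I (\<lambda>p q. K (h p) (h q))" if "psd_kernel I' K"
    unfolding psd_kernel_def
  proof
    fix v :: "'a \<Rightarrow> complex"
    have "sesq I (\<lambda>p q. K (h p) (h q)) v v = sesq I' K (v \<circ> inv_into I h) (v \<circ> inv_into I h)"
      unfolding sesq_def sum.reindex_bij_betw[OF assms, symmetric]
      using assms by (intro sum.cong refl) (simp add: bij_betw_def)
    then show "0 \<le> sesq I (\<lambda>p q. K (h p) (h q)) v v" using that by (simp add: psd_kernel_def)
  qed
  ultimately show ?thesis by auto
qed

lemma psd_iff_psd_kernel_pair:
  "psd (d * e) X \<longleftrightarrow> X \<in> carrier_mat (d * e) (d * e) \<and>
     psd_kernel ({..<d} \<times> {..<e}) (\<lambda>p q. X $$ (fst p * e + snd p, fst q * e + snd q))"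
  unfolding psd_iff_psd_kernel psd_kernel_reindex[OF pair_index_bij] case_prod_unfold by (rule refl)

lemma psd_iff_psd_kernelI:
  assumes "X \<in> carrier_mat (d * e) (d * e)"
    and "\<And>a a' b b'. a < d \<Longrightarrow> a' < d \<Longrightarrow> b < e \<Longrightarrow> b' < e \<Longrightarrow>
      X $$ (a * e + b, a' * e + b') = K (a, b) (a', b')"
  shows "psd (d * e) X \<longleftrightarrow> psd_kernel ({..<d} \<times> {..<e}) K"
proof -
  have "psd_kernel ({..<d} \<times> {..<e}) (\<lambda>p q. X $$ (fst p * e + snd p, fst q * e + snd q)) \<longleftrightarrow>
      psd_kernel ({..<d} \<times> {..<e}) K"
    using assms(2) by (intro psd_kernel_cong) auto
  then show ?thesis using assms(1) by (simp add: psd_iff_psd_kernel_pair)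
qed

lemma kron_index:
  assumes "X \<in> carrier_mat d d'" "Y \<in> carrier_mat e e'" "i < d" "j < d'" "k < e" "l < e'"
  shows "kron X Y $$ (i * e + k, j * e' + l) = X $$ (i, j) * Y $$ (k, l)"
  using assms by (simp add: kron_def pair_index_less)

lemma kron_carrier:
  "X \<in> carrier_mat d d' \<Longrightarrow> Y \<in> carrier_mat e e' \<Longrightarrow> kron X Y \<in> carrier_mat (d * e) (d' * e')"
  by (simp add: kron_def)

lemma id_tensor_index:
  assumes "r < dR" "s < dR" "b < dB" "b' < dB"
  shows "id_tensor dR dA dB N X $$ (r * dB + b, s * dB + b') =
    N (mat dA dA (\<lambda>(a, a'). X $$ (r * dA + a, s * dA + a'))) $$ (b, b')"
  using assms by (simp add: id_tensor_def pair_index_less)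

lemma id_tensor_carrier [simp]: "id_tensor dR dA dB N X \<in> carrier_mat (dR * dB) (dR * dB)"
  by (simp add: id_tensor_def)

lemma max_entangled_index:
  assumes "a < d" "x < d" "a' < d" "x' < d"
  shows "max_entangled d $$ (a * d + x, a' * d + x') = (if a = x \<and> a' = x' then 1 / of_nat d else 0)"
  using assms by (simp add: max_entangled_def pair_index_less)

section \<open>Choi operators as kernels\<close>

definition choi_kernel :: "nat \<Rightarrow> superop \<Rightarrow> nat \<times> nat \<Rightarrow> nat \<times> nat \<Rightarrow> complex" where
  "choi_kernel d N p q = N (matrix_unit d (fst p) (fst q)) $$ (snd p, snd q)"

lemma choi_index:
  assumes "linear_superop dA dB N" "a < dA" "a' < dA" "b < dB" "b' < dB"
  shows "choi dA dB N $$ (a * dB + b, a' * dB + b') = choi_kernel dA N (a, b) (a', b') / of_nat dA"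
proof -
  have "mat dA dA (\<lambda>(x, x'). max_entangled dA $$ (a * dA + x, a' * dA + x')) =
     (1 / of_nat dA) \<cdot>\<^sub>m matrix_unit dA a a'"
    using assms by (intro eq_matI) (auto simp: max_entangled_index matrix_unit_def)
  then have "choi dA dB N $$ (a * dB + b, a' * dB + b') = N ((1 / of_nat dA) \<cdot>\<^sub>m matrix_unit dA a a') $$ (b, b')"
    using assms by (simp add: choi_def id_tensor_index)
  also have "\<dots> = ((1 / of_nat dA) \<cdot>\<^sub>m N (matrix_unit dA a a')) $$ (b, b')"
    using assms(1) by (simp add: linear_superop_def)
  also have "\<dots> = choi_kernel dA N (a, b) (a', b') / of_nat dA"
    using linear_superop_carrier[OF assms(1), of "matrix_unit dA a a'"] assms by (auto simp: choi_kernel_def)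
  finally show ?thesis .
qed

lemma psd_max_entangled: "psd (d * d) (max_entangled d)"
proof -
  have "psd_kernel ({..<d} \<times> {..<d}) (\<lambda>p q. (1 / of_nat d) * 
      ((if fst p = snd p then 1 else 0) * cnj (if fst q = snd q then 1 else 0)))"
    by (intro psd_kernel_scale psd_kernel_rank_one) (simp add: less_eq_complex_def)
  also have "?this \<longleftrightarrow> psd_kernel ({..<d} \<times> {..<d}) (\<lambda>p q. max_entangled d $$ (fst p * d + snd p, fst q * d + snd q))"
    by (rule psd_kernel_cong) (auto simp: max_entangled_index)
  finally show ?thesis unfolding psd_iff_psd_kernel_pair by (simp add: max_entangled_def)
qed

lemma psd_kernel_choi_kernel:
  assumes "cp_map dA dB N"
  shows "psd_kernel ({..<dA} \<times> {..<dB}) (choi_kernel dA N)"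
proof (cases "dA = 0")
  case True
  then show ?thesis by (simp add: psd_kernel_def sesq_def)
next
  case False
  have lin: "linear_superop dA dB N" using assms by (simp add: cp_map_def)
  have "psd (dA * dB) (choi dA dB N)"
    unfolding choi_def using assms psd_max_entangled by (simp add: cp_map_def)
  then have "psd_kernel ({..<dA} \<times> {..<dB}) (\<lambda>p q. choi dA dB N $$ (fst p * dB + snd p, fst q * dB + snd q))"
    by (simp add: psd_iff_psd_kernel_pair)
  then have "psd_kernel ({..<dA} \<times> {..<dB}) (\<lambda>p q. of_nat dA * choi dA dB N $$ (fst p * dB + snd p, fst q * dB + snd q))"
    by (rule psd_kernel_scale) (simp add: less_eq_complex_def)
  also have "?this \<longleftrightarrow> ?thesis"
    using False by (intro psd_kernel_cong) (auto simp: choi_index[OF lin])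
  finally show ?thesis .
qed

subsection \<open>The loop supermap\<close>

text \<open>Composition of completely positive maps in terms of kernels: contracting Gram vectors of
  \<open>X\<close> with Gram vectors of \<open>C\<close> over \<open>B\<close> gives Gram vectors of
  the result. It yields both complete positivity of a map built from a kernel and positivity of the
  retrocausal kernels.\<close>

lemma psd_kernel_contract:
  assumes fin: "finite R" "finite A" "finite B" and X: "psd_kernel (R \<times> B) X" and C: "psd_kernel (A \<times> B) C"
  shows "psd_kernel (R \<times> A) (\<lambda>p q. \<Sum>k\<in>B. \<Sum>l\<in>B. X (fst p, k) (fst q, l) * C (snd p, k) (snd q, l))"
proof -
  obtain x where x: "\<And>p q. p \<in> R \<times> B \<Longrightarrow> q \<in> R \<times> B \<Longrightarrow> X p q = (\<Sum>t\<in>R \<times> B. x t p * cnj (x t q))"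
    using psd_kernel_gram[OF _ X] fin by auto
  obtain c where c: "\<And>p q. p \<in> A \<times> B \<Longrightarrow> q \<in> A \<times> B \<Longrightarrow> C p q = (\<Sum>u\<in>A \<times> B. c u p * cnj (c u q))"
    using psd_kernel_gram[OF _ C] fin by auto
  define w where "w t u p = (\<Sum>k\<in>B. x t (fst p, k) * c u (snd p, k))" for t u p
  have "(\<Sum>k\<in>B. \<Sum>l\<in>B. X (r, k) (s, l) * C (j, k) (i, l)) =
     (\<Sum>t\<in>R \<times> B. \<Sum>u\<in>A \<times> B. w t u (r, j) * cnj (w t u (s, i)))"
    if "r \<in> R" "s \<in> R" "i \<in> A" "j \<in> A" for r s i j
  proof -
    have "(\<Sum>k\<in>B. \<Sum>l\<in>B. X (r, k) (s, l) * C (j, k) (i, l)) =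
      (\<Sum>k\<in>B. \<Sum>l\<in>B. \<Sum>t\<in>R \<times> B. \<Sum>u\<in>A \<times> B.
        (x t (r, k) * c u (j, k)) * cnj (x t (s, l) * c u (i, l)))"
    proof (intro sum.cong refl)
      fix k l assume "k \<in> B" "l \<in> B"
      then have "X (r, k) (s, l) * C (j, k) (i, l) =
        (\<Sum>t\<in>R \<times> B. x t (r, k) * cnj (x t (s, l))) * (\<Sum>u\<in>A \<times> B. c u (j, k) * cnj (c u (i, l)))"
        using that by (simp add: x c)
      then show "X (r, k) (s, l) * C (j, k) (i, l) = (\<Sum>t\<in>R \<times> B. \<Sum>u\<in>A \<times> B.
        (x t (r, k) * c u (j, k)) * cnj (x t (s, l) * c u (i, l)))"
        by (simp add: sum_product mult_ac)
    qed
    also have "\<dots> = (\<Sum>t\<in>R \<times> B. \<Sum>u\<in>A \<times> B. \<Sum>k\<in>B. \<Sum>l\<in>B.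
        (x t (r, k) * c u (j, k)) * cnj (x t (s, l) * c u (i, l)))" by (rule sum_swap4)
    finally show ?thesis by (simp add: w_def sum_product)
  qed
  then have "psd_kernel (R \<times> A) (\<lambda>p q. \<Sum>k\<in>B. \<Sum>l\<in>B. X (fst p, k) (fst q, l) * C (snd p, k) (snd q, l)) \<longleftrightarrow>
     psd_kernel (R \<times> A) (\<lambda>p q. \<Sum>t\<in>R \<times> B. \<Sum>u\<in>A \<times> B. w t u p * cnj (w t u q))"
    by (intro psd_kernel_cong) auto
  then show ?thesis by (simp add: psd_kernel_sum psd_kernel_rank_one)
qed

lemma psd_kernel_swap: "psd_kernel (A \<times> B) K \<longleftrightarrow> psd_kernel (B \<times> A) (\<lambda>p q. K (prod.swap p) (prod.swap q))"
  by (rule psd_kernel_reindex) (auto simp: bij_betw_def inj_on_def)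

text \<open>A Choi kernel with the output index first. For a channel from \<open>B\<close> to
  \<open>A\<close> it then lives on \<open>A \<times> B\<close>, like the kernel of
  \<open>N : A \<rightarrow> B\<close> with which it is paired.\<close>

definition out_kernel :: "nat \<Rightarrow> superop \<Rightarrow> nat \<times> nat \<Rightarrow> nat \<times> nat \<Rightarrow> complex" where
  "out_kernel d P p q = P (matrix_unit d (snd p) (snd q)) $$ (fst p, fst q)"

lemma trace_matrix_unit: "a < d \<Longrightarrow> a' < d \<Longrightarrow> trace_mat (matrix_unit d a a') = (if a = a' then 1 else 0)"
proof -
  assume a: "a < d" "a' < d"
  have "trace_mat (matrix_unit d a a') = (\<Sum>i<d. if a = i then (if a = a' then 1 else 0) else 0)"
    unfolding trace_mat_def by (intro sum.cong) (auto simp: matrix_unit_def)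
  then show ?thesis using a by (simp add: sum_delta_mult)
qed

lemma trace_mat_carrier: "X \<in> carrier_mat d d \<Longrightarrow> trace_mat X = (\<Sum>i<d. X $$ (i, i))"
  by (simp add: trace_mat_def)

lemma channel_kernel_out_kernel:
  assumes "channel dB dA P"
  shows "channel_kernel {..<dA} {..<dB} (out_kernel dB P)"
  unfolding channel_kernel_def
proof (intro conjI ballI)
  have cp: "cp_map dB dA P" using assms by (simp add: channel_def)
  then have lin: "linear_superop dB dA P" by (simp add: cp_map_def)
  show "psd_kernel ({..<dA} \<times> {..<dB}) (out_kernel dB P)"
    using psd_kernel_choi_kernel[OF cp] unfolding psd_kernel_swap[of "{..<dB}"] by (simp add: choi_kernel_def out_kernel_def[abs_def])
  fix b b' assume b: "b \<in> {..<dB}" "b' \<in> {..<dB}"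
  have "(\<Sum>a<dA. out_kernel dB P (a, b) (a, b')) = trace_mat (P (matrix_unit dB b b'))"
    using linear_superop_carrier[OF lin, of "matrix_unit dB b b'"] by (simp add: out_kernel_def trace_mat_carrier)
  also have "\<dots> = trace_mat (matrix_unit dB b b')" using assms by (simp add: channel_def)
  finally show "(\<Sum>a<dA. out_kernel dB P (a, b) (a, b')) = (if b = b' then 1 else 0)"
    using b by (simp add: trace_matrix_unit)
qed

definition superop_of :: "nat \<Rightarrow> nat \<Rightarrow> (nat \<times> nat \<Rightarrow> nat \<times> nat \<Rightarrow> complex) \<Rightarrow> superop" where
  "superop_of dA dB C Y = mat dA dA (\<lambda>(j, i). \<Sum>k<dB. \<Sum>l<dB. Y $$ (k, l) * C (j, k) (i, l))"

lemma superop_of_carrier [simp]: "superop_of dA dB C Y \<in> carrier_mat dA dA"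
  by (simp add: superop_of_def)

lemma out_kernel_superop_of:
  assumes "j < dA" "i < dA" "k < dB" "l < dB"
  shows "out_kernel dB (superop_of dA dB C) (j, k) (i, l) = C (j, k) (i, l)"
proof -
  have "out_kernel dB (superop_of dA dB C) (j, k) (i, l) =
     (\<Sum>k'<dB. \<Sum>l'<dB. matrix_unit dB k l $$ (k', l') * C (j, k') (i, l'))"
    using assms by (simp add: out_kernel_def superop_of_def)
  also have "\<dots> = (\<Sum>k'<dB. \<Sum>l'<dB. if l = l' then (if k = k' then C (j, k) (i, l) else 0) else 0)"
    by (intro sum.cong refl) simp
  also have "\<dots> = C (j, k) (i, l)" using assms by (simp add: sum_delta_mult)
  finally show ?thesis .
qed

text \<open>The converse of \<open>channel_kernel_out_kernel\<close>: an optimiser found among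
  kernels becomes an actual channel. Positivity with a reference of any size \<open>n\<close> is a
  single contraction.\<close>

lemma channel_superop_of:
  assumes "channel_kernel {..<dA} {..<dB} C"
  shows "channel dB dA (superop_of dA dB C)"
proof -
  let ?P = "superop_of dA dB C"
  have lin: "linear_superop dB dA ?P"
    unfolding linear_superop_def
  proof (intro conjI ballI allI)
    fix X Y :: "complex mat" and c :: complex
    assume X: "X \<in> carrier_mat dB dB"
    show "?P X \<in> carrier_mat dA dA" by simp
    show "?P (c \<cdot>\<^sub>m X) = c \<cdot>\<^sub>m ?P X"
    proof (rule eq_matI)
      fix j i assume ji: "j < dim_row (c \<cdot>\<^sub>m ?P X)" "i < dim_col (c \<cdot>\<^sub>m ?P X)"
      have "(\<Sum>k<dB. \<Sum>l<dB. (c \<cdot>\<^sub>m X) $$ (k, l) * C (j, k) (i, l)) =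
        (\<Sum>k<dB. \<Sum>l<dB. c * (X $$ (k, l) * C (j, k) (i, l)))"
        using X by (intro sum.cong refl) simp
      then show "?P (c \<cdot>\<^sub>m X) $$ (j, i) = (c \<cdot>\<^sub>m ?P X) $$ (j, i)"
        using ji by (simp add: superop_of_def sum_distrib_left)
    qed (simp_all add: superop_of_def)
    assume Y: "Y \<in> carrier_mat dB dB"
    show "?P (X + Y) = ?P X + ?P Y"
    proof (rule eq_matI)
      fix j i assume ji: "j < dim_row (?P X + ?P Y)" "i < dim_col (?P X + ?P Y)"
      have "(\<Sum>k<dB. \<Sum>l<dB. (X + Y) $$ (k, l) * C (j, k) (i, l)) =
        (\<Sum>k<dB. \<Sum>l<dB. X $$ (k, l) * C (j, k) (i, l) + Y $$ (k, l) * C (j, k) (i, l))"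
        using X Y by (intro sum.cong refl) (simp add: distrib_right)
      then show "?P (X + Y) $$ (j, i) = (?P X + ?P Y) $$ (j, i)"
        using ji by (simp add: superop_of_def sum.distrib)
    qed (simp_all add: superop_of_def)
  qed
  have "psd (n * dA) (id_tensor n dB dA ?P X)" if X: "psd (n * dB) X" for n X
  proof -
    let ?X = "\<lambda>p q. X $$ (fst p * dB + snd p, fst q * dB + snd q)"
    have "psd_kernel ({..<n} \<times> {..<dA}) (\<lambda>p q. \<Sum>k<dB. \<Sum>l<dB. ?X (fst p, k) (fst q, l) * C (snd p, k) (snd q, l))"
      using X assms by (intro psd_kernel_contract) (auto simp: psd_iff_psd_kernel_pair channel_kernel_def)
    also have "?this \<longleftrightarrow> psd_kernel ({..<n} \<times> {..<dA})
       (\<lambda>p q. id_tensor n dB dA ?P X $$ (fst p * dA + snd p, fst q * dA + snd q))"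
      by (rule psd_kernel_cong) (auto simp: id_tensor_index superop_of_def)
    finally show ?thesis by (simp add: psd_iff_psd_kernel_pair)
  qed
  moreover have "trace_mat (?P X) = trace_mat X" if X: "X \<in> carrier_mat dB dB" for X
  proof -
    have "trace_mat (?P X) = (\<Sum>j<dA. \<Sum>k<dB. \<Sum>l<dB. X $$ (k, l) * C (j, k) (j, l))"
      by (simp add: trace_mat_def superop_of_def)
    also have "\<dots> = (\<Sum>k<dB. \<Sum>j<dA. \<Sum>l<dB. X $$ (k, l) * C (j, k) (j, l))" by (rule sum.swap)
    also have "\<dots> = (\<Sum>k<dB. \<Sum>l<dB. \<Sum>j<dA. X $$ (k, l) * C (j, k) (j, l))"
      by (rule sum.cong[OF refl], rule sum.swap)
    also have "\<dots> = (\<Sum>k<dB. \<Sum>l<dB. if k = l then X $$ (k, k) else 0)"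
      using assms by (intro sum.cong refl) (auto simp: channel_kernel_def sum_distrib_left[symmetric])
    also have "\<dots> = trace_mat X" using X by (simp add: sum_delta_mult trace_mat_carrier)
    finally show ?thesis .
  qed
  ultimately show ?thesis using lin by (simp add: channel_def cp_map_def)
qed

section \<open>Diagonal entries of the loop output\<close>

lemma mat_eq_pairI:
  assumes "X \<in> carrier_mat (d * e) (d' * e')" "Y \<in> carrier_mat (d * e) (d' * e')"
    and eq: "\<And>i j k l. i < d \<Longrightarrow> j < d' \<Longrightarrow> k < e \<Longrightarrow> l < e' \<Longrightarrow>
      X $$ (i * e + k, j * e' + l) = Y $$ (i * e + k, j * e' + l)"
  shows "X = Y"
proof (rule eq_matI)
  fix u v assume "u < dim_row Y" "v < dim_col Y"
  then have u: "u < d * e" "v < d' * e'" using assms by auto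
  then have "0 < e" "0 < e'" by (auto intro: Nat.gr0I)
  then have "X $$ (u div e * e + u mod e, v div e' * e' + v mod e') =
     Y $$ (u div e * e + u mod e, v div e' * e' + v mod e')"
    using u by (intro eq) (auto simp: less_mult_imp_div_less)
  then show "X $$ (u, v) = Y $$ (u, v)" by simp
qed (use assms in auto)

lemma id_tensor_kron:
  assumes N: "linear_superop dA dB N" and \<rho>: "\<rho> \<in> carrier_mat d d" and U: "U \<in> carrier_mat dA dA"
  shows "id_tensor d dA dB N (kron \<rho> U) = kron \<rho> (N U)"
proof (rule mat_eq_pairI[where d = d and e = dB and d' = d and e' = dB])
  have NU: "N U \<in> carrier_mat dB dB" by (rule linear_superop_carrier[OF N U])
  then show "kron \<rho> (N U) \<in> carrier_mat (d * dB) (d * dB)" by (rule kron_carrier[OF \<rho>])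
  fix i j k l assume ij: "i < d" "j < d" "k < dB" "l < dB"
  have "mat dA dA (\<lambda>(a, a'). kron \<rho> U $$ (i * dA + a, j * dA + a')) = \<rho> $$ (i, j) \<cdot>\<^sub>m U"
    using ij U by (intro eq_matI) (auto simp: kron_index[OF \<rho> U])
  then show "id_tensor d dA dB N (kron \<rho> U) $$ (i * dB + k, j * dB + l) = kron \<rho> (N U) $$ (i * dB + k, j * dB + l)"
    using ij N U carrier_matD[OF NU]
    by (simp add: id_tensor_index kron_index[OF \<rho> NU] linear_superop_def del: carrier_matD)
qed simp

lemma swap_index_pair:
  assumes "x < dX" "z < dZ"
  shows "swap_index dX dY dZ ((y * dX + x) * dZ + z) = (x * dY + y) * dZ + z"
  using assms by (simp add: swap_index_def)

definition subblock :: "nat \<Rightarrow> nat \<Rightarrow> complex mat \<Rightarrow> complex mat" where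
  "subblock e m W = mat e e (\<lambda>(r, s). W $$ (m * e + r, m * e + s))"

text \<open>Only blocks diagonal in the decoded message are computed, since the trace and the
  success probability read nothing else. After the reordering, such a block is \<open>\<rho>\<close>
  on \<open>M\<close> tensored with the block of the decoder output on \<open>L\<close> that belongs
  to \<open>m\<close>.\<close>

lemma retro_comp_kron:
  assumes E: "linear_superop (dM * dL) dA E" and D: "linear_superop dB (dM * dL) D"
    and N: "linear_superop dA dB N" and \<rho>: "\<rho> \<in> carrier_mat dM dM" and U: "U \<in> carrier_mat dA dA"
    and m: "m < dM" and j: "j < dA" "i < dA"
  shows "retro_comp dA dB dM dL E D N (kron \<rho> U) $$ (m * dA + j, m * dA + i) =
    E (kron \<rho> (subblock dL m (D (N U)))) $$ (j, i)"
proof -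
  let ?W = "D (N U)"
  have NU: "N U \<in> carrier_mat dB dB" by (rule linear_superop_carrier[OF N U])
  have W: "?W \<in> carrier_mat (dM * dL) (dM * dL)" by (rule linear_superop_carrier[OF D NU])
  have sb: "subblock dL m ?W \<in> carrier_mat dL dL" by (simp add: subblock_def)
  let ?S = "swap_sys dM dM dL (kron \<rho> ?W)"
  have "mat (dM * dL) (dM * dL) (\<lambda>(a, a'). ?S $$ (m * (dM * dL) + a, m * (dM * dL) + a')) =
     kron \<rho> (subblock dL m ?W)" (is "?L = ?R")
  proof (rule mat_eq_pairI[where d = dM and e = dL and d' = dM and e' = dL])
    show "?R \<in> carrier_mat (dM * dL) (dM * dL)" by (rule kron_carrier[OF \<rho> sb])
    fix n n' r s assume n: "n < dM" "n' < dM" "r < dL" "s < dL"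
    have idx: "m * (dM * dL) + (x * dL + z) = (m * dM + x) * dL + z" for x z
      by (simp add: algebra_simps)
    have ls: "(m * dM + x) * dL + z < dM * dM * dL" if "x < dM" "z < dL" for x z
      using that m by (intro pair_index_less)
    have "?L $$ (n * dL + r, n' * dL + s) = ?S $$ ((m * dM + n) * dL + r, (m * dM + n') * dL + s)"
      using n by (simp add: pair_index_less idx)
    also have "\<dots> = kron \<rho> ?W $$ ((n * dM + m) * dL + r, (n' * dM + m) * dL + s)"
      using n ls by (simp add: swap_sys_def swap_index_pair)
    also have "\<dots> = kron \<rho> ?W $$ (n * (dM * dL) + (m * dL + r), n' * (dM * dL) + (m * dL + s))"
      by (simp add: algebra_simps)
    also have "\<dots> = \<rho> $$ (n, n') * ?W $$ (m * dL + r, m * dL + s)"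
      using n m by (intro kron_index[OF \<rho> W]) (auto intro: pair_index_less)
    also have "\<dots> = ?R $$ (n * dL + r, n' * dL + s)"
      using n m by (simp add: kron_index[OF \<rho> sb]) (simp add: subblock_def)
    finally show "?L $$ (n * dL + r, n' * dL + s) = ?R $$ (n * dL + r, n' * dL + s)" .
  qed simp
  then show ?thesis
    using m j unfolding retro_comp_def id_tensor_kron[OF N \<rho> U] id_tensor_kron[OF D \<rho> NU]
    by (simp add: id_tensor_index)
qed


text \<open>The first entangled state feeds \<open>|j><i|\<close> into \<open>A\<close> and keeps a
  copy of the pair in \<open>A'\<close>; the final one selects the output entry with the same pair,
  so the loop is closed by a sum over \<open>j\<close> and \<open>i\<close>. One factor
  \<open>1 / dA\<close> stays inside the argument because \<open>T\<close> is an arbitrary function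
  here.\<close>

lemma loop_diag:
  assumes \<rho>: "\<rho> \<in> carrier_mat dE dE" and m: "m < dF" 
  shows "loop dE dF dA T \<rho> $$ (m, m) =
    (\<Sum>j<dA. \<Sum>i<dA. T (kron ((1 / of_nat dA) \<cdot>\<^sub>m \<rho>) (matrix_unit dA j i)) $$ (m * dA + j, m * dA + i)) / of_nat dA"
proof -
  let ?TT = "tensor_id dA (dE * dA) (dF * dA) T (kron \<rho> (max_entangled dA))"
  let ?K = "kron (1\<^sub>m dF) (max_entangled dA)"
  let ?D = "dA * dA"
  have \<Phi>: "max_entangled dA \<in> carrier_mat ?D ?D" by (simp add: max_entangled_def)
  have one: "1\<^sub>m dF \<in> carrier_mat dF dF" by simp
  have K: "?K \<in> carrier_mat (dF * ?D) (dF * ?D)" by (rule kron_carrier[OF one \<Phi>])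
  have TT: "?TT \<in> carrier_mat (dF * ?D) (dF * ?D)" by (simp add: tensor_id_def mult.assoc)
  have blk: "?TT $$ (m * ?D + (j * dA + j), m * ?D + (i * dA + i)) =
     T (kron ((1 / of_nat dA) \<cdot>\<^sub>m \<rho>) (matrix_unit dA j i)) $$ (m * dA + j, m * dA + i)"
    if ji: "j < dA" "i < dA" for j i
  proof -
    have e: "m * ?D + (x * dA + x) = (m * dA + x) * dA + x" for x by (simp add: algebra_simps)
    have \<rho>': "(1 / of_nat dA) \<cdot>\<^sub>m \<rho> \<in> carrier_mat dE dE" using \<rho> by simp
    have "mat (dE * dA) (dE * dA) (\<lambda>(a, a'). kron \<rho> (max_entangled dA) $$ (a * dA + j, a' * dA + i)) =
      kron ((1 / of_nat dA) \<cdot>\<^sub>m \<rho>) (matrix_unit dA j i)" (is "?L = ?R")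
    proof (rule mat_eq_pairI[where d = dE and e = dA and d' = dE and e' = dA])
      show "?R \<in> carrier_mat (dE * dA) (dE * dA)" by (rule kron_carrier[OF \<rho>' matrix_unit_carrier])
      fix n n' x x' assume n: "n < dE" "n' < dE" "x < dA" "x' < dA"
      have e: "(n * dA + x) * dA + j = n * ?D + (x * dA + j)" for n x j by (simp add: algebra_simps)
      have "?L $$ (n * dA + x, n' * dA + x') = kron \<rho> (max_entangled dA) $$ (n * ?D + (x * dA + j), n' * ?D + (x' * dA + i))"
        using n by (simp add: pair_index_less e)
      also have "\<dots> = \<rho> $$ (n, n') * max_entangled dA $$ (x * dA + j, x' * dA + i)"
        using n ji by (intro kron_index[OF \<rho> \<Phi>]) (auto intro: pair_index_less)
      also have "\<dots> = ?R $$ (n * dA + x, n' * dA + x')"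
        using n ji \<rho> by (simp add: kron_index[OF \<rho>' matrix_unit_carrier] max_entangled_index)
      finally show "?L $$ (n * dA + x, n' * dA + x') = ?R $$ (n * dA + x, n' * dA + x')" .
    qed simp
    then show ?thesis
      unfolding e tensor_id_def using m ji by (simp add: pair_index_less)
  qed
  have "loop dE dF dA T \<rho> $$ (m, m) = (\<Sum>k<?D. (?K * ?TT) $$ (m * ?D + k, m * ?D + k))"
    using m by (simp add: loop_def ptrace_snd_def)
  also have "\<dots> = (\<Sum>k<?D. \<Sum>z<dF * ?D. ?K $$ (m * ?D + k, z) * ?TT $$ (z, m * ?D + k))"
    using K TT m by (intro sum.cong refl) (simp add: scalar_prod_def pair_index_less lessThan_atLeast0)
  also have "\<dots> = (\<Sum>k<?D. \<Sum>n<dF. \<Sum>z<?D. ?K $$ (m * ?D + k, n * ?D + z) * ?TT $$ (n * ?D + z, m * ?D + k))"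
    by (simp only: sum_pair_index)
  also have "\<dots> = (\<Sum>k<?D. \<Sum>n<dF. if m = n then \<Sum>z<?D. max_entangled dA $$ (k, z) * ?TT $$ (m * ?D + z, m * ?D + k) else 0)"
    using m by (intro sum.cong refl) (auto simp: kron_index[OF one \<Phi>])
  also have "\<dots> = (\<Sum>k<?D. \<Sum>z<?D. max_entangled dA $$ (k, z) * ?TT $$ (m * ?D + z, m * ?D + k))"
    using m by (simp add: sum_delta_mult)
  also have "\<dots> = (\<Sum>i<dA. \<Sum>x<dA. \<Sum>j<dA. \<Sum>y<dA. max_entangled dA $$ (i * dA + x, j * dA + y) *
     ?TT $$ (m * ?D + (j * dA + y), m * ?D + (i * dA + x)))"
    by (simp only: sum_pair_index)
  also have "\<dots> = (\<Sum>i<dA. \<Sum>x<dA. \<Sum>j<dA. \<Sum>y<dA. if j = y then (if i = x then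
     ?TT $$ (m * ?D + (j * dA + j), m * ?D + (i * dA + i)) / of_nat dA else 0) else 0)"
    by (intro sum.cong refl) (simp add: max_entangled_index)
  also have "\<dots> = (\<Sum>i<dA. \<Sum>x<dA. \<Sum>j<dA. if i = x then
     ?TT $$ (m * ?D + (j * dA + j), m * ?D + (i * dA + i)) / of_nat dA else 0)"
    by (intro sum.cong refl sum_delta_mult finite_lessThan)
  also have "\<dots> = (\<Sum>i<dA. \<Sum>x<dA. if i = x then
     (\<Sum>j<dA. ?TT $$ (m * ?D + (j * dA + j), m * ?D + (i * dA + i)) / of_nat dA) else 0)"
    by (intro sum.cong refl) simp
  also have "\<dots> = (\<Sum>i<dA. \<Sum>j<dA. ?TT $$ (m * ?D + (j * dA + j), m * ?D + (i * dA + i)) / of_nat dA)"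
    by (intro sum.cong refl sum_delta_mult finite_lessThan)
  also have "\<dots> = (\<Sum>j<dA. \<Sum>i<dA. ?TT $$ (m * ?D + (j * dA + j), m * ?D + (i * dA + i)) / of_nat dA)"
    by (rule sum.swap)
  also have "\<dots> = (\<Sum>j<dA. \<Sum>i<dA. T (kron ((1 / of_nat dA) \<cdot>\<^sub>m \<rho>) (matrix_unit dA j i)) $$ (m * dA + j, m * dA + i)) / of_nat dA"
    by (simp add: blk sum_divide_distrib)
  finally show ?thesis .
qed

lemma sum_collapse:
  assumes "finite A" "m \<in> A"
  shows "(\<Sum>n\<in>A. \<Sum>r\<in>R. \<Sum>n'\<in>A. \<Sum>s\<in>S. if m = n \<and> m = n' then F r s else 0) =
    (\<Sum>r\<in>R. \<Sum>s\<in>S. F r s :: complex)"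
proof -
  have "(\<Sum>n\<in>A. \<Sum>r\<in>R. \<Sum>n'\<in>A. \<Sum>s\<in>S. if m = n \<and> m = n' then F r s else 0) =
    (\<Sum>n\<in>A. \<Sum>r\<in>R. \<Sum>n'\<in>A. if m = n' then (if m = n then \<Sum>s\<in>S. F r s else 0) else 0)"
    by (intro sum.cong refl) auto
  also have "\<dots> = (\<Sum>n\<in>A. \<Sum>r\<in>R. if m = n then \<Sum>s\<in>S. F r s else 0)"
    by (intro sum.cong refl sum_delta_mult assms)
  also have "\<dots> = (\<Sum>n\<in>A. if m = n then \<Sum>r\<in>R. \<Sum>s\<in>S. F r s else 0)"
    by (intro sum.cong refl) simp
  also have "\<dots> = (\<Sum>r\<in>R. \<Sum>s\<in>S. F r s)"
    by (rule sum_delta_mult[OF assms])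
  finally show ?thesis .
qed

text \<open>The kernel of \<open>Y \<mapsto> E(|m\<rangle>\<langle>m| \<otimes> \<langle>m'| D(Y) |m'\<rangle>)\<close>, in terms of the kernels of \<open>D\<close> and \<open>E\<close>.\<close>

definition retro_kernel :: "nat \<Rightarrow> (nat \<times> nat \<Rightarrow> nat \<times> nat \<Rightarrow> complex) \<Rightarrow> (nat \<times> nat \<Rightarrow> nat \<times> nat \<Rightarrow> complex) \<Rightarrow>
    nat \<Rightarrow> nat \<Rightarrow> nat \<times> nat \<Rightarrow> nat \<times> nat \<Rightarrow> complex" where
  "retro_kernel dL CD CE m m' p q = (\<Sum>r<dL. \<Sum>s<dL. CD (m' * dL + r, snd p) (m' * dL + s, snd q) *
     CE (fst p, m * dL + r) (fst q, m * dL + s))"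

text \<open>Expanding encoder and decoder over matrix units makes the loop sum the \<open>A\<close>
  part of the pairing and the sum over operators on \<open>B\<close> its \<open>B\<close> part. The
  input projector selects the encoder block \<open>m\<close>, the diagonal entry the decoder block
  \<open>m'\<close>. Each entangled state contributes one factor \<open>1 / dA\<close>.\<close>

lemma retro_map_diag:
  assumes E: "linear_superop (dM * dL) dA E" and D: "linear_superop dB (dM * dL) D"
    and N: "linear_superop dA dB N" and m: "m < dM" "m' < dM"
  shows "retro_map dA dB dM dL E D N (basis_proj dM m) $$ (m', m') =
    pairing ({..<dA} \<times> {..<dB}) (choi_kernel dA N) (retro_kernel dL (out_kernel dB D) (out_kernel (dM * dL) E) m m') / (of_nat dA)\<^sup>2"
proof -
  let ?c = "1 / of_nat dA :: complex"
  have \<rho>: "?c \<cdot>\<^sub>m basis_proj dM m \<in> carrier_mat dM dM" by (simp add: basis_proj_matrix_unit)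
  have bp: "basis_proj dM m \<in> carrier_mat dM dM" by (simp add: basis_proj_matrix_unit)
  have sb: "subblock dL m' W \<in> carrier_mat dL dL" for W by (simp add: subblock_def)
  have key: "E (kron (?c \<cdot>\<^sub>m basis_proj dM m) (subblock dL m' (D (N (matrix_unit dA j i))))) $$ (j, i) =
     ?c * (\<Sum>k<dB. \<Sum>l<dB. choi_kernel dA N (j, k) (i, l) * retro_kernel dL (out_kernel dB D) (out_kernel (dM * dL) E) m m' (j, k) (i, l))"
    if ji: "j < dA" "i < dA" for j i
  proof -
    let ?U = "N (matrix_unit dA j i)"
    have U: "?U \<in> carrier_mat dB dB" by (rule linear_superop_carrier[OF N matrix_unit_carrier])
    let ?K = "kron (?c \<cdot>\<^sub>m basis_proj dM m) (subblock dL m' (D ?U))"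
    let ?e = "\<lambda>u v. out_kernel (dM * dL) E (j, u) (i, v)"
    have K: "?K \<in> carrier_mat (dM * dL) (dM * dL)" by (rule kron_carrier[OF \<rho> sb])
    have "E ?K $$ (j, i) = (\<Sum>u<dM * dL. \<Sum>v<dM * dL. ?K $$ (u, v) * ?e u v)"
      unfolding out_kernel_def using ji by (simp add: linear_superop_expand[OF E K])
    also have "\<dots> = (\<Sum>n<dM. \<Sum>r<dL. \<Sum>n'<dM. \<Sum>s<dL. ?K $$ (n * dL + r, n' * dL + s) * ?e (n * dL + r) (n' * dL + s))"
      by (simp only: sum_pair_index)
    also have "\<dots> = (\<Sum>n<dM. \<Sum>r<dL. \<Sum>n'<dM. \<Sum>s<dL. if m = n \<and> m = n' then
        ?c * D ?U $$ (m' * dL + r, m' * dL + s) * ?e (m * dL + r) (m * dL + s) else 0)"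
    proof (intro sum.cong refl)
      fix n r n' s assume n: "n \<in> {..<dM}" "r \<in> {..<dL}" "n' \<in> {..<dM}" "s \<in> {..<dL}"
      then have "?K $$ (n * dL + r, n' * dL + s) =
        (?c \<cdot>\<^sub>m basis_proj dM m) $$ (n, n') * subblock dL m' (D ?U) $$ (r, s)"
        by (intro kron_index[OF \<rho> sb]) auto
      then show "?K $$ (n * dL + r, n' * dL + s) * ?e (n * dL + r) (n' * dL + s) =
        (if m = n \<and> m = n' then ?c * D ?U $$ (m' * dL + r, m' * dL + s) * ?e (m * dL + r) (m * dL + s) else 0)"
        using n by (auto simp: basis_proj_matrix_unit matrix_unit_def subblock_def)
    qed
    also have "\<dots> = (\<Sum>r<dL. \<Sum>s<dL. ?c * D ?U $$ (m' * dL + r, m' * dL + s) * ?e (m * dL + r) (m * dL + s))"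
      using m by (intro sum_collapse) auto
    also have "\<dots> = (\<Sum>r<dL. \<Sum>s<dL. \<Sum>k<dB. \<Sum>l<dB. ?c * (choi_kernel dA N (j, k) (i, l) *
        (out_kernel dB D (m' * dL + r, k) (m' * dL + s, l) * ?e (m * dL + r) (m * dL + s))))"
    proof (rule sum.cong[OF refl], rule sum.cong[OF refl])
      fix r s assume rs: "r \<in> {..<dL}" "s \<in> {..<dL}"
      have "D ?U $$ (m' * dL + r, m' * dL + s) =
        (\<Sum>k<dB. \<Sum>l<dB. choi_kernel dA N (j, k) (i, l) * out_kernel dB D (m' * dL + r, k) (m' * dL + s, l))"
        unfolding choi_kernel_def out_kernel_def using rs m
        by (simp add: linear_superop_expand[OF D U] pair_index_less)
      then show "?c * D ?U $$ (m' * dL + r, m' * dL + s) * ?e (m * dL + r) (m * dL + s) =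
        (\<Sum>k<dB. \<Sum>l<dB. ?c * (choi_kernel dA N (j, k) (i, l) *
          (out_kernel dB D (m' * dL + r, k) (m' * dL + s, l) * ?e (m * dL + r) (m * dL + s))))"
        by (simp add: sum_distrib_left sum_distrib_right mult.assoc)
    qed
    also have "\<dots> = (\<Sum>k<dB. \<Sum>l<dB. \<Sum>r<dL. \<Sum>s<dL. ?c * (choi_kernel dA N (j, k) (i, l) *
        (out_kernel dB D (m' * dL + r, k) (m' * dL + s, l) * ?e (m * dL + r) (m * dL + s))))"
      by (rule sum_swap4)
    finally show ?thesis by (simp only: sum_distrib_left retro_kernel_def fst_conv snd_conv)
  qed
  have "retro_map dA dB dM dL E D N (basis_proj dM m) $$ (m', m') =
    (\<Sum>j<dA. \<Sum>i<dA. ?c * (\<Sum>k<dB. \<Sum>l<dB. choi_kernel dA N (j, k) (i, l) *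
      retro_kernel dL (out_kernel dB D) (out_kernel (dM * dL) E) m m' (j, k) (i, l))) / of_nat dA"
    unfolding retro_map_def loop_diag[OF bp m(2)]
    by (simp add: retro_comp_kron[OF E D N \<rho> matrix_unit_carrier m(2)] key)
  also have "(\<Sum>j<dA. \<Sum>i<dA. ?c * (\<Sum>k<dB. \<Sum>l<dB. choi_kernel dA N (j, k) (i, l) *
      retro_kernel dL (out_kernel dB D) (out_kernel (dM * dL) E) m m' (j, k) (i, l))) =
      ?c * (\<Sum>j<dA. \<Sum>i<dA. \<Sum>k<dB. \<Sum>l<dB. choi_kernel dA N (j, k) (i, l) *
      retro_kernel dL (out_kernel dB D) (out_kernel (dM * dL) E) m m' (j, k) (i, l))"
    by (simp only: sum_distrib_left)
  also have "(\<Sum>j<dA. \<Sum>i<dA. \<Sum>k<dB. \<Sum>l<dB. choi_kernel dA N (j, k) (i, l) *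
      retro_kernel dL (out_kernel dB D) (out_kernel (dM * dL) E) m m' (j, k) (i, l)) =
      pairing ({..<dA} \<times> {..<dB}) (choi_kernel dA N) (retro_kernel dL (out_kernel dB D) (out_kernel (dM * dL) E) m m')"
    unfolding pairing_def sum.cartesian_product' by (rule sum.cong[OF refl], rule sum.swap)
  finally show ?thesis by (simp add: power2_eq_square)
qed

subsection \<open>The converse bound\<close>

lemma psd_kernel_retro_kernel:
  assumes CD: "channel_kernel {..<dM * dL} B CD" and CE: "channel_kernel A {..<dM * dL} CE"
    and fin: "finite A" "finite B" and m: "m < dM" "m' < dM"
  shows "psd_kernel (A \<times> B) (retro_kernel dL CD CE m m')"
proof -
  have "psd_kernel (A \<times> {..<dL}) (\<lambda>p q. 1 * cnj 1 * CE (fst p, m * dL + snd p) (fst q, m * dL + snd q))"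
    by (rule psd_kernel_pullback[where I = "A \<times> {..<dM * dL}" and g = "\<lambda>_. 1" and h = "\<lambda>p. (fst p, m * dL + snd p)"])
      (use CE fin m in \<open>auto simp: channel_kernel_def pair_index_less\<close>)
  moreover have "psd_kernel (B \<times> {..<dL}) (\<lambda>p q. 1 * cnj 1 * CD (m' * dL + snd p, fst p) (m' * dL + snd q, fst q))"
    by (rule psd_kernel_pullback[where I = "{..<dM * dL} \<times> B" and g = "\<lambda>_. 1" and h = "\<lambda>p. (m' * dL + snd p, fst p)"])
      (use CD fin m in \<open>auto simp: channel_kernel_def pair_index_less\<close>)
  ultimately have "psd_kernel (A \<times> B) (\<lambda>p q. \<Sum>r<dL. \<Sum>s<dL.
     1 * cnj 1 * CE (fst (fst p, r), m * dL + snd (fst p, r)) (fst (fst q, s), m * dL + snd (fst q, s)) *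
     (1 * cnj 1 * CD (m' * dL + snd (snd p, r), fst (snd p, r)) (m' * dL + snd (snd q, s), fst (snd q, s))))"
    using fin by (intro psd_kernel_contract) auto
  then show ?thesis by (simp add: retro_kernel_def[abs_def] mult.commute)
qed

text \<open>Decoding \<open>m\<close> and then re-encoding \<open>g m\<close> is an honest channel from \<open>B\<close> to \<open>A\<close>.\<close>

lemma channel_kernel_retro_kernel:
  assumes CD: "channel_kernel {..<dM * dL} B CD" and CE: "channel_kernel A {..<dM * dL} CE"
    and fin: "finite A" "finite B" and g: "\<And>m. m < dM \<Longrightarrow> g m < dM"
  shows "channel_kernel A B (\<lambda>p q. \<Sum>m<dM. retro_kernel dL CD CE (g m) m p q)"
  unfolding channel_kernel_def
proof (intro conjI ballI)
  show "psd_kernel (A \<times> B) (\<lambda>p q. \<Sum>m<dM. retro_kernel dL CD CE (g m) m p q)"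
    using g by (intro psd_kernel_sum psd_kernel_retro_kernel[OF CD CE fin]) auto
  fix b b' assume b: "b \<in> B" "b' \<in> B"
  have "(\<Sum>a\<in>A. retro_kernel dL CD CE (g m) m (a, b) (a, b')) = (\<Sum>r<dL. CD (m * dL + r, b) (m * dL + r, b'))"
    if m: "m < dM" for m
  proof -
    have "(\<Sum>a\<in>A. retro_kernel dL CD CE (g m) m (a, b) (a, b')) =
       (\<Sum>r<dL. \<Sum>a\<in>A. \<Sum>s<dL. CD (m * dL + r, b) (m * dL + s, b') * CE (a, g m * dL + r) (a, g m * dL + s))"
      unfolding retro_kernel_def fst_conv snd_conv by (rule sum.swap)
    also have "\<dots> = (\<Sum>r<dL. \<Sum>s<dL. \<Sum>a\<in>A. CD (m * dL + r, b) (m * dL + s, b') * CE (a, g m * dL + r) (a, g m * dL + s))"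
      by (rule sum.cong[OF refl], rule sum.swap)
    also have "\<dots> = (\<Sum>r<dL. \<Sum>s<dL. if r = s then CD (m * dL + r, b) (m * dL + s, b') else 0)"
    proof (intro sum.cong refl)
      fix r s assume rs: "r \<in> {..<dL}" "s \<in> {..<dL}"
      \<comment> \<open>The encoder preserves the trace on every message block, so the result does
        not depend on \<open>g m\<close>: any map \<open>g\<close> of the messages is allowed,
        bijective or not.\<close>
      have "(\<Sum>a\<in>A. CE (a, g m * dL + r) (a, g m * dL + s)) = (if r = s then 1 else 0)"
        using CE rs g[OF m] by (simp add: channel_kernel_def pair_index_less)
      then show "(\<Sum>a\<in>A. CD (m * dL + r, b) (m * dL + s, b') * CE (a, g m * dL + r) (a, g m * dL + s)) =
         (if r = s then CD (m * dL + r, b) (m * dL + s, b') else 0)"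
        by (simp add: sum_distrib_left[symmetric])
    qed
    also have "\<dots> = (\<Sum>r<dL. CD (m * dL + r, b) (m * dL + r, b'))"
      by (intro sum.cong refl sum_delta_mult) auto
    finally show ?thesis .
  qed
  then have "(\<Sum>m<dM. \<Sum>a\<in>A. retro_kernel dL CD CE (g m) m (a, b) (a, b')) =
     (\<Sum>m<dM. \<Sum>r<dL. CD (m * dL + r, b) (m * dL + r, b'))" by simp
  also have "\<dots> = (\<Sum>u<dM * dL. CD (u, b) (u, b'))" by (rule sum_pair_index[symmetric])
  also have "\<dots> = (if b = b' then 1 else 0)" using CD b by (simp add: channel_kernel_def)
  finally show "(\<Sum>a\<in>A. \<Sum>m<dM. retro_kernel dL CD CE (g m) m (a, b) (a, b')) = (if b = b' then 1 else 0)"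
    by (subst sum.swap)
qed

text \<open>The lower bound is applied to the \<open>n - 1\<close> nontrivial cyclic shifts, which together cover all
  off-diagonal entries.\<close>

lemma cyclic_sum_bound:
  fixes f :: "nat \<Rightarrow> nat \<Rightarrow> real"
  assumes n: "1 \<le> n" and \<epsilon>: "0 < \<epsilon>" "\<epsilon> < 1"
    and lower: "\<And>g. (\<And>m. m < n \<Longrightarrow> g m < n) \<Longrightarrow> L \<le> (\<Sum>m<n. f (g m) m)"
    and upper: "(\<Sum>m<n. f m m) \<le> U"
    and good: "\<And>m. m < n \<Longrightarrow> (1 - \<epsilon>) * (\<Sum>m'<n. f m m') \<le> f m m"
  shows "(real n - 1) * ((1 - \<epsilon>) * L) \<le> \<epsilon> * U"
proof -
  define d where "d = (\<Sum>m<n. f m m)"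
  define T where "T = (\<Sum>m<n. \<Sum>m'<n. f m m')"
  have shift: "(\<Sum>m<n. f m m') = (\<Sum>k<n. f ((m' + k) mod n) m')" if "m' < n" for m'
  proof -
    have inj: "inj_on (\<lambda>k. (m' + k) mod n) {..<n}"
    proof (rule inj_onI)
      fix k l assume kl: "k \<in> {..<n}" "l \<in> {..<n}" "(m' + k) mod n = (m' + l) mod n"
      have "(m' + i) mod n = (if m' + i < n then m' + i else m' + i - n)" if "i < n" for i
        using that \<open>m' < n\<close> by (simp add: mod_if)
      then show "k = l" using kl that by (auto split: if_splits)
    qed
    moreover have "(\<lambda>k. (m' + k) mod n) ` {..<n} = {..<n}"
      using n by (intro endo_inj_surj inj) auto
    ultimately have "bij_betw (\<lambda>k. (m' + k) mod n) {..<n} {..<n}" by (simp add: bij_betw_def)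
    from sum.reindex_bij_betw[OF this, of "\<lambda>m. f m m'"] show ?thesis by simp
  qed
  have "T = (\<Sum>m'<n. \<Sum>m<n. f m m')" unfolding T_def by (rule sum.swap)
  also have "\<dots> = (\<Sum>m'<n. \<Sum>k<n. f ((m' + k) mod n) m')" by (simp add: shift)
  also have "\<dots> = (\<Sum>k<n. \<Sum>m'<n. f ((m' + k) mod n) m')" by (rule sum.swap)
  also have "\<dots> = d + (\<Sum>k\<in>{1..<n}. \<Sum>m'<n. f ((m' + k) mod n) m')"
  proof -
    have "{..<n} = insert 0 {1..<n}" using n by auto
    then show ?thesis by (simp add: d_def)
  qed
  also have "\<dots> \<ge> d + (\<Sum>k\<in>{1..<n}. L)"
    using n by (intro add_left_mono sum_mono lower) auto
  finally have T: "d + (real n - 1) * L \<le> T" using n by (simp add: of_nat_diff)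
  \<comment> \<open>The error condition summed over messages. With the lower bound on
    \<open>T\<close> it leaves \<open>(1 - \<epsilon>) * (n - 1) * L \<le> \<epsilon> * d\<close>,
    and then \<open>d \<le> U\<close> is inserted.\<close>
  have "(1 - \<epsilon>) * T \<le> d"
    unfolding T_def d_def sum_distrib_left[of _ _ "{..<n}"] by (intro sum_mono good[unfolded sum_distrib_left]) auto
  moreover have "(1 - \<epsilon>) * (d + (real n - 1) * L) \<le> (1 - \<epsilon>) * T" using T \<epsilon> by (intro mult_left_mono) auto
  moreover have "\<epsilon> * d \<le> \<epsilon> * U" using upper \<epsilon> by (intro mult_left_mono) (auto simp: d_def)
  ultimately show ?thesis by (simp add: algebra_simps)
qed

lemma retro_map_carrier: "retro_map dA dB dM dL E D N \<rho> \<in> carrier_mat dM dM"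
  by (simp add: retro_map_def loop_def ptrace_snd_def)

lemma trace_basis_proj_mult:
  assumes "Y \<in> carrier_mat d d" "m < d"
  shows "trace_mat (basis_proj d m * Y) = Y $$ (m, m)"
proof -
  have "trace_mat (basis_proj d m * Y) = (\<Sum>i<d. \<Sum>k<d. if m = k then (if m = i then Y $$ (m, m) else 0) else 0)"
  proof -
    have "trace_mat (basis_proj d m * Y) = (\<Sum>i<d. \<Sum>k<d. basis_proj d m $$ (i, k) * Y $$ (k, i))"
      unfolding trace_mat_def using assms(1)
      by (simp add: basis_proj_def scalar_prod_def lessThan_atLeast0)
    also have "\<dots> = (\<Sum>i<d. \<Sum>k<d. if m = k then (if m = i then Y $$ (m, m) else 0) else 0)"
      by (intro sum.cong refl) (auto simp: basis_proj_def)
    finally show ?thesis .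
  qed
  then show ?thesis using assms by (simp add: sum_delta_mult)
qed

text \<open>With positive denominators the bound on a minimum of ratios becomes one linear
  inequality per message. Both directions of the capacity formula use the error in this
  form.\<close>

lemma p_error_le_iff:
  assumes "1 \<le> dM"
    and F: "\<And>m m'. m < dM \<Longrightarrow> m' < dM \<Longrightarrow> retro_map dA dB dM dL E D N (basis_proj dM m) $$ (m', m') = complex_of_real (F m m')"
    and pos: "\<And>m. m < dM \<Longrightarrow> 0 < (\<Sum>m'<dM. F m m')"
  shows "p_error dA dB dM dL E D N \<le> \<epsilon> \<longleftrightarrow> (\<forall>m<dM. (1 - \<epsilon>) * (\<Sum>m'<dM. F m m') \<le> F m m)"
proof -
  let ?Y = "\<lambda>m. retro_map dA dB dM dL E D N (basis_proj dM m)"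
  have tr: "trace_mat (?Y m) = complex_of_real (\<Sum>m'<dM. F m m')" if "m < dM" for m
    using that by (simp add: trace_mat_carrier[OF retro_map_carrier] F)
  have "p_error dA dB dM dL E D N = 1 - Min ((\<lambda>m. F m m / (\<Sum>m'<dM. F m m')) ` {..<dM})"
    unfolding p_error_def Let_def
    by (intro arg_cong2[of _ _ _ _ minus] refl arg_cong[of _ _ Min] image_cong)
      (simp add: trace_basis_proj_mult[OF retro_map_carrier] tr F)
  also have "\<dots> \<le> \<epsilon> \<longleftrightarrow> 1 - \<epsilon> \<le> Min ((\<lambda>m. F m m / (\<Sum>m'<dM. F m m')) ` {..<dM})" by linarith
  also have "\<dots> \<longleftrightarrow> (\<forall>m<dM. 1 - \<epsilon> \<le> F m m / (\<Sum>m'<dM. F m m'))"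
  proof -
    have "(\<lambda>m. F m m / (\<Sum>m'<dM. F m m')) ` {..<dM} \<noteq> {}" using assms(1) by (auto simp: lessThan_empty_iff)
    then show ?thesis by (subst Min_ge_iff) auto
  qed
  also have "\<dots> \<longleftrightarrow> (\<forall>m<dM. (1 - \<epsilon>) * (\<Sum>m'<dM. F m m') \<le> F m m)"
    using pos by (auto simp: pos_le_divide_eq)
  finally show ?thesis .
qed

lemma retro_converse:
  assumes cp: "cp_map dA dB N" and dA: "1 \<le> dA" and dM: "1 \<le> dM" and \<epsilon>: "0 < \<epsilon>" "\<epsilon> < 1"
    and strat: "retro_strategy dA dB dM dL E D N" and err: "p_error dA dB dM dL E D N \<le> \<epsilon>"
    and bounds: "\<And>C. channel_kernel {..<dA} {..<dB} C \<Longrightarrow>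
      L \<le> Re (pairing ({..<dA} \<times> {..<dB}) (choi_kernel dA N) C) \<and> Re (pairing ({..<dA} \<times> {..<dB}) (choi_kernel dA N) C) \<le> U"
  shows "(real dM - 1) * ((1 - \<epsilon>) * L) \<le> \<epsilon> * U"
proof -
  let ?I = "{..<dA} \<times> {..<dB}"
  have E: "channel (dM * dL) dA E" and D: "channel dB (dM * dL) D" using strat by (auto simp: retro_strategy_def)
  have lin: "linear_superop (dM * dL) dA E" "linear_superop dB (dM * dL) D" "linear_superop dA dB N"
    using E D cp by (auto simp: channel_def cp_map_def)
  let ?CD = "out_kernel dB D" and ?CE = "out_kernel (dM * dL) E"
  note CD = channel_kernel_out_kernel[OF D] and CE = channel_kernel_out_kernel[OF E]
  have psd: "psd_kernel ?I (retro_kernel dL ?CD ?CE m m')" if "m < dM" "m' < dM" for m m'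
    by (rule psd_kernel_retro_kernel[OF CD CE _ _ that]) auto
  define f where "f m m' = Re (pairing ?I (choi_kernel dA N) (retro_kernel dL ?CD ?CE m m'))" for m m'
  have f: "0 \<le> pairing ?I (choi_kernel dA N) (retro_kernel dL ?CD ?CE m m')" if "m < dM" "m' < dM" for m m'
    by (rule pairing_nonneg[OF _ psd_kernel_choi_kernel[OF cp] psd[OF that]]) auto
  have entry: "retro_map dA dB dM dL E D N (basis_proj dM m) $$ (m', m') = complex_of_real (f m m' / (real dA)\<^sup>2)"
    if "m < dM" "m' < dM" for m m'
  proof -
    have "pairing ?I (choi_kernel dA N) (retro_kernel dL ?CD ?CE m m') = complex_of_real (f m m')"
      using f[OF that] by (simp add: f_def less_eq_complex_def complex_eq_iff)
    then show ?thesis by (simp add: retro_map_diag[OF lin that])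
  qed
  \<comment> \<open>Admissibility of a strategy says only that the denominators are nonzero;
    nonnegativity of the pairings supplies the sign.\<close>
  have pos: "0 < (\<Sum>m'<dM. f m m' / (real dA)\<^sup>2)" if m: "m < dM" for m
  proof -
    have "trace_mat (retro_map dA dB dM dL E D N (basis_proj dM m)) = complex_of_real (\<Sum>m'<dM. f m m' / (real dA)\<^sup>2)"
      using m by (simp add: trace_mat_carrier[OF retro_map_carrier] entry)
    moreover have "trace_mat (retro_map dA dB dM dL E D N (basis_proj dM m)) \<noteq> 0"
      using strat m by (simp add: retro_strategy_def)
    moreover have "0 \<le> (\<Sum>m'<dM. f m m' / (real dA)\<^sup>2)"
      using f m by (intro sum_nonneg divide_nonneg_nonneg) (auto simp: f_def less_eq_complex_def)
    ultimately show ?thesis by (metis less_eq_real_def of_real_0)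
  qed
  have good: "(1 - \<epsilon>) * (\<Sum>m'<dM. f m m') \<le> f m m" if "m < dM" for m
  proof -
    have "(1 - \<epsilon>) * (\<Sum>m'<dM. f m m' / (real dA)\<^sup>2) \<le> f m m / (real dA)\<^sup>2"
      using iffD1[OF p_error_le_iff[where F = "\<lambda>m m'. f m m' / (real dA)\<^sup>2", OF dM entry pos] err] that
      by simp
    then have "((1 - \<epsilon>) * (\<Sum>m'<dM. f m m')) / (real dA)\<^sup>2 \<le> f m m / (real dA)\<^sup>2"
      by (simp add: sum_divide_distrib[symmetric])
    then show ?thesis using dA by (simp add: divide_le_cancel)
  qed
  have bd: "L \<le> (\<Sum>m<dM. f (g m) m) \<and> (\<Sum>m<dM. f (g m) m) \<le> U" if g: "\<And>m. m < dM \<Longrightarrow> g m < dM" for g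
    using bounds[OF channel_kernel_retro_kernel[OF CD CE _ _ g]] by (simp add: pairing_sum_right f_def)
  show ?thesis
  proof (rule cyclic_sum_bound[OF dM \<epsilon>, where f = f])
    show "(\<Sum>m<dM. f m m) \<le> U" using bd[of "\<lambda>m. m"] by simp
    show "L \<le> (\<Sum>m<dM. f (g m) m)" if "\<And>m. m < dM \<Longrightarrow> g m < dM" for g
      using bd[OF that] by simp
  qed (rule good)
qed

subsection \<open>The optimal strategy\<close>

text \<open>The encoder reads the classical label \<open>w = m * dM + m'\<close>, made of the message and the decoded
  message, and applies the channel with kernel \<open>C w\<close> to the stored copy of \<open>B\<close>.\<close>

definition sel_kernel :: "nat \<Rightarrow> (nat \<Rightarrow> nat \<times> nat \<Rightarrow> nat \<times> nat \<Rightarrow> complex) \<Rightarrow> nat \<times> nat \<Rightarrow> nat \<times> nat \<Rightarrow> complex" where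
  "sel_kernel dB C p q = (if snd p div dB = snd q div dB
     then C (snd p div dB) (fst p, snd p mod dB) (fst q, snd q mod dB) else 0)"

text \<open>A direct sum of channels over the classical label. Positivity is a sum of pullbacks
  weighted by the indicators of the labels, and the trace condition holds within each label and is
  trivial across labels.\<close>

lemma channel_kernel_sel:
  assumes C: "\<And>w. w < n \<Longrightarrow> channel_kernel {..<dA} {..<dB} (C w)"
  shows "channel_kernel {..<dA} {..<n * dB} (sel_kernel dB C)"
  unfolding channel_kernel_def
proof (intro conjI ballI)
  have div: "u div dB < n" if "u < n * dB" for u using that by (simp add: less_mult_imp_div_less)
  have md: "u mod dB < dB" if "u < n * dB" for u using that by (cases dB) auto
  let ?g = "\<lambda>w p. if snd p div dB = w then 1 else 0 :: complex"
  let ?h = "\<lambda>p. (fst p, snd p mod dB)"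
  have "psd_kernel ({..<dA} \<times> {..<n * dB}) (\<lambda>p q. \<Sum>w<n. ?g w p * cnj (?g w q) * C w (?h p) (?h q))"
    using C md by (intro psd_kernel_sum psd_kernel_pullback[where I = "{..<dA} \<times> {..<dB}"]) (auto simp: channel_kernel_def)
  also have "?this \<longleftrightarrow> psd_kernel ({..<dA} \<times> {..<n * dB}) (sel_kernel dB C)"
  proof (rule psd_kernel_cong)
    fix p q assume pq: "p \<in> {..<dA} \<times> {..<n * dB}" "q \<in> {..<dA} \<times> {..<n * dB}"
    have "(\<Sum>w<n. ?g w p * cnj (?g w q) * C w (?h p) (?h q)) =
      (\<Sum>w<n. if snd p div dB = w then sel_kernel dB C p q else 0)"
      by (intro sum.cong refl) (auto simp: sel_kernel_def)
    also have "\<dots> = sel_kernel dB C p q" using pq div by (intro sum_delta_mult) auto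
    finally show "(\<Sum>w<n. ?g w p * cnj (?g w q) * C w (?h p) (?h q)) = sel_kernel dB C p q" .
  qed
  finally show "psd_kernel ({..<dA} \<times> {..<n * dB}) (sel_kernel dB C)" .
  fix u v assume uv: "u \<in> {..<n * dB}" "v \<in> {..<n * dB}"
  show "(\<Sum>a<dA. sel_kernel dB C (a, u) (a, v)) = (if u = v then 1 else 0)"
  proof (cases "u div dB = v div dB")
    case True
    have "(\<Sum>a<dA. C (u div dB) (a, u mod dB) (a, v mod dB)) = (if u mod dB = v mod dB then 1 else 0)"
      using C[of "u div dB"] uv div md by (simp add: channel_kernel_def)
    moreover have "u = v \<longleftrightarrow> u mod dB = v mod dB" using True by (metis div_mult_mod_eq)
    ultimately show ?thesis using True by (simp add: sel_kernel_def)
  qed (auto simp: sel_kernel_def)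
qed

lemma pair_index_eq_iff:
  assumes "x < e" "y < (e :: nat)"
  shows "m * e + x = n * e + y \<longleftrightarrow> m = n \<and> x = y"
proof
  assume eq: "m * e + x = n * e + y"
  have "(m * e + x) div e = m" "(n * e + y) div e = n" using assms by simp_all
  with eq have "m = n" by simp
  with eq show "m = n \<and> x = y" by simp
qed simp

text \<open>The decoder \<open>Y \<mapsto> (1/d) \<Sum>n. |n\<rangle>\<langle>n| \<otimes> |n\<rangle>\<langle>n| \<otimes> Y\<close>: it guesses the message at random and
  keeps both the guess and \<open>Y\<close> in \<open>L\<close>, of dimension \<open>d * dB\<close>.\<close>

definition copy_kernel :: "nat \<Rightarrow> nat \<Rightarrow> nat \<times> nat \<Rightarrow> nat \<times> nat \<Rightarrow> complex" where
  "copy_kernel d dB p q = (1 / of_nat d) * (\<Sum>n<d.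
     (if fst p = n * (d * dB) + (n * dB + snd p) then 1 else 0) *
     cnj (if fst q = n * (d * dB) + (n * dB + snd q) then 1 else 0))"

lemma copy_kernel_eq:
  assumes m: "m < d" and r: "r < d * dB" "s < d * dB" and k: "k < dB" "l < dB"
  shows "copy_kernel d dB (m * (d * dB) + r, k) (m * (d * dB) + s, l) =
     (if r = m * dB + k \<and> s = m * dB + l then 1 / of_nat d else 0)"
proof -
  have "copy_kernel d dB (m * (d * dB) + r, k) (m * (d * dB) + s, l) =
    (1 / of_nat d) * (\<Sum>n<d. if m = n then (if r = m * dB + k \<and> s = m * dB + l then 1 else 0) else 0)"
    unfolding copy_kernel_def using r k m
    by (intro arg_cong2[of _ _ _ _ times] refl sum.cong) (auto simp: pair_index_eq_iff pair_index_less)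
  then show ?thesis using m by (simp add: sum_delta_mult)
qed

lemma channel_kernel_copy:
  assumes "1 \<le> d"
  shows "channel_kernel {..<d * (d * dB)} {..<dB} (copy_kernel d dB)"
  unfolding channel_kernel_def
proof (intro conjI ballI)
  show "psd_kernel ({..<d * (d * dB)} \<times> {..<dB}) (copy_kernel d dB)"
    unfolding copy_kernel_def[abs_def]
    by (intro psd_kernel_scale psd_kernel_sum psd_kernel_rank_one) (simp add: less_eq_complex_def)
  fix k l assume kl: "k \<in> {..<dB}" "l \<in> {..<dB}"
  have "(\<Sum>u<d * (d * dB). copy_kernel d dB (u, k) (u, l)) =
     (\<Sum>m<d. \<Sum>r<d * dB. copy_kernel d dB (m * (d * dB) + r, k) (m * (d * dB) + r, l))"
    by (rule sum_pair_index)
  also have "\<dots> = (\<Sum>m<d. \<Sum>r<d * dB. if m * dB + k = r then (if k = l then 1 / of_nat d else 0) else 0)"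
    using kl by (intro sum.cong refl) (auto simp: copy_kernel_eq)
  also have "\<dots> = (\<Sum>m<d. if k = l then 1 / of_nat d else 0)"
    using kl by (intro sum.cong refl sum_delta_mult) (auto simp: pair_index_less)
  also have "\<dots> = (if k = l then 1 else 0)" using assms by simp
  finally show "(\<Sum>u<d * (d * dB). copy_kernel d dB (u, k) (u, l)) = (if k = l then 1 else 0)" .
qed

lemma retro_achievable:
  fixes dA dB dM :: nat and N :: superop
  assumes cp: "cp_map dA dB N" and dA: "1 \<le> dA" and dM: "1 \<le> dM" and \<epsilon>: "0 < \<epsilon>" "\<epsilon> < 1"
    and Cx: "channel_kernel {..<dA} {..<dB} Cx" "pairing ({..<dA} \<times> {..<dB}) (choi_kernel dA N) Cx = of_real U"
    and Cn: "channel_kernel {..<dA} {..<dB} Cn" "pairing ({..<dA} \<times> {..<dB}) (choi_kernel dA N) Cn = of_real L"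
    and UL: "0 < U" "0 \<le> L" and le: "(real dM - 1) * ((1 - \<epsilon>) * L) \<le> \<epsilon> * U"
  obtains E D where "retro_strategy dA dB dM (dM * dB) E D N" "p_error dA dB dM (dM * dB) E D N \<le> \<epsilon>"
proof -
  let ?I = "{..<dA} \<times> {..<dB}"
  let ?dL = "dM * dB"
  define C where "C w = (if w div dM = w mod dM then Cx else Cn)" for w
  let ?CE = "sel_kernel dB C" and ?CD = "copy_kernel dM dB"
  define E where "E = superop_of dA (dM * ?dL) ?CE"
  define D where "D = superop_of (dM * ?dL) dB ?CD"
  have "channel_kernel {..<dA} {..<dM * dM * dB} ?CE"
    by (rule channel_kernel_sel) (simp add: C_def Cx Cn)
  then have chE: "channel (dM * ?dL) dA E"
    unfolding E_def by (intro channel_superop_of) (simp add: mult.assoc)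
  have chD: "channel dB (dM * ?dL) D"
    unfolding D_def by (intro channel_superop_of channel_kernel_copy dM)
  have lin: "linear_superop (dM * ?dL) dA E" "linear_superop dB (dM * ?dL) D" "linear_superop dA dB N"
    using chE chD cp by (auto simp: channel_def cp_map_def)
  \<comment> \<open>The factor \<open>1 / dM\<close> is the probability of each guess,
    \<open>1 / dA\<^sup>2\<close> is the weight of the loop; neither affects the success
    ratio.\<close>
  define F where "F m m' = (if m = m' then U else L) / (real dM * (real dA)\<^sup>2)" for m m' :: nat
  have ret: "retro_kernel ?dL (out_kernel dB D) (out_kernel (dM * ?dL) E) m m' (j, k) (i, l) =
     (1 / of_nat dM) * (if m = m' then Cx else Cn) (j, k) (i, l)"
    if m: "m < dM" "m' < dM" and jk: "j < dA" "i < dA" "k < dB" "l < dB" for m m' j k i l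
  proof -
    have "retro_kernel ?dL (out_kernel dB D) (out_kernel (dM * ?dL) E) m m' (j, k) (i, l) =
      (\<Sum>r<?dL. \<Sum>s<?dL. ?CD (m' * ?dL + r, k) (m' * ?dL + s, l) * ?CE (j, m * ?dL + r) (i, m * ?dL + s))"
      unfolding retro_kernel_def D_def E_def using m jk
      by (intro sum.cong refl) (simp add: out_kernel_superop_of pair_index_less)
    also have "\<dots> = (\<Sum>r<?dL. \<Sum>s<?dL. if m' * dB + l = s then (if m' * dB + k = r then
        (1 / of_nat dM) * ?CE (j, m * ?dL + (m' * dB + k)) (i, m * ?dL + (m' * dB + l)) else 0) else 0)"
      using m jk by (intro sum.cong refl) (auto simp: copy_kernel_eq)
    also have "\<dots> = (\<Sum>r<?dL. if m' * dB + k = r then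
        (1 / of_nat dM) * ?CE (j, m * ?dL + (m' * dB + k)) (i, m * ?dL + (m' * dB + l)) else 0)"
      using m jk by (intro sum.cong refl sum_delta_mult) (auto simp: pair_index_less)
    also have "\<dots> = (1 / of_nat dM) * ?CE (j, m * ?dL + (m' * dB + k)) (i, m * ?dL + (m' * dB + l))"
      using m jk by (intro sum_delta_mult) (auto simp: pair_index_less)
    finally have eq: "retro_kernel ?dL (out_kernel dB D) (out_kernel (dM * ?dL) E) m m' (j, k) (i, l) = \<dots>" .
    \<comment> \<open>The encoder input \<open>M (M' B)\<close>, where \<open>L\<close> holds the
      guess and \<open>B\<close>, read as \<open>(M M') B\<close>, exposes the label that
      \<open>sel_kernel\<close> consults.\<close>
    have idx: "m * ?dL + (m' * dB + x) = (m * dM + m') * dB + x" for x by (simp add: algebra_simps)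
    show ?thesis unfolding eq idx using m jk by (simp add: sel_kernel_def C_def)
  qed
  have entry: "retro_map dA dB dM ?dL E D N (basis_proj dM m) $$ (m', m') = complex_of_real (F m m')"
    if m: "m < dM" "m' < dM" for m m'
  proof -
    have "pairing ?I (choi_kernel dA N) (retro_kernel ?dL (out_kernel dB D) (out_kernel (dM * ?dL) E) m m') =
      pairing ?I (choi_kernel dA N) (\<lambda>p q. (1 / of_nat dM) * (if m = m' then Cx else Cn) p q)"
    proof (rule pairing_cong)
      fix p q assume "p \<in> ?I" "q \<in> ?I"
      then have "fst p < dA" "fst q < dA" "snd p < dB" "snd q < dB" by auto
      from ret[OF m this] show "retro_kernel ?dL (out_kernel dB D) (out_kernel (dM * ?dL) E) m m' p q =
        (1 / of_nat dM) * (if m = m' then Cx else Cn) p q" by (simp only: prod.collapse)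
    qed (rule refl)
    then show ?thesis
      unfolding retro_map_diag[OF lin m] pairing_scale_right by (simp add: F_def Cx(2) Cn(2))
  qed
  have sumF: "(\<Sum>m'<dM. F m m') = (U + (real dM - 1) * L) / (real dM * (real dA)\<^sup>2)" if "m < dM" for m
  proof -
    have "(\<Sum>m'<dM. if m = m' then U else L) = (\<Sum>m'<dM. (if m = m' then U - L else 0) + L)"
      by (intro sum.cong refl) simp
    also have "\<dots> = U - L + real dM * L" using that by (simp add: sum.distrib)
    finally show ?thesis unfolding F_def sum_divide_distrib[symmetric] by (simp add: algebra_simps)
  qed
  have c: "0 < real dM * (real dA)\<^sup>2" using dA dM by simp
  have "0 \<le> (real dM - 1) * L" using dM UL by (intro mult_nonneg_nonneg) auto
  \<comment> \<open>Since \<open>U > 0\<close>, the denominators stay positive even for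
    \<open>L = 0\<close>, so the strategy is admissible.\<close>
  then have pos: "0 < (\<Sum>m'<dM. F m m')" if "m < dM" for m
    unfolding sumF[OF that] using UL c by (intro divide_pos_pos) auto
  have "trace_mat (retro_map dA dB dM ?dL E D N (basis_proj dM m)) \<noteq> 0" if "m < dM" for m
  proof -
    have "trace_mat (retro_map dA dB dM ?dL E D N (basis_proj dM m)) = complex_of_real (\<Sum>m'<dM. F m m')"
      using that by (simp add: trace_mat_carrier[OF retro_map_carrier] entry)
    then show ?thesis using pos[OF that] by (simp only: of_real_eq_0_iff)
  qed
  then have strat: "retro_strategy dA dB dM ?dL E D N" using chE chD by (simp add: retro_strategy_def)
  have "(1 - \<epsilon>) * (\<Sum>m'<dM. F m m') \<le> F m m" if "m < dM" for m
  proof -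
    have "(1 - \<epsilon>) * (U + (real dM - 1) * L) \<le> U" using le by (simp add: algebra_simps)
    then have "(1 - \<epsilon>) * (U + (real dM - 1) * L) / (real dM * (real dA)\<^sup>2) \<le> U / (real dM * (real dA)\<^sup>2)"
      using c by (intro divide_right_mono) auto
    then show ?thesis unfolding sumF[OF that] by (simp add: F_def)
  qed
  then have "p_error dA dB dM ?dL E D N \<le> \<epsilon>"
    by (intro iffD2[OF p_error_le_iff[where F = F, OF dM entry pos]]) simp_all
  with strat show ?thesis by (rule that)
qed


section \<open>Loewner inequalities for Choi operators as kernel conditions\<close>

lemma psd_kernel_divide_nat:
  assumes "1 \<le> (n :: nat)"
  shows "psd_kernel I (\<lambda>p q. K p q / of_nat n) \<longleftrightarrow> psd_kernel I K"
proof
  assume "psd_kernel I (\<lambda>p q. K p q / of_nat n)"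
  from psd_kernel_scale[OF this, of "of_nat n"] show "psd_kernel I K"
    using assms by (simp add: less_eq_complex_def)
next
  assume "psd_kernel I K"
  from psd_kernel_scale[OF this, of "1 / of_nat n"] show "psd_kernel I (\<lambda>p q. K p q / of_nat n)"
    by (simp add: less_eq_complex_def)
qed

lemma kron_max_mixed_index:
  assumes "\<sigma> \<in> carrier_mat dB dB" "a < dA" "a' < dA" "b < dB" "b' < dB"
  shows "kron (max_mixed dA) \<sigma> $$ (a * dB + b, a' * dB + b') = one_tensor (\<lambda>b b'. \<sigma> $$ (b, b')) (a, b) (a', b') / of_nat dA"
proof -
  have "max_mixed dA \<in> carrier_mat dA dA" by (simp add: max_mixed_def)
  from kron_index[OF this assms] show ?thesis using assms by (simp add: max_mixed_def one_tensor_def)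
qed

text \<open>The Choi operator and the maximally mixed state carry the same factor
  \<open>1 / dA\<close>; cancelling it leaves the dual constraint for the unnormalised
  kernel.\<close>

lemma loewner_choi_le_iff:
  assumes lin: "linear_superop dA dB N" and dA: "1 \<le> dA" and \<sigma>: "\<sigma> \<in> carrier_mat dB dB"
  shows "loewner_le (dA * dB) (choi dA dB N) (complex_of_real l \<cdot>\<^sub>m kron (max_mixed dA) \<sigma>) \<longleftrightarrow>
    psd_kernel ({..<dA} \<times> {..<dB}) (\<lambda>p q. l * one_tensor (\<lambda>b b'. \<sigma> $$ (b, b')) p q - choi_kernel dA N p q)"
proof -
  have mm: "max_mixed dA \<in> carrier_mat dA dA" by (simp add: max_mixed_def)
  have c: "choi dA dB N \<in> carrier_mat (dA * dB) (dA * dB)" by (simp add: choi_def)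
  have k: "kron (max_mixed dA) \<sigma> \<in> carrier_mat (dA * dB) (dA * dB)" by (rule kron_carrier[OF mm \<sigma>])
  have "psd (dA * dB) (complex_of_real l \<cdot>\<^sub>m kron (max_mixed dA) \<sigma> - choi dA dB N) \<longleftrightarrow>
    psd_kernel ({..<dA} \<times> {..<dB}) (\<lambda>p q. (l * one_tensor (\<lambda>b b'. \<sigma> $$ (b, b')) p q - choi_kernel dA N p q) / of_nat dA)"
  proof (rule psd_iff_psd_kernelI)
    show "complex_of_real l \<cdot>\<^sub>m kron (max_mixed dA) \<sigma> - choi dA dB N \<in> carrier_mat (dA * dB) (dA * dB)"
      by (intro minus_carrier_mat c k)
    fix a a' b b' assume "a < dA" "a' < dA" "b < dB" "b' < dB"
    then show "(complex_of_real l \<cdot>\<^sub>m kron (max_mixed dA) \<sigma> - choi dA dB N) $$ (a * dB + b, a' * dB + b') =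
      (l * one_tensor (\<lambda>b b'. \<sigma> $$ (b, b')) (a, b) (a', b') - choi_kernel dA N (a, b) (a', b')) / of_nat dA"
      using c k by (simp add: pair_index_less kron_max_mixed_index[OF \<sigma>] choi_index[OF lin] diff_divide_distrib)
  qed
  then show ?thesis using c k by (simp add: loewner_le_def psd_kernel_divide_nat[OF dA])
qed

lemma loewner_le_choi_iff:
  assumes lin: "linear_superop dA dB N" and dA: "1 \<le> dA" and \<tau>: "\<tau> \<in> carrier_mat dB dB"
  shows "loewner_le (dA * dB) (kron (max_mixed dA) \<tau>) (complex_of_real l \<cdot>\<^sub>m choi dA dB N) \<longleftrightarrow>
    psd_kernel ({..<dA} \<times> {..<dB}) (\<lambda>p q. l * choi_kernel dA N p q - one_tensor (\<lambda>b b'. \<tau> $$ (b, b')) p q)"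
proof -
  have mm: "max_mixed dA \<in> carrier_mat dA dA" by (simp add: max_mixed_def)
  have c: "choi dA dB N \<in> carrier_mat (dA * dB) (dA * dB)" by (simp add: choi_def)
  have k: "kron (max_mixed dA) \<tau> \<in> carrier_mat (dA * dB) (dA * dB)" by (rule kron_carrier[OF mm \<tau>])
  have "psd (dA * dB) (complex_of_real l \<cdot>\<^sub>m choi dA dB N - kron (max_mixed dA) \<tau>) \<longleftrightarrow>
    psd_kernel ({..<dA} \<times> {..<dB}) (\<lambda>p q. (l * choi_kernel dA N p q - one_tensor (\<lambda>b b'. \<tau> $$ (b, b')) p q) / of_nat dA)"
  proof (rule psd_iff_psd_kernelI)
    show "complex_of_real l \<cdot>\<^sub>m choi dA dB N - kron (max_mixed dA) \<tau> \<in> carrier_mat (dA * dB) (dA * dB)"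
      by (intro minus_carrier_mat c k)
    fix a a' b b' assume "a < dA" "a' < dA" "b < dB" "b' < dB"
    then show "(complex_of_real l \<cdot>\<^sub>m choi dA dB N - kron (max_mixed dA) \<tau>) $$ (a * dB + b, a' * dB + b') =
      (l * choi_kernel dA N (a, b) (a', b') - one_tensor (\<lambda>b b'. \<tau> $$ (b, b')) (a, b) (a', b')) / of_nat dA"
      using c k by (simp add: pair_index_less kron_max_mixed_index[OF \<tau>] choi_index[OF lin] diff_divide_distrib)
  qed
  then show ?thesis using c k by (simp add: loewner_le_def psd_kernel_divide_nat[OF dA])
qed

subsection \<open>Max-information, Doeblin information and the capacity\<close>

lemma mat_adjoint_index:
  assumes "A \<in> carrier_mat n n" "i < n" "j < n"
  shows "mat_adjoint A $$ (i, j) = cnj (A $$ (j, i))"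
  using assms by (simp add: mat_adjoint_def mat_of_rows_def conjugate_complex_def)

lemma mat_adjoint_carrier: "A \<in> carrier_mat n n \<Longrightarrow> mat_adjoint A \<in> carrier_mat n n"
  by (simp add: mat_adjoint_def mat_of_rows_def)

lemma elog2_pos: "0 < r \<Longrightarrow> elog2 (ereal r) = ereal (log 2 r)"
  by (simp add: elog2_def)

lemma pairing_one_tensor_matrix:
  fixes dA dB :: nat
  assumes "channel_kernel {..<dA} {..<dB} C" "\<sigma> \<in> carrier_mat dB dB"
  shows "pairing ({..<dA} \<times> {..<dB}) (one_tensor (\<lambda>b b'. \<sigma> $$ (b, b'))) C = trace_mat \<sigma>"
  unfolding trace_mat_carrier[OF assms(2)] by (rule pairing_one_tensor) (use assms in simp_all)

lemma pairing_scale_left: "pairing I (\<lambda>p q. z * K p q) L = z * pairing I K L"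
  by (simp add: pairing_def sum_distrib_left mult.assoc)

lemma psd_kernel_of_one_tensor:
  assumes "psd_kernel (A \<times> B) (one_tensor S)" "finite A" "finite B" "a \<in> A"
  shows "psd_kernel B S"
proof -
  have "psd_kernel B (\<lambda>b b'. 1 * cnj 1 * one_tensor S (a, b) (a, b'))"
    by (rule psd_kernel_pullback[where I = "A \<times> B" and g = "\<lambda>_. 1" and h = "\<lambda>b. (a, b)"]) (use assms in auto)
  then show ?thesis by (simp add: one_tensor_def)
qed

text \<open>Pairing a feasible \<open>(l, \<sigma>)\<close> with \<open>C\<close> gives
  \<open>U \<le> l\<close>, and \<open>l = U\<close>, \<open>\<sigma> = S / U\<close> is feasible.
  Here \<open>S\<close> is positive, as a state has to be, because \<open>1 \<otimes> S\<close>
  dominates the positive kernel of \<open>N\<close>.\<close>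

lemma I_max_eq:
  assumes cp: "cp_map dA dB N" and dA: "1 \<le> dA"
    and C: "channel_kernel {..<dA} {..<dB} C" "pairing ({..<dA} \<times> {..<dB}) (choi_kernel dA N) C = of_real U"
    and S: "psd_kernel ({..<dA} \<times> {..<dB}) (\<lambda>p q. one_tensor S p q - choi_kernel dA N p q)" "(\<Sum>b<dB. S b b) = of_real U"
    and U: "0 < U"
  shows "I_max dA dB N = ereal (log 2 U)"
proof -
  let ?I = "{..<dA} \<times> {..<dB}"
  have lin: "linear_superop dA dB N" using cp by (simp add: cp_map_def)
  define Q where "Q = {elog2 (ereal l) | l \<sigma>. \<sigma> \<in> states dB \<and>
     loewner_le (dA * dB) (choi dA dB N) (complex_of_real l \<cdot>\<^sub>m kron (max_mixed dA) \<sigma>)}"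
  have "ereal (log 2 U) \<le> x" if xQ: "x \<in> Q" for x
  proof -
    obtain l \<sigma> where x: "x = elog2 (ereal l)" "\<sigma> \<in> states dB"
      "loewner_le (dA * dB) (choi dA dB N) (complex_of_real l \<cdot>\<^sub>m kron (max_mixed dA) \<sigma>)"
      using xQ unfolding Q_def by blast
    have \<sigma>: "\<sigma> \<in> carrier_mat dB dB" "trace_mat \<sigma> = 1" using x(2) by (auto simp: states_def psd_def)
    have "psd_kernel ?I (\<lambda>p q. l * one_tensor (\<lambda>b b'. \<sigma> $$ (b, b')) p q - choi_kernel dA N p q)"
      using x(3) by (simp add: loewner_choi_le_iff[OF lin dA \<sigma>(1)])
    from pairing_nonneg[OF _ this, of C] C have "0 \<le> complex_of_real (l - U)"
      by (simp add: pairing_diff_left pairing_scale_left pairing_one_tensor_matrix[OF C(1) \<sigma>(1)] \<sigma>(2) channel_kernel_def)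
    then have "U \<le> l" by (simp add: less_eq_complex_def)
    then show ?thesis using U x(1) by (simp add: elog2_pos)
  qed
  moreover have "ereal (log 2 U) \<in> Q"
  proof -
    define \<sigma> where "\<sigma> = mat dB dB (\<lambda>(b, b'). (1 / of_real U) * S b b')"
    have \<sigma>: "\<sigma> \<in> carrier_mat dB dB" by (simp add: \<sigma>_def)
    have "psd_kernel ?I (one_tensor S)"
      using psd_kernel_add[OF S(1) psd_kernel_choi_kernel[OF cp]] by simp
    then have "psd_kernel {..<dB} S" by (rule psd_kernel_of_one_tensor[where a = 0]) (use dA in auto)
    then have "psd_kernel {..<dB} (\<lambda>b b'. (1 / of_real U) * S b b')"
      using U by (intro psd_kernel_scale) (auto simp: less_eq_complex_def)
    also have "?this \<longleftrightarrow> psd_kernel {..<dB} (\<lambda>b b'. \<sigma> $$ (b, b'))"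
      by (rule psd_kernel_cong) (simp add: \<sigma>_def)
    finally have "psd dB \<sigma>" using \<sigma> by (simp add: psd_iff_psd_kernel)
    moreover have "trace_mat \<sigma> = 1"
      unfolding trace_mat_carrier[OF \<sigma>] using U S(2) by (simp add: \<sigma>_def sum_divide_distrib[symmetric])
    ultimately have "\<sigma> \<in> states dB" by (simp add: states_def)
    moreover have "psd_kernel ?I (\<lambda>p q. U * one_tensor (\<lambda>b b'. \<sigma> $$ (b, b')) p q - choi_kernel dA N p q) \<longleftrightarrow>
       psd_kernel ?I (\<lambda>p q. one_tensor S p q - choi_kernel dA N p q)"
      using U by (intro psd_kernel_cong) (auto simp: one_tensor_def \<sigma>_def)
    ultimately show ?thesis
      unfolding Q_def using S(1) elog2_pos[OF U]
      unfolding mem_Collect_eq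
      by (intro exI[of _ U] exI[of _ \<sigma>] conjI) (simp_all only: loewner_choi_le_iff[OF lin dA \<sigma>])
  qed
  ultimately have "Inf Q = ereal (log 2 U)" by (intro antisym Inf_lower Inf_greatest)
  then show ?thesis by (simp add: I_max_def Q_def)
qed

text \<open>Pairing a feasible \<open>(l, \<tau>)\<close> with \<open>C\<close> gives
  \<open>1 \<le> l * L\<close>. For \<open>L = 0\<close> nothing is feasible and the infimum is
  infinite; otherwise \<open>l = 1 / L\<close>, \<open>\<tau> = S / L\<close> attains it, where
  \<open>\<tau>\<close> is Hermitian of trace 1 but possibly not positive.\<close>

lemma I_doe_eq:
  assumes cp: "cp_map dA dB N" and dA: "1 \<le> dA"
    and C: "channel_kernel {..<dA} {..<dB} C" "pairing ({..<dA} \<times> {..<dB}) (choi_kernel dA N) C = of_real L"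
    and S: "psd_kernel ({..<dA} \<times> {..<dB}) (\<lambda>p q. choi_kernel dA N p q - one_tensor S p q)" "(\<Sum>b<dB. S b b) = of_real L"
      "hermitian_kernel {..<dB} S"
    and L: "0 \<le> L"
  shows "I_doe dA dB N = (if L = 0 then \<infinity> else ereal (log 2 (1 / L)))"
proof -
  let ?I = "{..<dA} \<times> {..<dB}"
  have lin: "linear_superop dA dB N" using cp by (simp add: cp_map_def)
  define Q where "Q = {elog2 (ereal l) | l \<tau>. \<tau> \<in> aff_states dB \<and>
     loewner_le (dA * dB) (kron (max_mixed dA) \<tau>) (complex_of_real l \<cdot>\<^sub>m choi dA dB N)}"
  have lower: "\<exists>l. x = elog2 (ereal l) \<and> 1 \<le> l * L" if xQ: "x \<in> Q" for x
  proof -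
    obtain l \<tau> where x: "x = elog2 (ereal l)" "\<tau> \<in> aff_states dB"
      "loewner_le (dA * dB) (kron (max_mixed dA) \<tau>) (complex_of_real l \<cdot>\<^sub>m choi dA dB N)"
      using xQ unfolding Q_def by blast
    have \<tau>: "\<tau> \<in> carrier_mat dB dB" "trace_mat \<tau> = 1" using x(2) by (auto simp: aff_states_def)
    have "psd_kernel ?I (\<lambda>p q. l * choi_kernel dA N p q - one_tensor (\<lambda>b b'. \<tau> $$ (b, b')) p q)"
      using x(3) by (simp add: loewner_le_choi_iff[OF lin dA \<tau>(1)])
    from pairing_nonneg[OF _ this, of C] C have "0 \<le> complex_of_real (l * L - 1)"
      by (simp add: pairing_diff_left pairing_scale_left pairing_one_tensor_matrix[OF C(1) \<tau>(1)] \<tau>(2) channel_kernel_def)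
    then show ?thesis using x(1) by (auto simp: less_eq_complex_def)
  qed
  have "Inf Q = (if L = 0 then \<infinity> else ereal (log 2 (1 / L)))"
  proof (cases "L = 0")
    case True
    then have "Q = {}" using lower by fastforce
    then show ?thesis using True by (simp add: top_ereal_def)
  next
    case False
    then have L: "0 < L" using L by simp
    have "ereal (log 2 (1 / L)) \<le> x" if xQ: "x \<in> Q" for x
    proof -
      obtain l where l: "x = elog2 (ereal l)" "1 \<le> l * L" using lower[OF xQ] by auto
      then have "1 / L \<le> l" using L by (simp add: pos_divide_le_eq)
      moreover have "0 < 1 / L" using L by simp
      ultimately have "0 < l" "log 2 (1 / L) \<le> log 2 l" by (linarith, subst log_le_cancel_iff) linarith+
      then show ?thesis unfolding l(1) by (simp only: elog2_pos ereal_less_eq)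
    qed
    moreover have "ereal (log 2 (1 / L)) \<in> Q"
    proof -
      define \<tau> where "\<tau> = mat dB dB (\<lambda>(b, b'). S b b' / of_real L)"
      have \<tau>: "\<tau> \<in> carrier_mat dB dB" by (simp add: \<tau>_def)
      have "mat_adjoint \<tau> = \<tau>"
      proof (rule eq_matI)
        fix i j assume "i < dim_row \<tau>" "j < dim_col \<tau>"
        then have ij: "i < dB" "j < dB" by (auto simp: \<tau>_def)
        have "S i j = cnj (S j i)" by (rule hermitian_kernelD[OF S(3)]) (use ij in auto)
        with mat_adjoint_index[OF \<tau> ij] show "mat_adjoint \<tau> $$ (i, j) = \<tau> $$ (i, j)"
          using ij by (simp add: \<tau>_def)
      qed (use mat_adjoint_carrier[OF \<tau>] \<tau> in auto)
      moreover have "trace_mat \<tau> = 1"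
        unfolding trace_mat_carrier[OF \<tau>] using L S(2) by (simp add: \<tau>_def sum_divide_distrib[symmetric])
      ultimately have "\<tau> \<in> aff_states dB" using \<tau> by (simp add: aff_states_def)
      moreover have "psd_kernel ?I (\<lambda>p q. complex_of_real (1 / L) * choi_kernel dA N p q - one_tensor (\<lambda>b b'. \<tau> $$ (b, b')) p q)"
      proof -
        have "psd_kernel ?I (\<lambda>p q. complex_of_real (1 / L) * (choi_kernel dA N p q - one_tensor S p q))"
          using L by (intro psd_kernel_scale S(1)) (simp add: less_eq_complex_def)
        also have "?this \<longleftrightarrow> ?thesis"
          by (rule psd_kernel_cong) (auto simp: one_tensor_def \<tau>_def right_diff_distrib)
        finally show ?thesis .
      qed
      moreover have "ereal (log 2 (1 / L)) = elog2 (ereal (1 / L))" using L by (simp add: elog2_pos)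
      ultimately show ?thesis
        unfolding Q_def mem_Collect_eq
        by (intro exI[of _ "1 / L"] exI[of _ \<tau>] conjI) (simp_all only: loewner_le_choi_iff[OF lin dA \<tau>])
    qed
    ultimately have "Inf Q = ereal (log 2 (1 / L))" by (intro antisym Inf_lower Inf_greatest)
    then show ?thesis using False by simp
  qed
  then show ?thesis by (simp add: I_doe_def Q_def)
qed

text \<open>If \<open>U \<le> 0\<close>, then the positive \<open>S\<close> has zero diagonal, hence
  so has the Choi kernel, which lies below \<open>1 \<otimes> S\<close>. A positive kernel with zero
  diagonal vanishes, and \<open>N\<close> would be zero.\<close>

lemma max_pairing_pos:
  assumes cp: "cp_map dA dB N" and nz: "\<exists>X \<in> carrier_mat dA dA. N X \<noteq> 0\<^sub>m dB dB"
    and S: "psd_kernel ({..<dA} \<times> {..<dB}) (\<lambda>p q. one_tensor S p q - choi_kernel dA N p q)" "(\<Sum>b<dB. S b b) = of_real U"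
  shows "0 < U"
proof (rule ccontr)
  assume "\<not> 0 < U"
  let ?I = "{..<dA} \<times> {..<dB}"
  have lin: "linear_superop dA dB N" using cp by (simp add: cp_map_def)
  have dA: "0 < dA"
  proof (rule ccontr)
    assume "\<not> 0 < dA"
    then have "N X $$ (b, b') = 0" if "X \<in> carrier_mat dA dA" "b < dB" "b' < dB" for X b b'
      using linear_superop_expand[OF lin that] by simp
    then have "N X = 0\<^sub>m dB dB" if "X \<in> carrier_mat dA dA" for X
      using linear_superop_carrier[OF lin that] that by (intro eq_matI) auto
    with nz show False by blast
  qed
  note psdJ = psd_kernel_choi_kernel[OF cp]
  have "psd_kernel ?I (one_tensor S)" using psd_kernel_add[OF S(1) psdJ] by simp
  then have psdS: "psd_kernel {..<dB} S" by (rule psd_kernel_of_one_tensor[where a = 0]) (use dA in auto)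
  have nn: "0 \<le> S b b" if "b < dB" for b using psd_kernel_diag[OF _ psdS, of b] that by simp
  have "(\<Sum>b<dB. Re (S b b)) \<le> 0" using arg_cong[OF S(2), of Re] \<open>\<not> 0 < U\<close> by simp
  moreover have "0 \<le> (\<Sum>b<dB. Re (S b b))" using nn by (intro sum_nonneg) (auto simp: less_eq_complex_def)
  ultimately have "(\<Sum>b<dB. Re (S b b)) = 0" by simp
  then have S0: "Re (S b b) = 0" if "b < dB" for b
    using that nn by (subst (asm) sum_nonneg_eq_0_iff) (auto simp: less_eq_complex_def)
  have J0: "choi_kernel dA N p q = 0" if pq: "p \<in> ?I" "q \<in> ?I" for p q
  proof (rule psd_kernel_zero_diag[OF _ psdJ pq])
    have "0 \<le> one_tensor S p p - choi_kernel dA N p p" "0 \<le> choi_kernel dA N p p"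
      using psd_kernel_diag[OF _ S(1) pq(1)] psd_kernel_diag[OF _ psdJ pq(1)] by simp_all
    moreover have "Re (one_tensor S p p) = 0" using S0 pq(1) by (auto simp: one_tensor_def)
    ultimately show "choi_kernel dA N p p = 0" by (simp add: less_eq_complex_def complex_eq_iff)
  qed simp
  have "N X = 0\<^sub>m dB dB" if X: "X \<in> carrier_mat dA dA" for X
  proof (rule eq_matI)
    fix b b' assume "b < dim_row (0\<^sub>m dB dB :: complex mat)" "b' < dim_col (0\<^sub>m dB dB :: complex mat)"
    then have b: "b < dB" "b' < dB" by auto
    have "N X $$ (b, b') = (\<Sum>a<dA. \<Sum>a'<dA. X $$ (a, a') * choi_kernel dA N (a, b) (a', b'))"
      using linear_superop_expand[OF lin X b] by (simp add: choi_kernel_def)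
    also have "\<dots> = 0" using b by (simp add: J0)
    finally show "N X $$ (b, b') = 0\<^sub>m dB dB $$ (b, b')" using b by simp
  qed (use linear_superop_carrier[OF lin X] in auto)
  with nz show False by blast
qed

theorem theorem4:
  fixes dA dB :: nat and N :: superop and \<epsilon> :: real
  assumes "1 \<le> dA" and "1 \<le> dB"
    and "cp_map dA dB N"
    and "\<exists>X \<in> carrier_mat dA dA. N X \<noteq> 0\<^sub>m dB dB"
    and "0 < \<epsilon>" and "\<epsilon> < 1"
  shows "C_retro dA dB \<epsilon> N =
    elog2 (efloor (ereal (\<epsilon> / (1 - \<epsilon>)) * eexp2 (I_max dA dB N + I_doe dA dB N) + 1))"
proof -
  let ?A = "{..<dA}" and ?B = "{..<dB}"
  let ?I = "?A \<times> ?B" and ?J = "choi_kernel dA N"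
  note cp = assms(3) and \<epsilon> = assms(5,6)
  have ne: "?A \<noteq> {}" using assms(1) by (auto simp: lessThan_empty_iff)
  note psdJ = psd_kernel_choi_kernel[OF cp]
  have herm: "hermitian_kernel ?I ?J" by (rule psd_kernel_imp_hermitian_kernel[OF _ psdJ]) simp
  obtain Cx Sx where x: "channel_kernel ?A ?B Cx" "hermitian_kernel ?B Sx"
    "psd_kernel ?I (\<lambda>p q. one_tensor Sx p q - ?J p q)" "(\<Sum>b<dB. Sx b b) = pairing ?I ?J Cx"
    by (rule channel_kernel_duality[OF finite_lessThan finite_lessThan ne herm]) (rule that)
  \<comment> \<open>Duality is stated for maxima, so the minimum \<open>L\<close> is minus the
    maximum for \<open>- J\<close>; \<open>Sn\<close> undoes the sign of the multiplier.\<close>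
  have "hermitian_kernel ?I (\<lambda>p q. - ?J p q)"
    by (rule hermitian_kernel_uminus[OF herm])
  then obtain Cn Sm where n: "channel_kernel ?A ?B Cn" "hermitian_kernel ?B Sm"
    "psd_kernel ?I (\<lambda>p q. one_tensor Sm p q - - ?J p q)" "(\<Sum>b<dB. Sm b b) = pairing ?I (\<lambda>p q. - ?J p q) Cn"
    by (rule channel_kernel_duality[OF finite_lessThan finite_lessThan ne]) (rule that)
  have nonneg: "0 \<le> pairing ?I ?J C" if "channel_kernel ?A ?B C" for C
    using that psdJ by (intro pairing_nonneg) (auto simp: channel_kernel_def)
  define U where "U = Re (pairing ?I ?J Cx)"
  define L where "L = Re (pairing ?I ?J Cn)"
  have U: "pairing ?I ?J Cx = of_real U" and L: "pairing ?I ?J Cn = of_real L" "0 \<le> L"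
    using nonneg[OF x(1)] nonneg[OF n(1)] by (auto simp: U_def L_def less_eq_complex_def complex_eq_iff)
  have trx: "(\<Sum>b<dB. Sx b b) = of_real U" using x(4) U by simp
  define Sn where "Sn b b' = - Sm b b'" for b b'
  have one_tensorn: "one_tensor Sn p q = - one_tensor Sm p q" for p q :: "nat \<times> nat" by (simp add: one_tensor_def Sn_def)
  have psdn: "psd_kernel ?I (\<lambda>p q. ?J p q - one_tensor Sn p q)" using n(3) by (simp add: one_tensorn add.commute)
  have "pairing ?I (\<lambda>p q. - ?J p q) Cn = - pairing ?I ?J Cn" by (simp add: pairing_def sum_negf)
  then have trn: "(\<Sum>b<dB. Sn b b) = of_real L" using n(4) L by (simp add: Sn_def sum_negf)
  have hn: "hermitian_kernel ?B Sn" unfolding Sn_def[abs_def] by (rule hermitian_kernel_uminus[OF n(2)])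
  have U0: "0 < U" by (rule max_pairing_pos[OF cp assms(4) x(3) trx])
  have bounds: "L \<le> Re (pairing ?I ?J C) \<and> Re (pairing ?I ?J C) \<le> U" if C: "channel_kernel ?A ?B C" for C
  proof -
    have psdC: "psd_kernel ?I C" using C by (simp add: channel_kernel_def)
    have "0 \<le> of_real U - pairing ?I ?J C"
      using pairing_nonneg[OF _ x(3) psdC] by (simp add: pairing_diff_left pairing_one_tensor[OF _ _ C] trx)
    moreover have "0 \<le> pairing ?I ?J C - of_real L"
      using pairing_nonneg[OF _ psdn psdC] by (simp add: pairing_diff_left pairing_one_tensor[OF _ _ C] trn)
    ultimately show ?thesis by (simp add: less_eq_complex_def)
  qed
  have Imax: "I_max dA dB N = ereal (log 2 U)"
    by (rule I_max_eq[OF cp assms(1) x(1) U x(3) trx U0])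
  have Idoe: "I_doe dA dB N = (if L = 0 then \<infinity> else ereal (log 2 (1 / L)))"
    by (rule I_doe_eq[OF cp assms(1) n(1) L(1) psdn trn hn L(2)])
  \<comment> \<open>The converse holds for every \<open>dL\<close> and is already matched at
    \<open>dL = dM * dB\<close>, so the supremum runs over \<open>dM\<close> alone.\<close>
  have "(\<exists>dL E D. 1 \<le> dL \<and> retro_strategy dA dB dM dL E D N \<and> p_error dA dB dM dL E D N \<le> \<epsilon>) \<longleftrightarrow>
      (real dM - 1) * ((1 - \<epsilon>) * L) \<le> \<epsilon> * U" if dM: "1 \<le> dM" for dM
  proof
    assume "\<exists>dL E D. 1 \<le> dL \<and> retro_strategy dA dB dM dL E D N \<and> p_error dA dB dM dL E D N \<le> \<epsilon>"
    then show "(real dM - 1) * ((1 - \<epsilon>) * L) \<le> \<epsilon> * U"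
      using retro_converse[OF cp assms(1) dM \<epsilon> _ _ bounds] by blast
  next
    assume "(real dM - 1) * ((1 - \<epsilon>) * L) \<le> \<epsilon> * U"
    from retro_achievable[OF cp assms(1) dM \<epsilon> x(1) U n(1) L(1) U0 L(2) this]
    obtain E D where "retro_strategy dA dB dM (dM * dB) E D N" "p_error dA dB dM (dM * dB) E D N \<le> \<epsilon>" .
    moreover have "1 \<le> dM * dB" using dM assms(2) by simp
    ultimately show "\<exists>dL E D. 1 \<le> dL \<and> retro_strategy dA dB dM dL E D N \<and> p_error dA dB dM dL E D N \<le> \<epsilon>"
      by blast
  qed
  then have "{elog2 (ereal (real dM)) | dM dL E D.
      1 \<le> dM \<and> 1 \<le> dL \<and> retro_strategy dA dB dM dL E D N \<and> p_error dA dB dM dL E D N \<le> \<epsilon>} =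
    {elog2 (ereal (real dM)) | dM. 1 \<le> dM \<and> (real dM - 1) * ((1 - \<epsilon>) * L) \<le> \<epsilon> * U}"
    by blast
  then have C: "C_retro dA dB \<epsilon> N =
      Sup {elog2 (ereal (real dM)) | dM. 1 \<le> dM \<and> (real dM - 1) * ((1 - \<epsilon>) * L) \<le> \<epsilon> * U}"
    by (simp only: C_retro_def)
  show ?thesis
  proof (cases "L = 0")
    case True
    \<comment> \<open>For \<open>L = 0\<close> the inequality holds for every number of messages, so
      the supremum exceeds every real. On the other side \<open>\<epsilon> > 0\<close> keeps the
      product with infinity infinite.\<close>
    have "ereal B \<le> C_retro dA dB \<epsilon> N" for B :: real
    proof -
      define d where "d = nat \<lceil>2 powr B\<rceil>"
      have d: "2 powr B \<le> real d" unfolding d_def by (rule real_nat_ceiling_ge)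
      moreover have "0 < 2 powr B" by simp
      ultimately have "0 < real d" by linarith
      then have "B \<le> log 2 (real d)" using d \<open>0 < real d\<close> by (simp add: le_log_iff)
      then have "ereal B \<le> elog2 (ereal (real d))" using \<open>0 < real d\<close> by (simp add: elog2_pos)
      also have "\<dots> \<le> C_retro dA dB \<epsilon> N"
        unfolding C
      proof (rule Sup_upper, unfold mem_Collect_eq, intro exI[of _ d] conjI refl)
        show "1 \<le> d" using \<open>0 < real d\<close> by simp
        show "(real d - 1) * ((1 - \<epsilon>) * L) \<le> \<epsilon> * U" using True \<epsilon> U0 by simp
      qed
      finally show ?thesis .
    qed
    then have "C_retro dA dB \<epsilon> N = \<infinity>" by (rule ereal_top)
    moreover have "elog2 (efloor (ereal (\<epsilon> / (1 - \<epsilon>)) * eexp2 (I_max dA dB N + I_doe dA dB N) + 1)) = \<infinity>"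
      using True \<epsilon> by (simp add: Imax Idoe eexp2_def efloor_def elog2_def one_ereal_def)
    ultimately show ?thesis by simp
  next
    case False
    then have L0: "0 < L" using L(2) by simp
    \<comment> \<open>The value of \<open>dM\<close> at equality in the inequality;
      \<open>U / L\<close> is \<open>2 powr (I_max + I_doe)\<close>. As \<open>R \<ge> 1\<close>,
      its floor is itself a number of messages and attains the supremum.\<close>
    define R where "R = \<epsilon> / (1 - \<epsilon>) * (U / L) + 1"
    have R: "1 \<le> R" using \<epsilon> U0 L0 by (simp add: R_def)
    define K where "K = nat \<lfloor>R\<rfloor>"
    have K: "of_int \<lfloor>R\<rfloor> = real K" "1 \<le> K" using R by (auto simp: K_def le_nat_iff le_floor_iff)
    have "2 powr (log 2 U + log 2 (1 / L)) = U / L"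
      using U0 L0 by (simp add: powr_add)
    then have "elog2 (efloor (ereal (\<epsilon> / (1 - \<epsilon>)) * eexp2 (I_max dA dB N + I_doe dA dB N) + 1)) = elog2 (ereal (real K))"
      using False K(1) by (simp add: Imax Idoe eexp2_def efloor_def one_ereal_def R_def)
    moreover have "(real d - 1) * ((1 - \<epsilon>) * L) \<le> \<epsilon> * U \<longleftrightarrow> d \<le> K" for d :: nat
    proof -
      have "(real d - 1) * ((1 - \<epsilon>) * L) \<le> \<epsilon> * U \<longleftrightarrow> real d \<le> R"
        using \<epsilon> L0 by (simp add: R_def field_simps)
      also have "\<dots> \<longleftrightarrow> d \<le> K" using R by (simp add: K_def le_nat_iff le_floor_iff)
      finally show ?thesis .
    qed
    then have "C_retro dA dB \<epsilon> N = Sup {elog2 (ereal (real d)) | d. 1 \<le> d \<and> d \<le> K}" by (simp only: C)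
    moreover have "Sup {elog2 (ereal (real d)) | d. 1 \<le> d \<and> d \<le> K} = elog2 (ereal (real K))"
    proof (intro antisym Sup_least)
      fix x assume "x \<in> {elog2 (ereal (real d)) | d. 1 \<le> d \<and> d \<le> K}"
      then show "x \<le> elog2 (ereal (real K))" by (auto simp: elog2_pos)
    next
      have "elog2 (ereal (real K)) \<in> {elog2 (ereal (real d)) | d. 1 \<le> d \<and> d \<le> K}"
        using K(2) by blast
      then show "elog2 (ereal (real K)) \<le> Sup {elog2 (ereal (real d)) | d. 1 \<le> d \<and> d \<le> K}"
        by (rule Sup_upper)
    qed
    ultimately show ?thesis by simp
  qed
qed

end
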